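(* For every fixed real $\epsilon > 0$ there exists $t(\epsilon)$ such that for every fixed integer $t \geq t(\epsilon)$ the following holds: there is an algorithm that, given an $n$-vertex graph $G$ with average degree $d(G) \geq (2+\epsilon)g(t)$, finds a $K_{t}$-minor in $G$ in $O(n)$ time.
   Context: All graphs are finite and simple. The average degree of a graph $G$ is $d(G) = 2|E(G)|/|V(G)|$. A graph $H$ is a minor of $G$ if $H$ can be obtained from $G$ by a sequence of vertex deletions, edge deletions and edge contractions; $K_t$ denotes the complete graph on $t$ vertices. Define $g(t)$ to be the minimum number $D$ such that every graph $G$ with $d(G) \geq D$ contains a $K_t$-minor (this is known to be well defined). Finding a $K_t$-minor means outputting a sequence of vertex deletions, edge deletions and edge contractions transforming $G$ into $K_t$. The input graph is given as a list of vertices and a list of edges; the running time bound is for fixed $t$ and $\epsilon$. *)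

theory Defs
  imports Complex_Main
begin

type_synonym 'a graph = "'a set \<times> 'a set set"

abbreviation verts :: "'a graph \<Rightarrow> 'a set" where "verts \<equiv> fst"
abbreviation edges :: "'a graph \<Rightarrow> 'a set set" where "edges \<equiv> snd"

definition simple_graph :: "'a graph \<Rightarrow> bool" where
  "simple_graph G \<longleftrightarrow> finite (verts G) \<and>
     (\<forall>e\<in>edges G. \<exists>u\<in>verts G. \<exists>v\<in>verts G. u \<noteq> v \<and> e = {u, v})"

definition average_degree :: "'a graph \<Rightarrow> real" where
  "average_degree G = 2 * real (card (edges G)) / real (card (verts G))"

definition complete_graph :: "nat \<Rightarrow> nat graph" where
  "complete_graph t = ({..<t}, {{u, v} | u v. u < t \<and> v < t \<and> u \<noteq> v})"

definition isomorphic :: "'a graph \<Rightarrow> 'b graph \<Rightarrow> bool" where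
  "isomorphic G H \<longleftrightarrow>
     (\<exists>f. bij_betw f (verts G) (verts H) \<and> edges H = (\<lambda>e. f ` e) ` edges G)"

datatype 'a minor_op = Del_Vertex 'a | Del_Edge 'a 'a | Contract 'a 'a

fun applicable :: "'a minor_op \<Rightarrow> 'a graph \<Rightarrow> bool" where
  "applicable (Del_Vertex v) G \<longleftrightarrow> v \<in> verts G"
| "applicable (Del_Edge u v) G \<longleftrightarrow> {u, v} \<in> edges G"
| "applicable (Contract u v) G \<longleftrightarrow> {u, v} \<in> edges G"

text \<open>Contracting \<open>uv\<close> merges \<open>v\<close> into \<open>u\<close>: the new vertex keeps the name \<open>u\<close>. Removing \<open>uv\<close>
  first avoids a loop, and parallel edges are identified because the edges form a set.\<close>

fun apply_op :: "'a minor_op \<Rightarrow> 'a graph \<Rightarrow> 'a graph" where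
  "apply_op (Del_Vertex v) G = (verts G - {v}, {e \<in> edges G. v \<notin> e})"
| "apply_op (Del_Edge u v) G = (verts G, edges G - {{u, v}})"
| "apply_op (Contract u v) G =
     (verts G - {v}, (\<lambda>e. (\<lambda>w. if w = v then u else w) ` e) ` (edges G - {{u, v}}))"

fun transforms :: "'a minor_op list \<Rightarrow> 'a graph \<Rightarrow> 'a graph \<Rightarrow> bool" where
  "transforms [] G H \<longleftrightarrow> H = G"
| "transforms (x # xs) G H \<longleftrightarrow> applicable x G \<and> transforms xs (apply_op x G) H"

definition minor :: "'b graph \<Rightarrow> 'a graph \<Rightarrow> bool" where
  "minor H G \<longleftrightarrow> (\<exists>xs H'. transforms xs G H' \<and> isomorphic H' H)"

text \<open>Graphs on natural numbers represent all finite graphs up to isomorphism. The minimum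
  exists for every \<open>t \<ge> 3\<close>; for \<open>t \<le> 2\<close> there is none and the value is unspecified.\<close>

definition g :: "nat \<Rightarrow> real" where
  "g t = (LEAST D. \<forall>G :: nat graph.
     simple_graph G \<and> average_degree G \<ge> D \<longrightarrow> minor (complete_graph t) G)"

text \<open>The machine is a word RAM with structured control flow: registers and arrays are numbered
  (a program mentions only finitely many of them), any array cell is accessed in one time unit,
  and every instruction and every evaluation of a test costs one time unit. The parameter \<open>B\<close> of
  the semantics is the largest number that fits in a machine word; an instruction whose result
  exceeds \<open>B\<close> cannot be executed.\<close>

record state =
  reg :: "nat \<Rightarrow> nat"
  arr :: "nat \<Rightarrow> nat \<Rightarrow> nat"

datatype binop = Plus | Minus | Times | Div | Mod

fun eval_binop :: "binop \<Rightarrow> nat \<Rightarrow> nat \<Rightarrow> nat" where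
  "eval_binop Plus x y = x + y"
| "eval_binop Minus x y = x - y"
| "eval_binop Times x y = x * y"
| "eval_binop Div x y = x div y"
| "eval_binop Mod x y = x mod y"

datatype test = Less nat nat | Equal nat nat

fun holds :: "test \<Rightarrow> state \<Rightarrow> bool" where
  "holds (Less i j) s \<longleftrightarrow> reg s i < reg s j"
| "holds (Equal i j) s \<longleftrightarrow> reg s i = reg s j"

text \<open>\<open>Load i a j\<close> is \<open>r\<^sub>i := A\<^sub>a[r\<^sub>j]\<close> and \<open>Store a i j\<close> is \<open>A\<^sub>a[r\<^sub>i] := r\<^sub>j\<close>.\<close>

datatype program =
    Skip
  | Const nat nat
  | Arith nat binop nat nat
  | Load nat nat nat
  | Store nat nat nat
  | Seq program program
  | Cond test program program
  | While test program

inductive exec :: "nat \<Rightarrow> program \<Rightarrow> state \<Rightarrow> nat \<Rightarrow> state \<Rightarrow> bool" for B :: nat where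
  Skip: "exec B Skip s 1 s"
| Const: "k \<le> B \<Longrightarrow> exec B (Const i k) s 1 (s\<lparr>reg := (reg s)(i := k)\<rparr>)"
| Arith: "x = eval_binop f (reg s j) (reg s k) \<Longrightarrow> x \<le> B \<Longrightarrow>
    exec B (Arith i f j k) s 1 (s\<lparr>reg := (reg s)(i := x)\<rparr>)"
| Load: "exec B (Load i a j) s 1 (s\<lparr>reg := (reg s)(i := arr s a (reg s j))\<rparr>)"
| Store: "exec B (Store a i j) s 1
    (s\<lparr>arr := (arr s)(a := (arr s a)(reg s i := reg s j))\<rparr>)"
| Seq: "exec B p s T1 s' \<Longrightarrow> exec B q s' T2 s'' \<Longrightarrow> exec B (Seq p q) s (T1 + T2) s''"
| Cond_True: "holds b s \<Longrightarrow> exec B p s T s' \<Longrightarrow> exec B (Cond b p q) s (1 + T) s'"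
| Cond_False: "\<not> holds b s \<Longrightarrow> exec B q s T s' \<Longrightarrow> exec B (Cond b p q) s (1 + T) s'"
| While_False: "\<not> holds b s \<Longrightarrow> exec B (While b p) s 1 s"
| While_True: "holds b s \<Longrightarrow> exec B p s T1 s' \<Longrightarrow> exec B (While b p) s' T2 s'' \<Longrightarrow>
    exec B (While b p) s (1 + T1 + T2) s''"

text \<open>Vertices may have arbitrary natural numbers as names. Both lists are in arbitrary order and
  without repetition, and each edge is listed once, as an ordered pair in either orientation.\<close>

definition lists_graph :: "nat list \<Rightarrow> (nat \<times> nat) list \<Rightarrow> nat graph \<Rightarrow> bool" where
  "lists_graph vs es G \<longleftrightarrow> simple_graph G \<and>
     distinct vs \<and> set vs = verts G \<and>
     distinct (map (\<lambda>(u, v). {u, v}) es) \<and> set (map (\<lambda>(u, v). {u, v}) es) = edges G"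

definition cells :: "nat list \<Rightarrow> nat \<Rightarrow> nat" where
  "cells xs i = (if i < length xs then xs ! i else 0)"

definition input_state :: "nat list \<Rightarrow> (nat \<times> nat) list \<Rightarrow> state" where
  "input_state vs es =
     \<lparr>reg = cells [length vs, length es],
      arr = (\<lambda>_ _. 0)(0 := cells vs, 1 := cells (map fst es), 2 := cells (map snd es))\<rparr>"

text \<open>Words have \<open>O(log N)\<close> bits, where \<open>N\<close> is the largest number in the input.\<close>

definition word_bound :: "nat \<Rightarrow> nat list \<Rightarrow> (nat \<times> nat) list \<Rightarrow> nat" where
  "word_bound k vs es = (Max ({length vs, length es} \<union> set vs) + 2) ^ k"

text \<open>The output is a sequence of \<open>reg s 2\<close> operations: arrays 3, 4, 5 hold the kinds of the
  operations and their first and second operands (the latter unused for vertex deletions).\<close>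

definition decode_op :: "nat \<Rightarrow> nat \<Rightarrow> nat \<Rightarrow> nat minor_op" where
  "decode_op k u v =
     (if k = 0 then Del_Vertex u else if k = 1 then Del_Edge u v else Contract u v)"

definition output_ops :: "state \<Rightarrow> nat minor_op list" where
  "output_ops s = map (\<lambda>i. decode_op (arr s 3 i) (arr s 4 i) (arr s 5 i)) [0..<reg s 2]"

end

theory Submission
  imports Defs
begin

text \<open>
  Put \<open>L = \<lceil>g t\<rceil>\<close>; for large \<open>t\<close> this is at most \<open>(1 + \<epsilon>/2) g t\<close>, so the input has at
  least \<open>L n\<close> edges and the algorithm keeps only \<open>L n\<close> of them. It maintains a minor with at least
  \<open>L\<close> edges per vertex. Take a vertex \<open>v\<close> of degree at most \<open>2 L\<close>. If it has a neighbour
  \<open>w\<close> with fewer than \<open>L\<close> common neighbours, then the contraction of \<open>v w\<close> loses at most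
  \<open>L\<close> edges and one vertex, and takes constant time, since only the neighbours of \<open>v\<close> are moved.
  Otherwise the neighbourhood of \<open>v\<close> induces a graph of bounded size and minimum degree at least
  \<open>L \<ge> g t\<close>, whose \<open>K\<^sub>t\<close>-minor is read off a table. If no vertex has degree at most \<open>2 L\<close>,
  then there are more than \<open>L n\<close> edges and one can be deleted. Vertices whose degree may have dropped
  wait on a stack, and a potential argument bounds the number of steps by \<open>O(n)\<close>.

  Mader's theorem follows from the same contraction argument, and it makes the set in the definition
  of \<open>g\<close> nonempty. The minimum is attained because gluing two copies of a \<open>K\<^sub>t\<close>-minor-free
  graph at a vertex gives a \<open>K\<^sub>t\<close>-minor-free graph of larger average degree.
\<close>

text \<open>The factor 2 is lost between two measures of density. Having \<open>L\<close> edges per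
  vertex means average degree \<open>2 L\<close>, but the neighbourhood found at the end only has
  minimum degree \<open>L\<close>, which guarantees no more than average degree \<open>L\<close>.
  The summand \<open>\<epsilon>\<close> pays for rounding \<open>g t\<close> up to an integer; this
  is why \<open>t\<close> must be large, since \<open>g t\<close> grows with \<open>t\<close>. A
  step takes constant time because it looks at one neighbourhood of at most \<open>2 L\<close>
  vertices, and \<open>L\<close> depends on \<open>t\<close> only. The finitely many graphs of that
  size become cases of the program text, and the answer for each is fixed when the text is formed,
  so the choice may be nonconstructive. The input may have quadratically many edges, so forgotten
  edges cannot be deleted one by one in the output. The search emits only contractions and deletions
  of vertices, and the graph it stores is merely a spanning subgraph of the graph that the output
  produces. This suffices, since a complete graph has no room for further edges.\<close>

definition nbrs :: "'a graph \<Rightarrow> 'a \<Rightarrow> 'a set" where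
  "nbrs G v = {x. {v, x} \<in> edges G}"

definition pairs :: "'a set \<Rightarrow> 'a set set" where
  "pairs V = {{u, v} | u v. u \<in> V \<and> v \<in> V \<and> u \<noteq> v}"

definition graph_map :: "('a \<Rightarrow> 'b) \<Rightarrow> 'a graph \<Rightarrow> 'b graph" where
  "graph_map f G = (f ` verts G, (\<lambda>e. f ` e) ` edges G)"

definition spanning_subgraph :: "'a graph \<Rightarrow> 'a graph \<Rightarrow> bool" where
  "spanning_subgraph W H \<longleftrightarrow> verts W = verts H \<and> edges W \<subseteq> edges H"

definition induce :: "'a graph \<Rightarrow> 'a set \<Rightarrow> 'a graph" where
  "induce G S = (S, {e \<in> edges G. e \<subseteq> S})"

text \<open>The apex supplies the additional vertex in the induction on \<open>t\<close> for Mader's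
  theorem.\<close>

definition cone :: "'a \<Rightarrow> 'a graph \<Rightarrow> 'a graph" where
  "cone v G = (insert v (verts G), edges G \<union> (\<lambda>x. {v, x}) ` verts G)"

abbreviation merge :: "'a \<Rightarrow> 'a \<Rightarrow> 'a \<Rightarrow> 'a" where
  "merge u v \<equiv> (\<lambda>w. if w = v then u else w)"

subsection \<open>Basic facts on simple graphs\<close>

lemma simple_graph_iff:
  "simple_graph G \<longleftrightarrow> finite (verts G) \<and> edges G \<subseteq> pairs (verts G)"
  unfolding simple_graph_def pairs_def by blast

lemma finite_pairs: "finite V \<Longrightarrow> finite (pairs V)"
  by (rule finite_subset[of _ "Pow V"]) (auto simp: pairs_def)

lemma simple_finite_verts: "simple_graph G \<Longrightarrow> finite (verts G)"
  by (simp add: simple_graph_iff)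

lemma simple_finite_edges: "simple_graph G \<Longrightarrow> finite (edges G)"
  unfolding simple_graph_iff by (meson finite_pairs finite_subset)

lemma simple_edgeE:
  assumes "simple_graph G" "e \<in> edges G"
  obtains a b where "e = {a, b}" "a \<noteq> b" "a \<in> verts G" "b \<in> verts G"
  using assms unfolding simple_graph_def by blast

lemma simple_edge_subset: "simple_graph G \<Longrightarrow> e \<in> edges G \<Longrightarrow> e \<subseteq> verts G"
  by (auto elim: simple_edgeE)

lemma simple_edgeD:
  assumes "simple_graph G" "{u, v} \<in> edges G"
  shows "u \<noteq> v" "u \<in> verts G" "v \<in> verts G"
  using simple_edgeE[OF assms] by (auto simp: doubleton_eq_iff)

lemma nbrs_sym: "x \<in> nbrs G v \<longleftrightarrow> v \<in> nbrs G x"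
  by (simp add: nbrs_def insert_commute)

lemma nbrs_subset: "simple_graph G \<Longrightarrow> nbrs G v \<subseteq> verts G"
  by (auto simp: nbrs_def dest: simple_edgeD)

lemma nbrs_irrefl: "simple_graph G \<Longrightarrow> v \<notin> nbrs G v"
  using simple_edgeD(1)[of G v v] by (auto simp: nbrs_def)

lemma finite_nbrs: "simple_graph G \<Longrightarrow> finite (nbrs G v)"
  by (meson finite_subset nbrs_subset simple_finite_verts)

lemma pairsI: "u \<in> V \<Longrightarrow> v \<in> V \<Longrightarrow> u \<noteq> v \<Longrightarrow> {u, v} \<in> pairs V"
  unfolding pairs_def by blast

lemma simple_apply_op:
  assumes G: "simple_graph G" and app: "applicable x G"
  shows "simple_graph (apply_op x G)"
proof (cases x)
  case (Del_Vertex v)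
  have "e \<in> pairs (verts G - {v})" if e: "e \<in> edges G" "v \<notin> e" for e
  proof -
    obtain a b where "e = {a, b}" "a \<noteq> b" "a \<in> verts G" "b \<in> verts G"
      using simple_edgeE[OF G e(1)] .
    then show ?thesis using e(2) by (auto intro!: pairsI)
  qed
  then have "edges (apply_op x G) \<subseteq> pairs (verts G - {v})" unfolding Del_Vertex by auto
  then show ?thesis using G Del_Vertex unfolding simple_graph_iff by simp
next
  case (Del_Edge u v)
  then show ?thesis using G unfolding simple_graph_iff by auto
next
  case (Contract u v)
  with app have uv: "{u, v} \<in> edges G" by simp
  note d = simple_edgeD[OF G uv]
  have "merge u v ` e \<in> pairs (verts G - {v})" if e: "e \<in> edges G - {{u, v}}" for e
  proof -
    obtain a b where ab: "e = {a, b}" "a \<noteq> b" "a \<in> verts G" "b \<in> verts G"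
      using simple_edgeE[OF G] e by blast
    have "merge u v a \<noteq> merge u v b" using ab e by auto
    moreover have "merge u v a \<in> verts G - {v}" "merge u v b \<in> verts G - {v}"
      using ab d by auto
    moreover have "merge u v ` e = {merge u v a, merge u v b}" using ab(1) by blast
    ultimately show ?thesis using pairsI[of "merge u v a" _ "merge u v b"] by simp
  qed
  then have "edges (apply_op x G) \<subseteq> pairs (verts G - {v})" unfolding Contract by auto
  then show ?thesis using G Contract unfolding simple_graph_iff by simp
qed

section \<open>Sequences of operations and complete minors\<close>

lemma transforms_append:
  "transforms (xs @ ys) G H \<longleftrightarrow> (\<exists>K. transforms xs G K \<and> transforms ys K H)"
  by (induction xs arbitrary: G) auto

lemma simple_transforms: "simple_graph G \<Longrightarrow> transforms xs G H \<Longrightarrow> simple_graph H"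
proof (induction xs arbitrary: G)
  case (Cons x xs)
  then show ?case using Cons.IH[of "apply_op x G"] simple_apply_op[of G x] by simp
qed simp

text \<open>Applicability only asks for the presence of a vertex or an edge, and every operation
  acts on the edges one at a time, so it is monotone in the edge set.\<close>

lemma spanning_apply_op:
  assumes "spanning_subgraph W H" "applicable x W"
  shows "applicable x H \<and> spanning_subgraph (apply_op x W) (apply_op x H)"
  using assms by (cases x) (auto simp: spanning_subgraph_def)

lemma spanning_transforms:
  assumes "transforms xs W K" "spanning_subgraph W H"
  shows "\<exists>K'. transforms xs H K' \<and> spanning_subgraph K K'"
  using assms
proof (induction xs arbitrary: W H)
  case (Cons x xs)
  then show ?case
    using spanning_apply_op[of W H x] Cons.IH[of "apply_op x W" "apply_op x H"] by simp
qed auto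

lemma card_verts_transforms:
  assumes "transforms xs G H" "simple_graph G" shows "card (verts H) \<le> card (verts G)"
  using assms
proof (induction xs arbitrary: G)
  case (Cons x xs)
  have "card (verts (apply_op x G)) \<le> card (verts G)"
    using simple_finite_verts[OF Cons.prems(2)] by (cases x) (auto intro: card_mono)
  moreover have "card (verts H) \<le> card (verts (apply_op x G))"
    using Cons simple_apply_op[OF Cons.prems(2)] by simp
  ultimately show ?case by simp
qed auto

lemma pairs_image: "inj_on f V \<Longrightarrow> (\<lambda>e. f ` e) ` pairs V = pairs (f ` V)"
  unfolding pairs_def
  by (auto simp: image_iff inj_on_def) (metis image_empty image_insert)+

lemma complete_graph_pairs: "complete_graph t = ({..<t}, pairs {..<t})"
  by (auto simp: complete_graph_def pairs_def)

lemma inj_on_image_Pow: "inj_on f V \<Longrightarrow> inj_on (\<lambda>e. f ` e) (Pow V)"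
  by (auto intro!: inj_onI dest: inj_on_image_eq_iff)

text \<open>Every bijection between the vertex sets of two complete graphs is an isomorphism, so
  only the number of vertices and completeness matter. Later arguments work with this form.\<close>

lemma isomorphic_complete_iff:
  assumes G: "simple_graph G"
  shows "isomorphic G (complete_graph t) \<longleftrightarrow> card (verts G) = t \<and> edges G = pairs (verts G)"
proof
  assume "isomorphic G (complete_graph t)"
  then obtain f where f: "bij_betw f (verts G) {..<t}"
    and e: "pairs {..<t} = (\<lambda>e. f ` e) ` edges G"
    unfolding isomorphic_def complete_graph_pairs by auto
  have inj: "inj_on f (verts G)" and img: "f ` verts G = {..<t}"
    using f by (auto simp: bij_betw_def)
  have "(\<lambda>e. f ` e) ` pairs (verts G) = (\<lambda>e. f ` e) ` edges G"
    using pairs_image[OF inj] e img by simp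
  moreover have "edges G \<subseteq> Pow (verts G)" "pairs (verts G) \<subseteq> Pow (verts G)"
    using simple_edge_subset[OF G] by (auto simp: pairs_def)
  \<comment> \<open>Taking images under \<open>f\<close> is injective on sets of vertices, so equal
    images force equal edge sets.\<close>
  ultimately have "pairs (verts G) = edges G"
    using inj_on_image_eq_iff[OF inj_on_image_Pow[OF inj]] by metis
  then show "card (verts G) = t \<and> edges G = pairs (verts G)"
    using bij_betw_same_card[OF f] by simp
next
  assume a: "card (verts G) = t \<and> edges G = pairs (verts G)"
  obtain f where f: "bij_betw f (verts G) {..<t}"
    using ex_bij_betw_finite_nat[OF simple_finite_verts[OF G]] a by (auto simp: atLeast0LessThan)
  then have "pairs {..<t} = (\<lambda>e. f ` e) ` edges G"
    using pairs_image[of f "verts G"] a by (simp add: bij_betw_def)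
  then show "isomorphic G (complete_graph t)"
    using f unfolding isomorphic_def complete_graph_pairs by auto
qed

lemma minor_complete_iff:
  assumes "simple_graph G"
  shows "minor (complete_graph t) G \<longleftrightarrow>
    (\<exists>xs H. transforms xs G H \<and> card (verts H) = t \<and> edges H = pairs (verts H))"
  using isomorphic_complete_iff simple_transforms[OF assms] unfolding minor_def by blast

lemma minor_transforms: "transforms xs G K \<Longrightarrow> minor Q K \<Longrightarrow> minor Q G"
  unfolding minor_def using transforms_append by blast

lemma minor_apply_op: "applicable x G \<Longrightarrow> minor Q (apply_op x G) \<Longrightarrow> minor Q G"
  using minor_transforms[of "[x]"] by simp

lemma complete_spanning:
  assumes "spanning_subgraph K K'" "simple_graph K'" "edges K = pairs (verts K)"
  shows "edges K' = pairs (verts K')"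
  using assms by (auto simp: spanning_subgraph_def simple_graph_iff)

lemma minor_complete_spanning:
  assumes "spanning_subgraph W G" "simple_graph G" "simple_graph W"
    "minor (complete_graph t) W"
  shows "minor (complete_graph t) G"
proof -
  obtain xs K where K: "transforms xs W K" "card (verts K) = t" "edges K = pairs (verts K)"
    using assms minor_complete_iff by blast
  obtain K' where K': "transforms xs G K'" "spanning_subgraph K K'"
    using spanning_transforms K assms by blast
  have "edges K' = pairs (verts K')"
    using complete_spanning[OF K'(2)] K simple_transforms[OF assms(2) K'(1)] by blast
  then show ?thesis
    using minor_complete_iff[OF assms(2)] K' K by (metis spanning_subgraph_def)
qed

text \<open>The vertices outside \<open>S\<close> are deleted one at a time, and each takes its
  edges along.\<close>

lemma transforms_induce:
  assumes G: "simple_graph G" and S: "S \<subseteq> verts G"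
  shows "\<exists>xs. transforms xs G (induce G S)"
proof -
  have "finite (verts G - S)" using G by (simp add: simple_finite_verts)
  then show ?thesis using G S
  proof (induction "verts G - S" arbitrary: G rule: finite_induct)
    case empty
    then have "S = verts G" by auto
    then have "induce G S = G"
      using simple_edge_subset[OF empty(2)] by (auto simp: induce_def prod_eq_iff)
    then show ?case by (metis transforms.simps(1))
  next
    case (insert x F)
    let ?G = "apply_op (Del_Vertex x) G"
    have x: "x \<in> verts G" "x \<notin> S" using insert.hyps(4) by auto
    have "F = verts ?G - S" using insert.hyps(2,4) by auto
    moreover have "simple_graph ?G" by (rule simple_apply_op[OF insert.prems(1)]) (use x in simp)
    moreover have "S \<subseteq> verts ?G" using insert.prems(2) x by auto
    ultimately obtain xs where "transforms xs ?G (induce ?G S)"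
      using insert.hyps(3) by blast
    moreover have "induce ?G S = induce G S" using x by (auto simp: induce_def)
    ultimately have "transforms (Del_Vertex x # xs) G (induce G S)" using x by simp
    then show ?case by blast
  qed
qed

lemma simple_induce: "simple_graph G \<Longrightarrow> S \<subseteq> verts G \<Longrightarrow> simple_graph (induce G S)"
  using simple_transforms transforms_induce by blast

lemma nbrs_induce: "w \<in> S \<Longrightarrow> nbrs (induce G S) w = nbrs G w \<inter> S"
  by (auto simp: nbrs_def induce_def)

subsection \<open>Renaming vertices\<close>

lemma simple_graph_map:
  assumes "simple_graph G" "inj_on f (verts G)" shows "simple_graph (graph_map f G)"
  using assms pairs_image[OF assms(2)] unfolding simple_graph_iff graph_map_def by auto

text \<open>Injectivity on the vertices carries over to sets of vertices. Hence no two edges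
  collapse, and removing a vertex or an edge commutes with renaming.\<close>

lemma graph_map_apply_op:
  assumes G: "simple_graph G" and inj: "inj_on f (verts G)" and app: "applicable x G"
  shows "applicable (map_minor_op f x) (graph_map f G)"
    and "apply_op (map_minor_op f x) (graph_map f G) = graph_map f (apply_op x G)"
proof -
  have E: "edges G \<subseteq> Pow (verts G)" using simple_edge_subset[OF G] by auto
  have diff: "(\<lambda>e. f ` e) ` edges G - {f ` {u, v}} = (\<lambda>e. f ` e) ` (edges G - {{u, v}})"
    if "{u, v} \<in> edges G" for u v
    using inj_on_image_set_diff[OF inj_on_image_Pow[OF inj], of "edges G" "{{u, v}}"] E that
    by auto
  show "applicable (map_minor_op f x) (graph_map f G)"
    using app by (cases x) (auto simp: graph_map_def intro: rev_image_eqI)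
  show "apply_op (map_minor_op f x) (graph_map f G) = graph_map f (apply_op x G)"
  proof (cases x)
    case (Del_Vertex v)
    then have v: "v \<in> verts G" using app by simp
    have "f v \<in> f ` e \<longleftrightarrow> v \<in> e" if "e \<in> edges G" for e
      using inj_on_image_mem_iff[OF inj v] E that by blast
    then have "{e \<in> (\<lambda>e. f ` e) ` edges G. f v \<notin> e} = (\<lambda>e. f ` e) ` {e \<in> edges G. v \<notin> e}"
      by auto
    then show ?thesis
      using Del_Vertex inj_on_image_set_diff[OF inj, of "verts G" "{v}"] v
      by (simp add: graph_map_def)
  next
    case (Del_Edge u v)
    then show ?thesis using diff[of u v] app by (simp add: graph_map_def)
  next
    case (Contract u v)
    then have uv: "{u, v} \<in> edges G" using app by simp
    note d = simple_edgeD[OF G uv]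
    have c: "merge (f u) (f v) ` f ` e = f ` merge u v ` e" if "e \<in> edges G" for e
    proof -
      have "merge (f u) (f v) (f y) = f (merge u v y)" if "y \<in> e" for y
        using inj_onD[OF inj, of y v] d(3) \<open>e \<in> edges G\<close> E that by auto
      then show ?thesis unfolding image_image by (rule image_cong[OF refl])
    qed
    have "verts (apply_op (map_minor_op f x) (graph_map f G)) = verts (graph_map f (apply_op x G))"
      using Contract inj_on_image_set_diff[OF inj, of "verts G" "{v}"] d(3)
      by (simp add: graph_map_def)
    moreover have "edges (apply_op (map_minor_op f x) (graph_map f G)) =
      (\<lambda>e. merge (f u) (f v) ` e) ` (\<lambda>e. f ` e) ` (edges G - {{u, v}})"
      using Contract diff[OF uv] by (simp add: graph_map_def)
    moreover have "\<dots> = edges (graph_map f (apply_op x G))"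
      using Contract c by (simp add: graph_map_def image_image)
    ultimately show ?thesis by (simp add: prod_eq_iff)
  qed
qed

lemma verts_apply_op: "verts (apply_op x G) \<subseteq> verts G"
  by (cases x) auto

lemma verts_transforms: "transforms xs G H \<Longrightarrow> verts H \<subseteq> verts G"
proof (induction xs arbitrary: G)
  case (Cons x xs)
  then show ?case using Cons.IH[of "apply_op x G"] verts_apply_op[of x G] by force
qed simp

lemma graph_map_transforms:
  assumes "simple_graph G" "inj_on f (verts G)" "transforms xs G H"
  shows "transforms (map (map_minor_op f) xs) (graph_map f G) (graph_map f H)"
  using assms
proof (induction xs arbitrary: G)
  case (Cons x xs)
  have x: "applicable x G" "transforms xs (apply_op x G) H" using Cons.prems(3) by auto
  have "inj_on f (verts (apply_op x G))"
    by (rule inj_on_subset[OF Cons.prems(2) verts_apply_op])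
  then show ?case
    using Cons.IH[OF simple_apply_op[OF Cons.prems(1) x(1)] _ x(2)]
      graph_map_apply_op[OF Cons.prems(1,2) x(1)] by simp
qed auto

lemma minor_complete_graph_map:
  assumes G: "simple_graph G" and inj: "inj_on f (verts G)" and m: "minor (complete_graph t) G"
  shows "minor (complete_graph t) (graph_map f G)"
proof -
  obtain xs H where H: "transforms xs G H" "card (verts H) = t" "edges H = pairs (verts H)"
    using m minor_complete_iff[OF G] by blast
  have inj': "inj_on f (verts H)" using inj verts_transforms[OF H(1)] inj_on_subset by blast
  have "card (verts (graph_map f H)) = t"
    "edges (graph_map f H) = pairs (verts (graph_map f H))"
    using H pairs_image[OF inj'] card_image[OF inj'] by (auto simp: graph_map_def)
  then show ?thesis
    using graph_map_transforms[OF G inj H(1)] minor_complete_iff[OF simple_graph_map[OF G inj]]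
    by blast
qed

lemma graph_map_id:
  assumes "simple_graph G" "\<And>x. x \<in> verts G \<Longrightarrow> f x = x" shows "graph_map f G = G"
proof -
  have "f ` e = e" if "e \<in> edges G" for e
    using simple_edge_subset[OF assms(1) that] assms(2) by force
  then show ?thesis using assms(2) by (auto simp: graph_map_def prod_eq_iff image_iff)
qed

text \<open>The converse renames back along the inverse of \<open>f\<close>.\<close>

lemma minor_complete_graph_map_iff:
  assumes G: "simple_graph G" and inj: "inj_on f (verts G)"
  shows "minor (complete_graph t) (graph_map f G) \<longleftrightarrow> minor (complete_graph t) G"
proof
  let ?h = "inv_into (verts G) f"
  assume "minor (complete_graph t) (graph_map f G)"
  moreover have "inj_on ?h (verts (graph_map f G))"
    by (simp add: graph_map_def inj_on_inv_into)
  ultimately have "minor (complete_graph t) (graph_map ?h (graph_map f G))"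
    using minor_complete_graph_map simple_graph_map[OF G inj] by blast
  moreover have "graph_map ?h (graph_map f G) = graph_map (\<lambda>x. ?h (f x)) G"
    by (simp add: graph_map_def image_image)
  moreover have "\<dots> = G" using inj by (intro graph_map_id G) simp
  ultimately show "minor (complete_graph t) G" by simp
qed (use minor_complete_graph_map[OF G inj] in blast)

subsection \<open>Counting edges\<close>

lemma card_incident:
  assumes G: "simple_graph G"
  shows "card {e \<in> edges G. v \<in> e} = card (nbrs G v)"
proof -
  have "e \<in> (\<lambda>x. {v, x}) ` nbrs G v" if e: "e \<in> edges G" "v \<in> e" for e
  proof -
    obtain a b where ab: "e = {a, b}" "a \<noteq> b" using simple_edgeE[OF G e(1)] by metis
    then have "e = {v, if v = a then b else a}" using e(2) by auto
    then show ?thesis using e(1) by (auto simp: nbrs_def simp del: insert_iff)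
  qed
  then have "{e \<in> edges G. v \<in> e} = (\<lambda>x. {v, x}) ` nbrs G v" by (auto simp: nbrs_def)
  then show ?thesis by (simp add: card_image inj_on_def doubleton_eq_iff)
qed

text \<open>Double counting of incidences: every edge has exactly two ends.\<close>

lemma handshake:
  assumes G: "simple_graph G"
  shows "(\<Sum>v\<in>verts G. card (nbrs G v)) = 2 * card (edges G)"
proof -
  have "(\<Sum>v\<in>verts G. card {e \<in> edges G. v \<in> e}) = 2 * card (edges G)"
  proof (rule sum_multicount)
    show "\<forall>e\<in>edges G. card {v \<in> verts G. v \<in> e} = 2"
    proof
      fix e assume e: "e \<in> edges G"
      obtain a b where ab: "e = {a, b}" "a \<noteq> b" "a \<in> verts G" "b \<in> verts G"
        using simple_edgeE[OF G e] .
      then have "{v \<in> verts G. v \<in> e} = {a, b}" by auto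
      then show "card {v \<in> verts G. v \<in> e} = 2" using ab by simp
    qed
  qed (use simple_finite_verts[OF G] simple_finite_edges[OF G] in auto)
  then show ?thesis by (simp add: card_incident[OF G])
qed

lemma min_degree_edges:
  assumes G: "simple_graph G" and d: "\<And>v. v \<in> verts G \<Longrightarrow> d \<le> card (nbrs G v)"
  shows "d * card (verts G) \<le> 2 * card (edges G)"
  using sum_bounded_below[of "verts G" d "\<lambda>v. card (nbrs G v)"] d handshake[OF G]
  by (simp add: mult.commute)

text \<open>Inside the neighbourhood of \<open>v\<close>, the degree of \<open>w\<close> is the
  number of common neighbours of \<open>v\<close> and \<open>w\<close>, so the hypothesis is a
  minimum degree condition there.\<close>

lemma dense_neighbourhood:
  assumes G: "simple_graph G" and d: "\<And>w. w \<in> nbrs G v \<Longrightarrow> d \<le> card (nbrs G v \<inter> nbrs G w)"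
  shows "d * card (nbrs G v) \<le> 2 * card (edges (induce G (nbrs G v)))"
  using min_degree_edges[OF simple_induce[OF G nbrs_subset[OF G]], of v d] d
  by (simp add: induce_def[of G] nbrs_induce[unfolded induce_def] Int_commute)

text \<open>Replaces the image in \<open>apply_op\<close> by an explicit set: edges avoiding
  \<open>v\<close> stay as they are, and each further edge at \<open>v\<close> is moved to
  \<open>w\<close>.\<close>

lemma contract_edges:
  assumes G: "simple_graph G" and vw: "{w, v} \<in> edges G"
  shows "edges (apply_op (Contract w v) G) =
    {e \<in> edges G. v \<notin> e} \<union> (\<lambda>x. {w, x}) ` (nbrs G v - {w})" (is "?L = ?R")
proof
  note d = simple_edgeD[OF G vw]
  have "merge w v ` e \<in> ?R" if e: "e \<in> edges G" "e \<noteq> {w, v}" for e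
  proof (cases "v \<in> e")
    case True
    then obtain x where x: "e = {v, x}" "x \<noteq> v"
      using simple_edgeE[OF G e(1)] by (metis insert_commute empty_iff insert_iff)
    then have "x \<in> nbrs G v - {w}" using e by (auto simp: nbrs_def)
    then show ?thesis using x by auto
  next
    case False
    then have "merge w v ` e = e" by force
    then show ?thesis using False e by auto
  qed
  then show "?L \<subseteq> ?R" by auto
  have "e \<in> ?L" if "e \<in> edges G" "v \<notin> e" for e
  proof -
    have "merge w v ` e = e" using that by force
    then show ?thesis using that by force
  qed
  moreover have "{w, x} \<in> ?L" if "x \<in> nbrs G v - {w}" for x
  proof -
    have x: "x \<noteq> v" using that nbrs_irrefl[OF G] by auto
    have "merge w v ` {v, x} = {w, x}" using x by auto
    moreover have "{v, x} \<in> edges G - {{w, v}}"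
      using that x by (auto simp: nbrs_def doubleton_eq_iff)
    ultimately show ?thesis by (auto intro!: rev_image_eqI)
  qed
  ultimately show "?R \<subseteq> ?L" by auto
qed

text \<open>Besides \<open>{w, v}\<close> itself, exactly one edge is lost for each common
  neighbour, where two edges become parallel.\<close>

lemma card_contract_edges:
  assumes G: "simple_graph G" and vw: "{w, v} \<in> edges G"
  shows "card (edges (apply_op (Contract w v) G)) + card (nbrs G v \<inter> nbrs G w) + 1 = card (edges G)"
proof -
  \<comment> \<open>\<open>?B\<close> holds only those moved edges that were not present before,
    which makes the union disjoint.\<close>
  let ?A = "{e \<in> edges G. v \<notin> e}" and ?B = "(\<lambda>x. {w, x}) ` (nbrs G v - {w} - nbrs G w)"
  note fin = simple_finite_edges[OF G] finite_nbrs[OF G]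
  have "card (edges G) = card ({e \<in> edges G. v \<in> e} \<union> ?A)" by (rule arg_cong[of _ _ card]) auto
  also have "\<dots> = card (nbrs G v) + card ?A"
    using fin by (subst card_Un_disjoint) (auto simp: card_incident[OF G])
  finally have 1: "card (edges G) = card (nbrs G v) + card ?A" .
  have vb: "v \<notin> nbrs G v" "w \<noteq> v" using nbrs_irrefl[OF G] simple_edgeD[OF G vw] by auto
  have "edges (apply_op (Contract w v) G) = ?A \<union> ?B"
    unfolding contract_edges[OF G vw] using vb by (auto simp: nbrs_def)
  then have "card (edges (apply_op (Contract w v) G)) = card (?A \<union> ?B)" by simp
  also have "\<dots> = card ?A + card ?B"
    using fin by (subst card_Un_disjoint) (auto simp: nbrs_def)
  also have "card ?B = card (nbrs G v - {w} - nbrs G w)"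
    by (rule card_image) (auto simp: inj_on_def doubleton_eq_iff)
  finally have 2: "card (edges (apply_op (Contract w v) G)) = card ?A + \<dots>" .
  have w: "w \<in> nbrs G v" "w \<notin> nbrs G w"
    using vw nbrs_irrefl[OF G] by (auto simp: nbrs_def insert_commute)
  have "nbrs G v = insert w ((nbrs G v - {w} - nbrs G w) \<union> (nbrs G v \<inter> nbrs G w))" using w by auto
  then have "card (nbrs G v) = card (insert w ((nbrs G v - {w} - nbrs G w) \<union> (nbrs G v \<inter> nbrs G w)))"
    by simp
  also have "\<dots> = 1 + card (nbrs G v - {w} - nbrs G w) + card (nbrs G v \<inter> nbrs G w)"
    using fin w by (subst card_insert_disjoint) (auto simp: card_Un_disjoint disjoint_iff)
  finally show ?thesis using 1 2 by simp
qed

subsection \<open>Mader's bound\<close>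

text \<open>Contracting an edge with fewer than \<open>d\<close> common neighbours costs one vertex
  and at most \<open>d\<close> edges, so the ratio \<open>d\<close> is kept. Since the number of
  vertices falls, the process ends, and it can only end at a vertex as described.\<close>

lemma reduce_to_dense_neighbourhood:
  assumes "simple_graph G" "verts G \<noteq> {}" "d \<ge> 1" "d * card (verts G) \<le> card (edges G)"
  shows "\<exists>xs K v. transforms xs G K \<and> simple_graph K \<and> v \<in> verts K \<and> nbrs K v \<noteq> {} \<and>
    (\<forall>w\<in>nbrs K v. d \<le> card (nbrs K v \<inter> nbrs K w))"
  using assms
proof (induction "card (verts G)" arbitrary: G rule: less_induct)
  case less
  note G = less.prems(1)
  note fin = simple_finite_verts[OF G] simple_finite_edges[OF G]
  have n: "card (verts G) \<ge> 1" using less.prems(2) fin by (simp add: card_gt_0_iff Suc_leI)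
  \<comment> \<open>Here \<open>d \<ge> 1\<close> enters: it keeps the graph from running out of
    edges.\<close>
  then have "edges G \<noteq> {}" using less.prems(3,4) by (intro notI) simp
  then obtain e where "e \<in> edges G" by blast
  then obtain a b where "e = {a, b}" by (rule simple_edgeE[OF G])
  with \<open>e \<in> edges G\<close> have ab: "{a, b} \<in> edges G" by simp
  show ?case
  proof (cases "\<forall>w\<in>nbrs G a. d \<le> card (nbrs G a \<inter> nbrs G w)")
    case True
    then show ?thesis using ab simple_edgeD[OF G ab] G
      by (intro exI[of _ "[]"] exI[of _ G] exI[of _ a]) (auto simp: nbrs_def)
  next
    case False
    then obtain w where w: "w \<in> nbrs G a" "card (nbrs G a \<inter> nbrs G w) < d" by fastforce
    then have wa: "{w, a} \<in> edges G" by (simp add: nbrs_def insert_commute)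
    let ?G = "apply_op (Contract w a) G"
    have V: "verts ?G = verts G - {a}" by simp
    have a: "a \<in> verts G" "w \<in> verts G" "w \<noteq> a" using simple_edgeD[OF G wa] by auto
    have c: "card (verts ?G) + 1 = card (verts G)" using V a n fin by simp
    have sg: "simple_graph ?G" by (rule simple_apply_op[OF G]) (use wa in simp)
    have "d * card (verts ?G) + d \<le> card (edges G)"
      using less.prems(4) c by (metis add_mult_distrib2 mult.right_neutral)
    then have "d * card (verts ?G) \<le> card (edges ?G)"
      using card_contract_edges[OF G wa] w(2) by linarith
    moreover have "verts ?G \<noteq> {}" using V a by auto
    ultimately obtain xs K v where
      K: "transforms xs ?G K" "simple_graph K" "v \<in> verts K" "nbrs K v \<noteq> {}"
        "\<forall>w\<in>nbrs K v. d \<le> card (nbrs K v \<inter> nbrs K w)"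
      using less.hyps[OF _ sg _ less.prems(3)] c by (metis less_add_one)
    have "transforms (Contract w a # xs) G K" using K(1) wa by simp
    then show ?thesis using K by blast
  qed
qed

text \<open>The apex is fresh, so operations inside \<open>G\<close> leave its edges alone, except
  that contracting \<open>{a, b}\<close> identifies the two edges from the apex to \<open>a\<close>
  and \<open>b\<close>, as it should.\<close>

lemma cone_apply_op:
  assumes "simple_graph G" "applicable x G" "v \<notin> verts G"
  shows "applicable x (cone v G) \<and> apply_op x (cone v G) = cone v (apply_op x G)"
proof (cases x)
  case (Del_Vertex u)
  then have "{e \<in> edges G \<union> (\<lambda>x. {v, x}) ` verts G. u \<notin> e} =
      {e \<in> edges G. u \<notin> e} \<union> (\<lambda>x. {v, x}) ` (verts G - {u})"
    using assms by auto
  then show ?thesis using Del_Vertex assms by (auto simp: cone_def)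
next
  case (Del_Edge a b)
  then have "{a, b} \<in> edges G" using assms by simp
  then have "{a, b} \<notin> (\<lambda>x. {v, x}) ` verts G"
    using simple_edgeD[OF assms(1)] assms(3) by (auto simp: doubleton_eq_iff)
  then show ?thesis using Del_Edge assms by (auto simp: cone_def)
next
  case (Contract a b)
  then have ab: "{a, b} \<in> edges G" using assms by simp
  note d = simple_edgeD[OF assms(1) ab]
  have "{a, b} \<notin> (\<lambda>x. {v, x}) ` verts G" using d assms(3) by (auto simp: doubleton_eq_iff)
  then have "edges (cone v G) - {{a, b}} = (edges G - {{a, b}}) \<union> (\<lambda>x. {v, x}) ` verts G"
    by (auto simp: cone_def)
  moreover have "(\<lambda>e. merge a b ` e) ` (\<lambda>x. {v, x}) ` verts G = (\<lambda>x. {v, x}) ` (verts G - {b})"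
  proof -
    have "merge a b ` {v, x} = {v, merge a b x}" for x using d assms(3) by auto
    then have "(\<lambda>e. merge a b ` e) ` (\<lambda>x. {v, x}) ` verts G = (\<lambda>x. {v, x}) ` merge a b ` verts G"
      unfolding image_image by (intro image_cong[OF refl])
    moreover have "merge a b ` verts G = verts G - {b}" using d by auto
    ultimately show ?thesis by simp
  qed
  ultimately have "(\<lambda>e. merge a b ` e) ` (edges (cone v G) - {{a, b}}) =
      (\<lambda>e. merge a b ` e) ` (edges G - {{a, b}}) \<union> (\<lambda>x. {v, x}) ` (verts G - {b})"
    by (simp only: image_Un)
  then have "edges (apply_op x (cone v G)) = edges (cone v (apply_op x G))"
    unfolding Contract by (simp add: cone_def[of v "(_, _)"])
  moreover have "verts (apply_op x (cone v G)) = verts (cone v (apply_op x G))"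
    using Contract d assms(3) by (auto simp: cone_def)
  ultimately show ?thesis using Contract ab by (auto simp: cone_def prod_eq_iff)
qed

lemma cone_transforms:
  assumes "simple_graph G" "v \<notin> verts G" "transforms xs G H"
  shows "transforms xs (cone v G) (cone v H)"
  using assms
proof (induction xs arbitrary: G)
  case (Cons x xs)
  have x: "applicable x G" "transforms xs (apply_op x G) H" using Cons.prems(3) by auto
  have "v \<notin> verts (apply_op x G)" using Cons.prems(2) verts_apply_op[of x G] by blast
  then show ?case
    using Cons.IH[OF simple_apply_op[OF Cons.prems(1) x(1)] _ x(2)]
      cone_apply_op[OF Cons.prems(1) x(1) Cons.prems(2)] by simp
qed simp

lemma cone_pairs:
  assumes "edges H = pairs (verts H)" "v \<notin> verts H"
  shows "edges (cone v H) = pairs (verts (cone v H))"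
  using assms unfolding cone_def pairs_def by (auto simp: insert_commute)

lemma simple_cone:
  assumes "simple_graph G" "v \<notin> verts G" shows "simple_graph (cone v G)"
proof -
  have "pairs (verts G) \<subseteq> pairs (insert v (verts G))" unfolding pairs_def by blast
  moreover have "{v, x} \<in> pairs (insert v (verts G))" if "x \<in> verts G" for x
    by (rule pairsI) (use that assms(2) in auto)
  ultimately show ?thesis using assms(1) unfolding cone_def simple_graph_iff by auto
qed

text \<open>If \<open>d\<close> works for \<open>t\<close>, then a vertex whose neighbourhood has
  minimum degree \<open>2 * d + 1\<close> has a \<open>K_t\<close>-minor inside its neighbourhood,
  and the vertex itself completes it to \<open>K_(t+1)\<close>. The resulting constant is
  exponential in \<open>t\<close>, but only its existence matters here.\<close>

theorem mader:
  "\<exists>d. \<forall>G :: 'a graph. simple_graph G \<longrightarrow> verts G \<noteq> {} \<longrightarrow>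
     d * card (verts G) \<le> card (edges G) \<longrightarrow> minor (complete_graph t) G"
proof (induction t)
  case 0
  have "minor (complete_graph 0) G" if G: "simple_graph G" for G :: "'a graph"
  proof -
    obtain xs where "transforms xs G (induce G {})" using transforms_induce[OF G] by blast
    moreover have "card (verts (induce G {})) = 0" by (simp add: induce_def)
    moreover have "edges (induce G {}) = pairs (verts (induce G {}))"
      using G by (auto simp: induce_def pairs_def simple_graph_def)
    ultimately show ?thesis using minor_complete_iff[OF G] by blast
  qed
  then show ?case by blast
next
  case (Suc t)
  then obtain d where d: "\<And>G :: 'a graph. simple_graph G \<Longrightarrow> verts G \<noteq> {} \<Longrightarrow>
     d * card (verts G) \<le> card (edges G) \<Longrightarrow> minor (complete_graph t) G" by blast
  have "minor (complete_graph (Suc t)) G"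
    \<comment> \<open>The factor 2 turns minimum degree into edges per vertex; the summand 1 makes
      the ratio positive even for \<open>d = 0\<close>.\<close>
    if G: "simple_graph G" "verts G \<noteq> {}" "(2 * d + 1) * card (verts G) \<le> card (edges G)"
    for G :: "'a graph"
  proof -
    obtain xs K v where K: "transforms xs G K" "simple_graph K" "v \<in> verts K" "nbrs K v \<noteq> {}"
        "\<forall>w\<in>nbrs K v. 2 * d + 1 \<le> card (nbrs K v \<inter> nbrs K w)"
      using reduce_to_dense_neighbourhood[OF G(1,2) le_add2 G(3)] by metis
    let ?N = "nbrs K v"
    note sK = nbrs_subset[OF K(2), of v]
    have sN: "simple_graph (induce K ?N)" by (rule simple_induce[OF K(2) sK])
    have vN: "v \<notin> ?N" by (rule nbrs_irrefl[OF K(2)])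
    have "(2 * d + 1) * card ?N \<le> 2 * card (edges (induce K ?N))"
      using dense_neighbourhood[OF K(2), of v "2 * d + 1"] K(5) by blast
    then have "d * card (verts (induce K ?N)) \<le> card (edges (induce K ?N))"
      by (simp add: induce_def)
    then have "minor (complete_graph t) (induce K ?N)"
      using d[OF sN] K(4) by (simp add: induce_def)
    then obtain ys H where H: "transforms ys (induce K ?N) H" "card (verts H) = t"
        "edges H = pairs (verts H)"
      using minor_complete_iff[OF sN] by blast
    have vH: "v \<notin> verts H" using verts_transforms[OF H(1)] vN by (auto simp: induce_def)
    have cv: "v \<notin> verts (induce K ?N)" using vN by (simp add: induce_def)
    have "transforms ys (cone v (induce K ?N)) (cone v H)"
      by (rule cone_transforms[OF sN cv H(1)])
    moreover have "card (verts (cone v H)) = Suc t"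
      using vH H(2) simple_finite_verts[OF simple_transforms[OF sN H(1)]] by (simp add: cone_def)
    moreover have "edges (cone v H) = pairs (verts (cone v H))" by (rule cone_pairs[OF H(3) vH])
    ultimately have "minor (complete_graph (Suc t)) (cone v (induce K ?N))"
      using minor_complete_iff[OF simple_cone[OF sN cv]] by blast
    moreover have iv: "insert v ?N \<subseteq> verts K" using sK K(3) by simp
    \<comment> \<open>By the choice of the neighbourhood, all edges of the cone at its apex
      \<open>v\<close> are edges of \<open>K\<close>.\<close>
    moreover have "spanning_subgraph (cone v (induce K ?N)) (induce K (insert v ?N))"
      unfolding spanning_subgraph_def by (auto simp: cone_def induce_def nbrs_def)
    ultimately have "minor (complete_graph (Suc t)) (induce K (insert v ?N))"
      using minor_complete_spanning simple_induce[OF K(2) iv] simple_cone[OF sN cv] by blast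
    then show ?thesis
      using transforms_induce[OF K(2) iv] K(1) minor_transforms by metis
  qed
  then show ?case by blast
qed

subsection \<open>Gluing two graphs at a vertex\<close>

abbreviation minor_free :: "nat \<Rightarrow> 'a graph \<Rightarrow> bool" where
  "minor_free t G \<equiv> simple_graph G \<and> \<not> minor (complete_graph t) G"

text \<open>Designed to be closed under the three operations. Edges of the parts may be missing in
  \<open>G\<close>, so that deleting an edge leaves the parts as they are, and the parts overlap in
  at most one vertex.\<close>

definition glued :: "nat \<Rightarrow> 'a graph \<Rightarrow> bool" where
  "glued t G \<longleftrightarrow> (\<exists>A B. minor_free t A \<and> minor_free t B \<and> verts G = verts A \<union> verts B \<and>
     edges G \<subseteq> edges A \<union> edges B \<and> (\<forall>x\<in>verts A \<inter> verts B. \<forall>y\<in>verts A \<inter> verts B. x = y))"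

lemma gluedI:
  "minor_free t A \<Longrightarrow> minor_free t B \<Longrightarrow> verts G = verts A \<union> verts B \<Longrightarrow>
   edges G \<subseteq> edges A \<union> edges B \<Longrightarrow>
   (\<And>x y. x \<in> verts A \<inter> verts B \<Longrightarrow> y \<in> verts A \<inter> verts B \<Longrightarrow> x = y) \<Longrightarrow> glued t G"
  unfolding glued_def by blast

text \<open>Stated for every \<open>x\<close>, because a vertex deleted from a glued graph may lie
  in one part only; the other part is then unchanged.\<close>

lemma minor_free_delete:
  assumes "minor_free t A"
  shows "minor_free t (verts A - {x}, {e \<in> edges A. x \<notin> e})"
proof (cases "x \<in> verts A")
  case True
  then have "applicable (Del_Vertex x) A" by simp
  from minor_apply_op[OF this, of "complete_graph t"] simple_apply_op[OF _ this]
  show ?thesis using assms by auto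
next
  case False
  then have "(verts A - {x}, {e \<in> edges A. x \<notin> e}) = A"
    using assms simple_edge_subset[of A] by (auto simp: prod_eq_iff)
  then show ?thesis using assms by simp
qed

text \<open>The part containing the edge is contracted, while the other part is merely renamed, with
  \<open>u\<close> in place of \<open>v\<close>, and renaming creates no minor.\<close>

lemma glued_contract:
  assumes A: "minor_free t A" and B: "minor_free t B"
    and G: "simple_graph G" "verts G = verts A \<union> verts B" "edges G \<subseteq> edges A \<union> edges B"
    and one: "\<And>x y. x \<in> verts A \<inter> verts B \<Longrightarrow> y \<in> verts A \<inter> verts B \<Longrightarrow> x = y"
    and uv: "{u, v} \<in> edges A"
  shows "glued t (apply_op (Contract u v) G)"
proof -
  let ?A = "apply_op (Contract u v) A" and ?B = "graph_map (merge u v) B"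
  have d: "u \<noteq> v" "u \<in> verts A" "v \<in> verts A" using simple_edgeD[OF _ uv] A by auto
  have app: "applicable (Contract u v) A" using uv by simp
  \<comment> \<open>Both \<open>u\<close> and \<open>v\<close> lie in \<open>A\<close>, so at most
    one of them is in \<open>B\<close>.\<close>
  have inj: "inj_on (merge u v) (verts B)" using one[of u v] d by (auto simp: inj_on_def)
  have fA: "minor_free t ?A"
    using A minor_apply_op[OF app, of "complete_graph t"] simple_apply_op[OF _ app] by blast
  have fB: "minor_free t ?B"
    using B minor_complete_graph_map_iff[OF _ inj] simple_graph_map[OF _ inj] by blast
  have V: "verts ?A = verts A - {v}" "verts ?B = merge u v ` verts B"
    "verts (apply_op (Contract u v) G) = verts G - {v}"
    by (auto simp: graph_map_def)
  have E: "edges ?A = (\<lambda>e. merge u v ` e) ` (edges A - {{u, v}})"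
    "edges ?B = (\<lambda>e. merge u v ` e) ` edges B"
    "edges (apply_op (Contract u v) G) = (\<lambda>e. merge u v ` e) ` (edges G - {{u, v}})"
    by (auto simp: graph_map_def)
  show ?thesis
  proof (rule gluedI[OF fA fB])
    show "verts (apply_op (Contract u v) G) = verts ?A \<union> verts ?B"
      unfolding V G(2) using d by auto
    show "edges (apply_op (Contract u v) G) \<subseteq> edges ?A \<union> edges ?B"
      unfolding E using G(3) by blast
    show "x = y" if xy: "x \<in> verts ?A \<inter> verts ?B" "y \<in> verts ?A \<inter> verts ?B" for x y
    proof -
      \<comment> \<open>A common vertex after the contraction either was common before, or it is
        \<open>u\<close> and replaces the common vertex \<open>v\<close>.\<close>
      have "z = merge u v v \<and> v \<in> verts A \<inter> verts B \<or> z \<in> verts A \<inter> verts B \<and> z \<noteq> v"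
        if "z \<in> verts ?A \<inter> verts ?B" for z
        using that d unfolding V Int_iff by (elim conjE imageE) (auto split: if_splits)
      from this[OF xy(1)] this[OF xy(2)] show ?thesis using one[of x y] one[of v x] one[of v y] by auto
    qed
  qed
qed

lemma glued_apply_op:
  assumes g: "glued t G" and G: "simple_graph G" and app: "applicable x G"
  shows "glued t (apply_op x G)"
proof -
  obtain A B where AB: "minor_free t A" "minor_free t B" "verts G = verts A \<union> verts B"
    "edges G \<subseteq> edges A \<union> edges B"
    and one: "\<And>x y. x \<in> verts A \<inter> verts B \<Longrightarrow> y \<in> verts A \<inter> verts B \<Longrightarrow> x = y"
    using g unfolding glued_def by blast
  show ?thesis
  proof (cases x)
    case (Del_Vertex v)
    show ?thesis unfolding Del_Vertex
      by (rule gluedI[OF minor_free_delete[OF AB(1), of v] minor_free_delete[OF AB(2), of v]])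
        (use AB(3,4) one in auto)
  next
    case (Del_Edge u v)
    show ?thesis unfolding Del_Edge by (rule gluedI[OF AB(1,2)]) (use AB(3,4) one in auto)
  next
    case (Contract u v)
    then have "{u, v} \<in> edges A \<or> {u, v} \<in> edges B" using app AB(4) by auto
    then show ?thesis
    proof
      assume "{u, v} \<in> edges A"
      then show ?thesis using glued_contract[OF AB(1,2) G AB(3,4) one] Contract by simp
    next
      assume "{u, v} \<in> edges B"
      moreover have "verts G = verts B \<union> verts A" "edges G \<subseteq> edges B \<union> edges A" using AB by auto
      ultimately show ?thesis
        using glued_contract[OF AB(2,1) G, of u v] one Contract by (simp add: Int_commute)
    qed
  qed
qed

lemma glued_transforms:
  assumes "transforms xs G H" "glued t G" "simple_graph G" shows "glued t H"
  using assms
proof (induction xs arbitrary: G)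
  case (Cons x xs)
  then show ?case
    using Cons.IH[of "apply_op x G"] glued_apply_op[of t G x] simple_apply_op[of G x] by simp
qed simp

text \<open>A part contained in the other one has at most one vertex and hence no edge, so all of
  \<open>H\<close> would lie in \<open>B\<close>.\<close>

lemma glued_complete_cover:
  assumes A: "minor_free t A" and B: "minor_free t B"
    and H: "simple_graph H" "card (verts H) = t" "edges H = pairs (verts H)"
      "verts H = verts A \<union> verts B" "edges H \<subseteq> edges A \<union> edges B"
    and one: "\<And>x y. x \<in> verts A \<inter> verts B \<Longrightarrow> y \<in> verts A \<inter> verts B \<Longrightarrow> x = y"
  shows "\<not> verts A \<subseteq> verts B"
proof
  assume sub: "verts A \<subseteq> verts B"
  have "edges A = {}"
  proof (rule ccontr)
    assume "edges A \<noteq> {}"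
    then obtain e where "e \<in> edges A" by blast
    then obtain a b where "a \<noteq> b" "a \<in> verts A" "b \<in> verts A" using A by (metis simple_edgeE)
    then show False using one[of a b] sub by auto
  qed
  then have "spanning_subgraph H B"
    using H(4,5) sub by (auto simp: spanning_subgraph_def)
  moreover have "minor (complete_graph t) H"
    using minor_complete_iff[OF H(1)] H(2,3) by (metis transforms.simps(1))
  ultimately show False using minor_complete_spanning[OF _ _ H(1)] B by blast
qed

text \<open>A complete graph has no cut vertex: if neither part covers the other, two vertices
  private to different parts would have to be adjacent, and no part contains such an edge.\<close>

lemma glued_minor_free:
  assumes g: "glued t G" and G: "simple_graph G" shows "\<not> minor (complete_graph t) G"
proof
  assume "minor (complete_graph t) G"
  then obtain xs H where H: "transforms xs G H" "card (verts H) = t" "edges H = pairs (verts H)"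
    using minor_complete_iff[OF G] by blast
  have sH: "simple_graph H" by (rule simple_transforms[OF G H(1)])
  obtain A B where AB: "minor_free t A" "minor_free t B" "verts H = verts A \<union> verts B"
    "edges H \<subseteq> edges A \<union> edges B"
    and one: "\<And>x y. x \<in> verts A \<inter> verts B \<Longrightarrow> y \<in> verts A \<inter> verts B \<Longrightarrow> x = y"
    using glued_transforms[OF H(1) g G] unfolding glued_def by blast
  have "\<not> verts A \<subseteq> verts B"
    by (rule glued_complete_cover[OF AB(1,2) sH H(2,3) AB(3,4) one])
  moreover have "\<not> verts B \<subseteq> verts A"
    by (rule glued_complete_cover[OF AB(2,1) sH H(2,3)]) (use AB one in auto)
  ultimately obtain a b where ab: "a \<in> verts A" "a \<notin> verts B" "b \<in> verts B" "b \<notin> verts A" by blast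
  then have "{a, b} \<in> edges H" unfolding H(3) by (intro pairsI) (use AB(3) in auto)
  then have "{a, b} \<in> edges A \<or> {a, b} \<in> edges B" using AB(4) by blast
  then show False using ab simple_edgeD AB(1,2) by metis
qed

text \<open>Two copies sharing one vertex have twice the edges but one vertex less than twice the
  vertices.\<close>

lemma minor_free_denser:
  fixes G :: "nat graph"
  assumes G: "minor_free t G" and e: "edges G \<noteq> {}"
  shows "\<exists>G' :: nat graph. minor_free t G' \<and> average_degree G' > average_degree G"
proof -
  have sG: "simple_graph G" using G by simp
  obtain a where a: "a \<in> verts G" using e simple_edge_subset[OF sG] simple_edgeE[OF sG] by blast
  \<comment> \<open>The copies use odd and positive even names, and \<open>0\<close> is the shared
    vertex.\<close>
  define f :: "nat \<Rightarrow> nat" where "f = (\<lambda>x. if x = a then 0 else 2 * x + 1)"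
  define h :: "nat \<Rightarrow> nat" where "h = (\<lambda>x. if x = a then 0 else 2 * x + 2)"
  have inj: "inj f" "inj h" by (auto simp: f_def h_def inj_def)
  then have injV: "inj_on f (verts G)" "inj_on h (verts G)" using inj_on_subset by blast+
  let ?A = "graph_map f G" and ?B = "graph_map h G"
  have cross: "f x = h y \<Longrightarrow> x = a \<and> y = a" for x y
    unfolding f_def h_def by (auto split: if_splits) presburger
  have A: "minor_free t ?A" "minor_free t ?B"
    using G simple_graph_map[OF sG] injV minor_complete_graph_map_iff[OF sG] by blast+
  let ?W = "(verts ?A \<union> verts ?B, edges ?A \<union> edges ?B)"
  have E: "edges ?A \<subseteq> pairs (verts ?A)" "edges ?B \<subseteq> pairs (verts ?B)"
    and fin: "finite (verts ?A)" "finite (verts ?B)" "finite (edges ?A)" "finite (edges ?B)"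
    using A simple_finite_verts simple_finite_edges simple_graph_iff by blast+
  have "pairs X \<subseteq> pairs Y" if "X \<subseteq> Y" for X Y :: "nat set" using that unfolding pairs_def by blast
  then have "edges ?A \<union> edges ?B \<subseteq> pairs (verts ?A \<union> verts ?B)"
    using E by (meson Un_least Un_upper1 Un_upper2 subset_trans)
  then have sW: "simple_graph ?W" using fin(1,2) by (simp add: simple_graph_iff)
  have fa: "f a = 0" "h a = 0" by (auto simp: f_def h_def)
  have VAB: "verts ?A \<inter> verts ?B = {0}"
  proof (intro equalityI subsetI)
    fix z assume "z \<in> verts ?A \<inter> verts ?B"
    then obtain x y where "z = f x" "z = h y" unfolding graph_map_def by (metis IntE fst_conv imageE)
    then show "z \<in> {0}" using cross[of x y] fa by simp
  next
    fix z :: nat assume "z \<in> {0}"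
    then show "z \<in> verts ?A \<inter> verts ?B"
      using imageI[OF a, of f] imageI[OF a, of h] fa by (simp add: graph_map_def)
  qed
  have "glued t ?W" by (rule gluedI[OF A]) (use VAB in auto)
  then have W: "minor_free t ?W" using glued_minor_free sW by blast
  have EAB: "edges ?A \<inter> edges ?B = {}"
  proof (rule ccontr)
    assume "edges ?A \<inter> edges ?B \<noteq> {}"
    then obtain d where d: "d \<in> edges ?A" "d \<in> edges ?B" by blast
    then have "d \<subseteq> {0}" using simple_edge_subset A VAB by blast
    moreover obtain x y where "d = {x, y}" "x \<noteq> y" using simple_edgeE[OF _ d(1)] A by metis
    ultimately show False by auto
  qed
  have cV: "card (verts ?A) = card (verts G)" "card (verts ?B) = card (verts G)"
    using injV by (auto simp: graph_map_def card_image)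
  have cE: "card (edges ?A) = card (edges G)" "card (edges ?B) = card (edges G)"
    using inj_on_subset[OF inj(1) subset_UNIV] inj_on_subset[OF inj(2) subset_UNIV]
    by (auto simp: graph_map_def intro!: card_image inj_on_image)
  \<comment> \<open>Here \<open>k\<close> is the number of vertices of the glued graph, one less
    than \<open>2 * n\<close>.\<close>
  have "2 * real m / real n < 2 * real (2 * m) / real k"
    if "k + 1 = 2 * n" "m > 0" "n > 0" for m n k :: nat
  proof -
    have k: "real k < 2 * real n" "real k > 0" using that(1,3) by linarith+
    have "2 * real m / real n = 2 * real (2 * m) / (2 * real n)" by simp
    also have "\<dots> < 2 * real (2 * m) / real k"
      by (rule divide_strict_left_mono[OF k(1)]) (use that k in auto)
    finally show ?thesis .
  qed
  moreover have "card (verts ?W) + 1 = 2 * card (verts G)"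
    using card_Un_Int[OF fin(1,2)] VAB cV by simp
  moreover have cW: "card (edges ?W) = 2 * card (edges G)"
    using card_Un_disjoint[OF fin(3,4) EAB] cE by simp
  moreover have "card (edges G) > 0" using e simple_finite_edges[OF sG] by (simp add: card_gt_0_iff)
  moreover have "card (verts G) > 0" using a simple_finite_verts[OF sG] card_gt_0_iff by blast
  ultimately have "average_degree G < average_degree ?W"
    unfolding average_degree_def cW by blast
  then show ?thesis using W by blast
qed

section \<open>The minimum defining \<open>g\<close>, and its lower bound\<close>

lemma complete_graph_minor_free:
  assumes "n < t" shows "minor_free t (complete_graph n)"
proof -
  have s: "simple_graph (complete_graph n)"
    by (simp add: complete_graph_pairs simple_graph_iff)
  moreover have "\<not> minor (complete_graph t) (complete_graph n)"
    using card_verts_transforms[OF _ s] assms minor_complete_iff[OF s]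
    by (fastforce simp: complete_graph_pairs)
  ultimately show ?thesis by simp
qed

lemma average_degree_complete_graph:
  assumes "n \<ge> 1" shows "average_degree (complete_graph n) = real n - 1"
proof -
  let ?K = "complete_graph n"
  have s: "simple_graph ?K" by (simp add: complete_graph_pairs simple_graph_iff)
  have "nbrs ?K v = {..<n} - {v}" if "v < n" for v
    using that by (auto simp: nbrs_def complete_graph_pairs pairs_def doubleton_eq_iff)
  then have "(\<Sum>v\<in>verts ?K. card (nbrs ?K v)) = n * (n - 1)" by (simp add: complete_graph_def)
  then have "2 * card (edges ?K) = n * (n - 1)" using handshake[OF s] by simp
  then have "2 * real (card (edges ?K)) = real n * (real n - 1)"
    using assms by (metis of_nat_mult of_nat_numeral of_nat_diff of_nat_1)
  then show ?thesis using assms by (simp add: average_degree_def complete_graph_def)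
qed

text \<open>The value \<open>g t\<close> is the supremum of the average degrees of graphs without
  \<open>K_t\<close>-minor. As none of them is densest, the supremum is not reached and is therefore
  itself an admissible \<open>D\<close>. The complete graph on \<open>t - 1\<close> vertices gives
  the lower bound.\<close>

lemma g_properties:
  assumes t: "t \<ge> 3"
  shows "\<And>G :: nat graph. simple_graph G \<Longrightarrow> average_degree G \<ge> g t \<Longrightarrow> minor (complete_graph t) G"
    and "g t > real t - 2"
proof -
  let ?P = "\<lambda>D. \<forall>G :: nat graph. simple_graph G \<and> average_degree G \<ge> D \<longrightarrow> minor (complete_graph t) G"
  let ?F = "{average_degree G | G :: nat graph. minor_free t G}"
  have Kt: "real t - 2 \<in> ?F"
    using complete_graph_minor_free[of "t - 1" t] average_degree_complete_graph[of "t - 1"] t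
    by (intro CollectI exI[of _ "complete_graph (t - 1)"]) (auto simp: of_nat_diff)
  obtain d where d: "\<And>G :: nat graph. simple_graph G \<Longrightarrow> verts G \<noteq> {} \<Longrightarrow>
     d * card (verts G) \<le> card (edges G) \<Longrightarrow> minor (complete_graph t) G"
    using mader[of t] by metis
  have "average_degree G \<le> 2 * real d" if G: "minor_free t G" for G :: "nat graph"
  \<comment> \<open>Division by zero gives the empty graph average degree \<open>0\<close>.\<close>
  proof (cases "verts G = {}")
    case False
    then have "\<not> d * card (verts G) \<le> card (edges G)" using d G by blast
    then have "real (card (edges G)) \<le> real d * real (card (verts G))"
      by (metis linear of_nat_le_iff of_nat_mult)
    moreover have "card (verts G) > 0" using False G simple_finite_verts card_gt_0_iff by blast
    ultimately show ?thesis by (simp add: average_degree_def field_simps)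
  qed (simp add: average_degree_def)
  then have bdd: "bdd_above ?F" unfolding bdd_above_def by blast
  have sup: "?P (Sup ?F)"
  proof (intro allI impI, rule ccontr)
    fix G :: "nat graph"
    assume G: "simple_graph G \<and> Sup ?F \<le> average_degree G" "\<not> minor (complete_graph t) G"
    \<comment> \<open>This is where \<open>t \<ge> 3\<close> matters: gluing raises the average
      degree only of a graph that has an edge.\<close>
    have "average_degree G > 0" using G(1) cSup_upper[OF Kt bdd] t by linarith
    then have "edges G \<noteq> {}" by (auto simp: average_degree_def)
    then obtain G' :: "nat graph" where
      G': "minor_free t G'" "average_degree G' > average_degree G"
      using minor_free_denser G by blast
    then have "average_degree G' \<in> ?F" by blast
    then show False using cSup_upper[OF _ bdd] G(1) G'(2) by fastforce
  qed
  have least: "Sup ?F \<le> D" if "?P D" for D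
  proof (rule cSup_least)
    show "?F \<noteq> {}" using Kt by blast
    show "x \<le> D" if "x \<in> ?F" for x using \<open>?P D\<close> that by force
  qed
  have "g t = Sup ?F" unfolding g_def by (rule Least_equality[of ?P, OF sup least])
  with sup have P: "?P (g t)" by (simp only:)
  then show "\<And>G :: nat graph. simple_graph G \<Longrightarrow> average_degree G \<ge> g t \<Longrightarrow> minor (complete_graph t) G"
    by blast
  obtain G :: "nat graph" where G: "real t - 2 = average_degree G" "minor_free t G" using Kt by blast
  then have "\<not> g t \<le> average_degree G" using P by blast
  then show "g t > real t - 2" using G by linarith
qed

subsection \<open>Weakest preconditions and running times\<close>

text \<open>Loops are excluded, so that the running time of a program is bounded by a number that
  depends only on its text.\<close>

primrec wp :: "nat \<Rightarrow> program \<Rightarrow> (state \<Rightarrow> bool) \<Rightarrow> state \<Rightarrow> bool" where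
  "wp B Skip Q s \<longleftrightarrow> Q s"
| "wp B (Const i k) Q s \<longleftrightarrow> k \<le> B \<and> Q (s\<lparr>reg := (reg s)(i := k)\<rparr>)"
| "wp B (Arith i f j k) Q s \<longleftrightarrow> eval_binop f (reg s j) (reg s k) \<le> B \<and>
     Q (s\<lparr>reg := (reg s)(i := eval_binop f (reg s j) (reg s k))\<rparr>)"
| "wp B (Load i a j) Q s \<longleftrightarrow> Q (s\<lparr>reg := (reg s)(i := arr s a (reg s j))\<rparr>)"
| "wp B (Store a i j) Q s \<longleftrightarrow>
     Q (s\<lparr>arr := (arr s)(a := (arr s a)(reg s i := reg s j))\<rparr>)"
| "wp B (Seq p q) Q s \<longleftrightarrow> wp B p (wp B q Q) s"
| "wp B (Cond b p q) Q s \<longleftrightarrow> (if holds b s then wp B p Q s else wp B q Q s)"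
| "wp B (While b p) Q s \<longleftrightarrow> False"

primrec time_bound :: "program \<Rightarrow> nat" where
  "time_bound Skip = 1"
| "time_bound (Const i k) = 1"
| "time_bound (Arith i f j k) = 1"
| "time_bound (Load i a j) = 1"
| "time_bound (Store a i j) = 1"
| "time_bound (Seq p q) = time_bound p + time_bound q"
| "time_bound (Cond b p q) = 1 + max (time_bound p) (time_bound q)"
| "time_bound (While b p) = 0"

definition runs :: "nat \<Rightarrow> program \<Rightarrow> nat \<Rightarrow> (state \<Rightarrow> bool) \<Rightarrow> state \<Rightarrow> bool" where
  "runs B p T Q s \<longleftrightarrow> (\<exists>T' s'. exec B p s T' s' \<and> T' \<le> T \<and> Q s')"

lemma runs_wp: "wp B p Q s \<Longrightarrow> runs B p (time_bound p) Q s"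
proof (induction p arbitrary: Q s)
  case (Seq p q)
  have "runs B p (time_bound p) (wp B q Q) s" using Seq by simp
  then obtain T1 s1 where 1: "exec B p s T1 s1" "T1 \<le> time_bound p" "wp B q Q s1"
    unfolding runs_def by blast
  then obtain T2 s2 where 2: "exec B q s1 T2 s2" "T2 \<le> time_bound q" "Q s2"
    using Seq.IH(2) unfolding runs_def by blast
  then show ?case unfolding runs_def using 1 exec.Seq[OF 1(1) 2(1)] by (auto intro!: exI add_mono)
next
  case (Cond b p q)
  show ?case
  proof (cases "holds b s")
    case True
    then have "runs B p (time_bound p) Q s" using Cond by simp
    then obtain T s' where "exec B p s T s'" "T \<le> time_bound p" "Q s'"
      unfolding runs_def by blast
    then show ?thesis unfolding runs_def
      by (intro exI[of _ "1 + T"] exI[of _ s']) (auto intro: exec.Cond_True[OF True, simplified])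
  next
    case False
    then have "runs B q (time_bound q) Q s" using Cond by simp
    then obtain T s' where "exec B q s T s'" "T \<le> time_bound q" "Q s'"
      unfolding runs_def by blast
    then show ?thesis unfolding runs_def
      by (intro exI[of _ "1 + T"] exI[of _ s']) (auto intro: exec.Cond_False[OF False, simplified])
  qed
qed (force simp: runs_def intro: exec.intros)+

lemma runs_Seq:
  assumes "runs B p T1 R s" "\<And>s'. R s' \<Longrightarrow> runs B q T2 Q s'"
  shows "runs B (Seq p q) (T1 + T2) Q s"
proof -
  obtain T1' s1 where 1: "exec B p s T1' s1" "T1' \<le> T1" "R s1"
    using assms(1) unfolding runs_def by blast
  then obtain T2' s2 where 2: "exec B q s1 T2' s2" "T2' \<le> T2" "Q s2"
    using assms(2) unfolding runs_def by blast
  then show ?thesis unfolding runs_def using 1 exec.Seq[OF 1(1) 2(1)] by (auto intro!: exI add_mono)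
qed

text \<open>The number \<open>f\<close> is a variant and a time budget at once: each iteration
  lowers it by one, and at \<open>0\<close> the test has to fail.\<close>

lemma runs_While:
  assumes "\<And>f s. I f s \<Longrightarrow> holds b s \<Longrightarrow> f > 0 \<and> wp B p (I (f - 1)) s" "I f s"
  shows "runs B (While b p) (1 + f * (1 + time_bound p)) (\<lambda>s'. (\<exists>f'. I f' s') \<and> \<not> holds b s') s"
  using assms(2)
proof (induction f arbitrary: s)
  case 0
  then have "\<not> holds b s" using assms(1) by blast
  then show ?case unfolding runs_def using 0 exec.While_False by fastforce
next
  case (Suc f)
  show ?case
  proof (cases "holds b s")
    case True
    then have "wp B p (I f) s" using assms(1)[OF Suc.prems] by simp
    from runs_wp[OF this] obtain T1 s1 where 1: "exec B p s T1 s1" "T1 \<le> time_bound p" "I f s1"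
      unfolding runs_def by blast
    from Suc.IH[OF 1(3)] obtain T2 s2 where 2: "exec B (While b p) s1 T2 s2"
      "T2 \<le> 1 + f * (1 + time_bound p)" "(\<exists>f'. I f' s2) \<and> \<not> holds b s2"
      unfolding runs_def by blast
    show ?thesis unfolding runs_def
      using exec.While_True[OF True 1(1) 2(1)] 1(2) 2(2,3)
      by (intro exI[of _ "1 + T1 + T2"] exI[of _ s2]) auto
  next
    case False
    then show ?thesis unfolding runs_def using Suc.prems exec.While_False by fastforce
  qed
qed

lemma wp_mono: "wp B p Q s \<Longrightarrow> (\<And>s'. Q s' \<Longrightarrow> R s') \<Longrightarrow> wp B p R s"
proof (induction p arbitrary: Q R s)
  case (Seq p q)
  show ?case using Seq.IH(1)[of "wp B q Q" s "wp B q R"] Seq.IH(2)[of Q _ R] Seq.prems by simp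
next
  case (Cond b p q)
  then show ?case by (simp split: if_splits)
qed auto

primrec seqs :: "program list \<Rightarrow> program" where
  "seqs [] = Skip"
| "seqs (p # ps) = Seq p (seqs ps)"

text \<open>A footprint: everything outside \<open>R\<close> and \<open>A\<close> is known to
  survive, so invariants about other cells pass through a program fragment at no cost.\<close>

definition frame :: "nat set \<Rightarrow> nat set \<Rightarrow> state \<Rightarrow> state \<Rightarrow> bool" where
  "frame R A s s' \<longleftrightarrow> (\<forall>r. r \<notin> R \<longrightarrow> reg s' r = reg s r) \<and> (\<forall>a. a \<notin> A \<longrightarrow> arr s' a = arr s a)"

lemma frame_reg: "frame R A s s' \<Longrightarrow> r \<notin> R \<Longrightarrow> reg s' r = reg s r"
  and frame_arr: "frame R A s s' \<Longrightarrow> a \<notin> A \<Longrightarrow> arr s' a = arr s a"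
  by (auto simp: frame_def)

lemma frame_refl: "frame R A s s"
  by (simp add: frame_def)

lemma frame_trans:
  "frame R A s s' \<Longrightarrow> frame R' A' s' s'' \<Longrightarrow> R \<subseteq> R'' \<Longrightarrow> R' \<subseteq> R'' \<Longrightarrow> A \<subseteq> A'' \<Longrightarrow> A' \<subseteq> A'' \<Longrightarrow>
   frame R'' A'' s s''"
  unfolding frame_def by (metis subsetD)

subsection \<open>Adjacency lists with positions\<close>

text \<open>The neighbours \<open>X\<close> of a vertex are listed without repetition as \<open>a 0, \<dots>, a (d - 1)\<close>, and
  \<open>p x\<close> is one more than the position of \<open>x\<close> in this list, or \<open>0\<close> if \<open>x\<close> does not occur.\<close>

definition row :: "nat \<Rightarrow> nat set \<Rightarrow> (nat \<Rightarrow> nat) \<Rightarrow> (nat \<Rightarrow> nat) \<Rightarrow> nat \<Rightarrow> bool" where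
  "row M X a p d \<longleftrightarrow> X \<subseteq> {..<M} \<and> (\<forall>x<M. x \<notin> X \<longrightarrow> p x = 0) \<and>
     (\<forall>i<d. a i \<in> X \<and> p (a i) = Suc i) \<and> (\<forall>x\<in>X. 0 < p x \<and> p x \<le> d \<and> a (p x - 1) = x)"

lemma row_bij: "row M X a p d \<Longrightarrow> bij_betw a {..<d} X"
proof (rule bij_betw_byWitness[where f' = "\<lambda>x. p x - 1"])
  assume r: "row M X a p d"
  show "\<forall>i\<in>{..<d}. p (a i) - 1 = i" "\<forall>x\<in>X. a (p x - 1) = x" "a ` {..<d} \<subseteq> X"
    using r unfolding row_def by auto
  have "p x - 1 < d" if "x \<in> X" for x
  proof -
    have "0 < p x" "p x \<le> d" using r that unfolding row_def by auto
    then show ?thesis by linarith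
  qed
  then show "(\<lambda>x. p x - 1) ` X \<subseteq> {..<d}" by auto
qed

lemma row_card: "row M X a p d \<Longrightarrow> d = card X"
  using bij_betw_same_card[OF row_bij] by simp

text \<open>The last entry fills the gap, so the deletion takes constant time. If \<open>x\<close>
  is the last entry itself, both updates of \<open>p\<close> hit the same cell and the later one,
  which clears it, wins.\<close>

lemma row_delete:
  assumes r: "row M X a p d" and x: "x \<in> X"
  shows "row M (X - {x}) (a(p x - 1 := a (d - 1))) (p(a (d - 1) := p x, x := 0)) (d - 1)"
proof -
  have px: "0 < p x" "p x \<le> d" "a (p x - 1) = x" using r x unfolding row_def by auto
  have A: "a i \<in> X" "p (a i) = Suc i" if "i < d" for i using r that unfolding row_def by auto
  have P: "0 < p y" "p y \<le> d" "a (p y - 1) = y" if "y \<in> X" for y using r that unfolding row_def by auto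
  have l: "a (d - 1) \<in> X" "p (a (d - 1)) = d" using A[of "d - 1"] px by auto
  have X: "X \<subseteq> {..<M}" and Z: "\<forall>x<M. x \<notin> X \<longrightarrow> p x = 0" using r unfolding row_def by auto
  let ?a = "a(p x - 1 := a (d - 1))" and ?p = "p(a (d - 1) := p x, x := 0)"
  have "?a i \<in> X - {x} \<and> ?p (?a i) = Suc i" if i: "i < d - 1" for i
  proof (cases "i = p x - 1")
    case True
    then have "p x \<noteq> d" using i px by auto
    then have "a (d - 1) \<noteq> x" using l by auto
    then show ?thesis using True l px by simp
  next
    case False
    then have "a i \<noteq> x" using A[of i] i by auto
    moreover have "p (a i) = Suc i" "Suc i \<noteq> d" using A[of i] i by auto
    then have "a i \<noteq> a (d - 1)" using l(2) by metis
    ultimately show ?thesis using False A[of i] i by simp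
  qed
  moreover have "0 < ?p y \<and> ?p y \<le> d - 1 \<and> ?a (?p y - 1) = y" if y: "y \<in> X - {x}" for y
  proof (cases "y = a (d - 1)")
    case True
    then have "p x \<noteq> d" using y px by auto
    then show ?thesis using True y px by auto
  next
    case False
    have "p y \<noteq> p x" using P(3)[of y] y px by auto
    moreover have "p y \<noteq> d" using P(3)[of y] y False by auto
    ultimately show ?thesis using False y P[of y] px by auto
  qed
  moreover have "\<forall>y<M. y \<notin> X - {x} \<longrightarrow> ?p y = 0" using Z l by auto
  ultimately show ?thesis using X unfolding row_def by blast
qed

lemma row_insert:
  assumes "row M X a p d" "x < M" "x \<notin> X"
  shows "row M (insert x X) (a(d := x)) (p(x := Suc d)) (Suc d)"
  using assms unfolding row_def by (auto simp: less_Suc_eq)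

lemma row_cong:
  assumes "row M X a p d" "\<And>i. i < M \<Longrightarrow> a' i = a i" "\<And>x. x < M \<Longrightarrow> p' x = p x"
  shows "row M X a' p' d"
proof -
  have "X \<subseteq> {..<M}" using assms(1) by (simp add: row_def)
  then have "d \<le> M" using row_card[OF assms(1)] card_mono[of "{..<M}" X] by simp
  then show ?thesis using assms \<open>X \<subseteq> {..<M}\<close> unfolding row_def
    by (smt (verit) diff_less lessThan_iff less_le_trans subset_iff zero_less_one order.strict_trans2 diff_le_self le_less_trans)
qed

text \<open>Array 7 is an adjacency matrix of positions, for tests and deletions in constant time;
  array 6 allows enumeration. Since \<open>0\<close> means absence, zero memory represents the
  edgeless graph, and the \<open>M * M\<close> cells need no initialisation.\<close>

definition rep :: "nat \<Rightarrow> (nat \<Rightarrow> nat set) \<Rightarrow> state \<Rightarrow> bool" where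
  "rep M N s \<longleftrightarrow> (\<forall>u<M. row M (N u) (\<lambda>i. arr s 6 (u * M + i)) (\<lambda>x. arr s 7 (u * M + x)) (arr s 8 u))"

lemma rep_cong: "rep M N s \<Longrightarrow> (\<And>a. a \<in> {6, 7, 8} \<Longrightarrow> arr s' a = arr s a) \<Longrightarrow> rep M N s'"
  by (simp add: rep_def)

lemma rep_degree: "rep M N s \<Longrightarrow> u < M \<Longrightarrow> arr s 8 u = card (N u)"
  unfolding rep_def using row_card by blast

lemma rep_subset: "rep M N s \<Longrightarrow> u < M \<Longrightarrow> N u \<subseteq> {..<M}"
  unfolding rep_def row_def by blast

lemma rep_adjacent: "rep M N s \<Longrightarrow> u < M \<Longrightarrow> x < M \<Longrightarrow> 0 < arr s 7 (u * M + x) \<longleftrightarrow> x \<in> N u"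
  unfolding rep_def row_def by (metis less_nat_zero_code)

lemma rep_bij:
  "rep M N s \<Longrightarrow> u < M \<Longrightarrow> bij_betw (\<lambda>i. arr s 6 (u * M + i)) {..<arr s 8 u} (N u)"
  unfolding rep_def using row_bij by blast

lemma rep_nth: "rep M N s \<Longrightarrow> u < M \<Longrightarrow> i < card (N u) \<Longrightarrow> arr s 6 (u * M + i) \<in> N u"
  using rep_bij[of M N s u] rep_degree[of M N s u] bij_betwE by fastforce

lemma rep_card_less:
  assumes "rep M N s" "u < M" "x < M" "x \<notin> N u" shows "card (N u) < M"
proof -
  have "N u \<subset> {..<M}" using rep_subset[OF assms(1,2)] assms(3,4) by auto
  then show ?thesis using psubset_card_mono[of "{..<M}"] by simp
qed

lemma cell_bound: "u < (M :: nat) \<Longrightarrow> x < M \<Longrightarrow> u * M + x < M * M"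
proof -
  assume a: "u < M" "x < M"
  then have "Suc u * M \<le> M * M" by (intro mult_le_mono1) simp
  then show ?thesis using a by simp
qed

text \<open>Different rows occupy disjoint blocks, so an update of one row cannot disturb
  another.\<close>

lemma cell_eq_iff:
  assumes "i < (M :: nat)" "j < M" shows "u * M + i = u' * M + j \<longleftrightarrow> u = u' \<and> i = j"
proof
  assume e: "u * M + i = u' * M + j"
  have "(u * M + i) div M = u" "(u' * M + j) div M = u'" "(u * M + i) mod M = i" "(u' * M + j) mod M = j"
    using assms by auto
  then show "u = u' \<and> i = j" using e by metis
qed simp

lemma rep_update:
  assumes r: "rep M N s" and u: "u < M"
    and row: "row M X (\<lambda>i. arr s' 6 (u * M + i)) (\<lambda>x. arr s' 7 (u * M + x)) (arr s' 8 u)"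
    and same: "\<And>u' i. u' < M \<Longrightarrow> u' \<noteq> u \<Longrightarrow> i < M \<Longrightarrow> arr s' 6 (u' * M + i) = arr s 6 (u' * M + i)"
      "\<And>u' i. u' < M \<Longrightarrow> u' \<noteq> u \<Longrightarrow> i < M \<Longrightarrow> arr s' 7 (u' * M + i) = arr s 7 (u' * M + i)"
      "\<And>u'. u' \<noteq> u \<Longrightarrow> arr s' 8 u' = arr s 8 u'"
  shows "rep M (N(u := X)) s'"
  unfolding rep_def
proof (intro allI impI)
  fix u' assume u': "u' < M"
  show "row M ((N(u := X)) u') (\<lambda>i. arr s' 6 (u' * M + i)) (\<lambda>x. arr s' 7 (u' * M + x)) (arr s' 8 u')"
  proof (cases "u' = u")
    case False
    have "row M (N u') (\<lambda>i. arr s 6 (u' * M + i)) (\<lambda>x. arr s 7 (u' * M + x)) (arr s 8 u')"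
      using r u' unfolding rep_def by blast
    then show ?thesis using row_cong same(1,2)[OF u' False] same(3)[OF False] False by simp
  qed (use row in simp)
qed

text \<open>Registers 3, 7, 8 hold \<open>M\<close> (a bound on the vertex names), 0, 1, and registers 12 to 18 are
  scratch. For a vertex \<open>u\<close>, the lists \<open>a\<close> and \<open>p\<close> of its row start at index \<open>u * M\<close> of arrays 6
  and 7, and array 8 holds its degree. Later, register 4 is the height of the stack in array 10,
  array 9 marks the remaining vertices, and register 6 tells that the search has ended.\<close>

definition half_delete :: "nat \<Rightarrow> nat \<Rightarrow> program" where
  "half_delete u x = seqs [Arith 12 Times u 3, Arith 13 Plus 12 x, Load 14 7 13, Load 15 8 u,
     Arith 15 Minus 15 8, Store 8 u 15, Arith 16 Plus 12 15, Load 16 6 16, Arith 17 Minus 14 8,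
     Arith 17 Plus 12 17, Store 6 17 16, Arith 18 Plus 12 16, Store 7 18 14, Store 7 13 7]"

definition half_insert :: "nat \<Rightarrow> nat \<Rightarrow> program" where
  "half_insert u x = seqs [Arith 12 Times u 3, Arith 13 Plus 12 x, Load 15 8 u,
     Arith 16 Plus 12 15, Store 6 16 x, Arith 15 Plus 15 8, Store 7 13 15, Store 8 u 15]"

definition env :: "nat \<Rightarrow> nat \<Rightarrow> state \<Rightarrow> bool" where
  "env B M s \<longleftrightarrow> reg s 3 = M \<and> reg s 7 = 0 \<and> reg s 8 = 1 \<and> M * M \<le> B \<and> M \<le> B"

lemma env_frame: "env B M s \<Longrightarrow> frame R A s s' \<Longrightarrow> {3, 7, 8} \<inter> R = {} \<Longrightarrow> env B M s'"
  unfolding env_def by (auto simp: frame_reg)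

text \<open>Only one direction of the edge is removed, so \<open>N\<close> is an arbitrary family of
  sets here and symmetry may fail in between. The effect appears as a hypothesis on an arbitrary
  \<open>Q\<close>, so that the rule applies in front of any continuation.\<close>

lemma wp_half_delete:
  assumes e: "env B M s" and r: "rep M N s" and u: "i < 12" "reg s i = u" "u < M"
    and x: "j < 12" "reg s j = x" "x \<in> N u"
    and Q: "\<And>s'. rep M (N(u := N u - {x})) s' \<Longrightarrow> frame {12..18} {6, 7, 8} s s' \<Longrightarrow> Q s'"
  shows "wp B (half_delete i j) Q s"
proof -
  have E: "reg s 3 = M" "reg s 7 = 0" "reg s 8 = Suc 0" "M * M \<le> B" "M \<le> B" using e unfolding env_def by auto
  let ?a = "\<lambda>i. arr s 6 (u * M + i)" and ?p = "\<lambda>x. arr s 7 (u * M + x)" and ?d = "arr s 8 u"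
  have row: "row M (N u) ?a ?p ?d" using r u unfolding rep_def by blast
  have xM: "x < M" using rep_subset[OF r u(3)] x by auto
  have p: "0 < ?p x" "?p x \<le> ?d" using row x unfolding row_def by auto
  have d: "?d \<le> M" using row_card[OF row] card_mono[of "{..<M}" "N u"] rep_subset[OF r u(3)] by simp
  have "?d - 1 < ?d" using p by linarith
  then have "?a (?d - 1) \<in> N u" using row unfolding row_def by blast
  then have lM: "?a (?d - 1) < M" using rep_subset[OF r u(3)] by auto
  have c: "u * M + y \<le> B" if "y < M" for y using cell_bound[OF u(3) that] E(4) by linarith
  have uM: "u * M \<le> B" using c[of 0] u by simp
  have dM: "?d - 1 < M" "?p x - 1 < M" using p d by auto
  have rep: "rep M (N(u := N u - {x})) s'"
    if s': "arr s' 6 = (arr s 6)(u * M + (?p x - 1) := ?a (?d - 1))"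
      "arr s' 7 = (arr s 7)(u * M + ?a (?d - 1) := ?p x, u * M + x := 0)"
      "arr s' 8 = (arr s 8)(u := ?d - 1)" for s'
  proof (rule rep_update[OF r u(3)])
    have 1: "(\<lambda>i. arr s' 6 (u * M + i)) = ?a(?p x - 1 := ?a (?d - 1))"
      "(\<lambda>x. arr s' 7 (u * M + x)) = ?p(?a (?d - 1) := ?p x, x := 0)" "arr s' 8 u = ?d - 1"
      unfolding s' by (auto simp: fun_eq_iff)
    show "row M (N u - {x}) (\<lambda>i. arr s' 6 (u * M + i)) (\<lambda>x. arr s' 7 (u * M + x)) (arr s' 8 u)"
      unfolding 1 by (rule row_delete[OF row x(3)])
  qed (use s' cell_eq_iff[of _ M _ _ u] xM lM dM in auto)
  \<comment> \<open>The operands lie below the scratch registers and hence keep their values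
    throughout.\<close>
  have ne: "k \<noteq> 12" "k \<noteq> 13" "k \<noteq> 14" "k \<noteq> 15" "k \<noteq> 16" "k \<noteq> 17" "k \<noteq> 18" if "k < 12" for k :: nat
    using that by auto
  have "?d - 1 \<le> B" "?p x - 1 \<le> B" using dM E(5) by linarith+
  then show ?thesis
    unfolding half_delete_def
    using E(1-3) u(2) x(2) ne[OF u(1)] ne[OF x(1)] c[OF dM(1)] c[OF dM(2)] c[OF lM] c[OF xM] uM
    by simp (intro Q rep; simp add: frame_def)
qed

lemma wp_half_insert:
  assumes e: "env B M s" and r: "rep M N s" and u: "i < 12" "reg s i = u" "u < M"
    and x: "j < 12" "reg s j = x" "x < M" "x \<notin> N u"
    and Q: "\<And>s'. rep M (N(u := insert x (N u))) s' \<Longrightarrow> frame {12..18} {6, 7, 8} s s' \<Longrightarrow> Q s'"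
  shows "wp B (half_insert i j) Q s"
proof -
  have E: "reg s 3 = M" "reg s 7 = 0" "reg s 8 = Suc 0" "M * M \<le> B" "M \<le> B"
    using e unfolding env_def by auto
  let ?a = "\<lambda>i. arr s 6 (u * M + i)" and ?p = "\<lambda>x. arr s 7 (u * M + x)" and ?d = "arr s 8 u"
  have row: "row M (N u) ?a ?p ?d" using r u unfolding rep_def by blast
  have d: "?d < M" using row_card[OF row] rep_card_less[OF r u(3) x(3,4)] by simp
  have c: "u * M + y \<le> B" if "y < M" for y using cell_bound[OF u(3) that] E(4) by linarith
  have uM: "u * M \<le> B" using c[of 0] u by simp
  have rep: "rep M (N(u := insert x (N u))) s'"
    if s': "arr s' 6 = (arr s 6)(u * M + ?d := x)" "arr s' 7 = (arr s 7)(u * M + x := Suc ?d)"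
      "arr s' 8 = (arr s 8)(u := Suc ?d)" for s'
  proof (rule rep_update[OF r u(3)])
    have 1: "(\<lambda>i. arr s' 6 (u * M + i)) = ?a(?d := x)"
      "(\<lambda>x. arr s' 7 (u * M + x)) = ?p(x := Suc ?d)" "arr s' 8 u = Suc ?d"
      unfolding s' by (auto simp: fun_eq_iff)
    show "row M (insert x (N u)) (\<lambda>i. arr s' 6 (u * M + i)) (\<lambda>x. arr s' 7 (u * M + x)) (arr s' 8 u)"
      unfolding 1 by (rule row_insert[OF row x(3,4)])
  qed (use s' cell_eq_iff[of _ M _ _ u] x d in auto)
  have ne: "k \<noteq> 12" "k \<noteq> 13" "k \<noteq> 14" "k \<noteq> 15" "k \<noteq> 16" "k \<noteq> 17" "k \<noteq> 18" if "k < 12" for k :: nat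
    using that by auto
  have "Suc ?d \<le> B" using d E(5) by linarith
  then show ?thesis
    unfolding half_insert_def
    using E(1-3) u(2) x(2) ne[OF u(1)] ne[OF x(1)] c[OF d] c[OF x(3)] uM
    by simp (intro Q rep; simp add: frame_def)
qed

lemma wp_fun [simp]: "wp B Skip Q = Q" "wp B (Seq p q) Q = wp B p (wp B q Q)"
  by (simp_all add: fun_eq_iff)

definition delete_edge :: "nat \<Rightarrow> nat \<Rightarrow> program" where
  "delete_edge i j = Seq (half_delete i j) (half_delete j i)"

definition insert_edge :: "nat \<Rightarrow> nat \<Rightarrow> program" where
  "insert_edge i j = Seq (half_insert i j) (half_insert j i)"

lemma wp_delete_edge:
  assumes e: "env B M s" and r: "rep M N s" and u: "i < 12" "reg s i = u" "u < M"
    and x: "j < 12" "reg s j = x" "x \<in> N u" "u \<in> N x" "u \<noteq> x"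
    and Q: "\<And>s'. rep M (N(u := N u - {x}, x := N x - {u})) s' \<Longrightarrow> frame {12..18} {6, 7, 8} s s' \<Longrightarrow> Q s'"
  shows "wp B (delete_edge i j) Q s"
proof -
  have xM: "x < M" using rep_subset[OF r u(3)] x by auto
  show ?thesis unfolding delete_edge_def wp.simps
  proof (rule wp_half_delete[OF e r u x(1-3)])
    fix s1 assume 1: "rep M (N(u := N u - {x})) s1" "frame {12..18} {6, 7, 8} s s1"
    show "wp B (half_delete j i) Q s1"
    proof (rule wp_half_delete[OF env_frame[OF e 1(2)] 1(1) x(1) _ xM u(1)])
      show "Q s'" if "rep M ((N(u := N u - {x}))(x := (N(u := N u - {x})) x - {u})) s'"
        "frame {12..18} {6, 7, 8} s1 s'" for s'
        using that x(5) by (intro Q frame_trans[OF 1(2)]) auto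
    qed (use u x frame_reg[OF 1(2)] in auto)
  qed
qed

lemma wp_insert_edge:
  assumes e: "env B M s" and r: "rep M N s" and u: "i < 12" "reg s i = u" "u < M"
    and x: "j < 12" "reg s j = x" "x < M" "x \<notin> N u" "u \<notin> N x" "u \<noteq> x"
    and Q: "\<And>s'. rep M (N(u := insert x (N u), x := insert u (N x))) s' \<Longrightarrow> frame {12..18} {6, 7, 8} s s' \<Longrightarrow> Q s'"
  shows "wp B (insert_edge i j) Q s"
  unfolding insert_edge_def wp.simps
proof (rule wp_half_insert[OF e r u x(1-4)])
  fix s1 assume 1: "rep M (N(u := insert x (N u))) s1" "frame {12..18} {6, 7, 8} s s1"
  show "wp B (half_insert j i) Q s1"
  proof (rule wp_half_insert[OF env_frame[OF e 1(2)] 1(1) x(1) _ x(3) u(1)])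
    show "Q s'" if "rep M ((N(u := insert x (N u)))(x := insert u ((N(u := insert x (N u))) x))) s'"
      "frame {12..18} {6, 7, 8} s1 s'" for s'
      using that x(6) by (intro Q frame_trans[OF 1(2)]) auto
  qed (use u x frame_reg[OF 1(2)] in auto)
qed

section \<open>The stack of vertices waiting to be examined\<close>

definition stack :: "state \<Rightarrow> nat set" where
  "stack s = arr s 10 ` {..<reg s 4}"

definition push :: "nat \<Rightarrow> program" where
  "push i = seqs [Store 10 4 i, Arith 4 Plus 4 8]"

lemma wp_push:
  assumes e: "env B M s" and i: "i \<noteq> 4" and b: "reg s 4 < B"
    and Q: "\<And>s'. frame {4} {10} s s' \<Longrightarrow> reg s' 4 = Suc (reg s 4) \<Longrightarrow>
      stack s' = insert (reg s i) (stack s) \<Longrightarrow> Q s'"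
  shows "wp B (push i) Q s"
proof -
  have "stack (s\<lparr>arr := (arr s)(10 := (arr s 10)(reg s 4 := reg s i)), reg := (reg s)(4 := Suc (reg s 4))\<rparr>)
      = insert (reg s i) (stack s)"
    by (auto simp: stack_def lessThan_Suc)
  then show ?thesis
    using e b unfolding push_def env_def by simp (intro Q; simp add: frame_def)
qed

lemma stack_frame: "frame R A s s' \<Longrightarrow> 4 \<notin> R \<Longrightarrow> 10 \<notin> A \<Longrightarrow> stack s' = stack s"
  by (simp add: stack_def frame_def)

section \<open>Contraction by moving neighbours one at a time\<close>

text \<open>The neighbourhoods after the neighbours \<open>X\<close> of \<open>v\<close> have been moved to \<open>w\<close>.\<close>

definition moved :: "nat \<Rightarrow> nat \<Rightarrow> nat set \<Rightarrow> (nat \<Rightarrow> nat set) \<Rightarrow> nat \<Rightarrow> nat set" where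
  "moved v w X N u =
     (if u = v then N v - X
      else if u = w then N w \<union> (X - {w}) - (if w \<in> X then {v} else {})
      else if u \<in> X then insert w (N u - {v}) else N u)"

text \<open>The tests exclude the two degenerate cases of a contraction: \<open>x = w\<close> would
  give a loop, and a vertex already adjacent to \<open>w\<close> a parallel edge.\<close>

definition attach :: program where
  "attach = Cond (Equal 10 11) Skip
       (seqs [Arith 12 Times 10 3, Arith 12 Plus 12 11, Load 12 7 12,
          Cond (Less 7 12) Skip (insert_edge 10 11)])"

text \<open>On entry register 12 holds the degree of \<open>v\<close>, so the last entry of its list
  is taken. The moved vertex is pushed because it loses \<open>v\<close> and need not gain
  \<open>w\<close>; the vertex \<open>w\<close> itself is pushed when its turn comes.\<close>

definition move_edge :: program where
  "move_edge = seqs [Arith 12 Minus 12 8, Arith 13 Times 9 3, Arith 13 Plus 13 12, Load 11 6 13,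
     delete_edge 9 11,
     attach,
     push 11]"

text \<open>An unrolled loop: \<open>v\<close> will have at most \<open>2 * L\<close> neighbours, so
  a fixed number of copies suffices and the cost is visible in the text.\<close>

primrec move_all :: "nat \<Rightarrow> program" where
  "move_all 0 = Skip"
| "move_all (Suc k) = Seq (Load 12 8 9) (Cond (Less 7 12) (Seq move_edge (move_all k)) Skip)"

lemma moved_insert_self:
  assumes "v \<noteq> w" "w \<notin> X" "v \<notin> X"
  shows "(moved v w X N)(v := moved v w X N v - {w}, w := moved v w X N w - {v}) =
    moved v w (insert w X) N"
  using assms by (auto simp: moved_def fun_eq_iff)

lemma moved_insert:
  assumes "v \<noteq> w" "x \<noteq> w" "x \<notin> X" "x \<noteq> v" "v \<notin> X"
  shows "((moved v w X N)(v := moved v w X N v - {x}, x := moved v w X N x - {v}))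
    (w := insert x (moved v w X N w), x := insert w (moved v w X N x - {v})) =
    moved v w (insert x X) N"
  using assms by (auto simp: moved_def fun_eq_iff)

text \<open>The order of the list decides which neighbour is moved, so the postcondition has to
  allow any \<open>x\<close> outside \<open>X\<close>.\<close>

lemma wp_move_edge:
  assumes e: "env B M s" and r: "rep M (moved v w X N) s" and X: "X \<subset> N v" "N v \<subseteq> {..<M}"
    and v: "reg s 9 = v" "v < M" "v \<notin> N v" and w: "reg s 10 = w" "w < M" "w \<in> N v"
    and sym: "\<And>a b. a \<in> N b \<longleftrightarrow> b \<in> N a"
    and b: "reg s 4 < B" and d: "reg s 12 = arr s 8 v"
    and Q: "\<And>s' x. x \<in> N v - X \<Longrightarrow> rep M (moved v w (insert x X) N) s' \<Longrightarrow>
      frame ({4, 11} \<union> {12..18}) {6, 7, 8, 10} s s' \<Longrightarrow> reg s' 4 = Suc (reg s 4) \<Longrightarrow>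
      stack s' = insert x (stack s) \<Longrightarrow> Q s'"
  shows "wp B move_edge Q s"
proof -
  let ?N = "moved v w X N" and ?x = "arr s 6 (v * M + (arr s 8 v - 1))"
  note deg = rep_degree[OF r v(2)]
  have vw: "v \<noteq> w" using v w by auto
  have Nv: "?N v = N v - X" by (simp add: moved_def)
  have fin: "finite (N v)" using X(2) finite_subset by blast
  have "card (?N v) > 0" using X(1) fin unfolding Nv by (auto simp: card_gt_0_iff)
  then have d0: "arr s 8 v > 0" using deg by simp
  then have xN: "?x \<in> N v - X" using rep_nth[OF r v(2), of "arr s 8 v - 1"] deg Nv by simp
  have dM: "arr s 8 v \<le> M" using deg card_mono[of "{..<M}" "?N v"] rep_subset[OF r v(2)] by simp
  have xM: "?x < M" using xN X(2) by auto
  have xv: "?x \<noteq> v" using xN v(3) by auto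
  have vX: "v \<notin> X" using X(1) v(3) by blast
  have B: "M * M \<le> B" "M \<le> B" using e by (auto simp: env_def)
  have c: "y * M + z \<le> B" if "y < M" "z < M" for y z using cell_bound[OF that] B by linarith
  have "arr s 8 v - 1 < M" using dM d0 by linarith
  then have b1: "v * M \<le> B" "v * M + (arr s 8 v - 1) \<le> B" "arr s 8 v - 1 \<le> B"
    using c[OF v(2)] c[OF v(2), of 0] v(2) B by auto
  have b2: "w * M \<le> B" "w * M + ?x \<le> B" using c[OF w(2), of 0] c[OF w(2) xM] w(2) by auto
  define s1 where "s1 = s\<lparr>reg := (reg s)(12 := arr s 8 v - 1, 13 := v * M + (arr s 8 v - 1), 11 := ?x)\<rparr>"
  have f1: "frame ({11} \<union> {12..18}) {} s s1" by (simp add: s1_def frame_def)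
  have e1: "env B M s1" using env_frame[OF e f1] by simp
  have r1: "rep M ?N s1" by (rule rep_cong[OF r]) (simp add: s1_def)
  have x1: "reg s1 11 = ?x" "reg s1 9 = v" "reg s1 10 = w" "reg s1 4 = reg s 4"
    using v w by (auto simp: s1_def)
  let ?R = "\<lambda>s'. rep M (moved v w (insert ?x X) N) s' \<and> frame ({11} \<union> {12..18}) {6, 7, 8} s s'"
  have fin': "wp B (seqs [push 11]) Q s'" if "?R s'" "reg s' 11 = ?x" for s'
  proof -
    have f: "frame ({11} \<union> {12..18}) {6, 7, 8} s s'" using that by blast
    have e': "env B M s'" using env_frame[OF e f] by simp
    have s4: "reg s' 4 = reg s 4" using frame_reg[OF f, of 4] by simp
    show ?thesis unfolding seqs.simps wp.simps
    proof (rule wp_push[OF e'])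
      fix s2 assume 2: "frame {4} {10} s' s2" "reg s2 4 = Suc (reg s' 4)"
        "stack s2 = insert (reg s' 11) (stack s')"
      show "Q s2"
      proof (rule Q[OF xN])
        show "rep M (moved v w (insert ?x X) N) s2"
          by (rule rep_cong[of _ _ s']) (use that(1) frame_arr[OF 2(1)] in auto)
        show "frame ({4, 11} \<union> {12..18}) {6, 7, 8, 10} s s2"
          by (rule frame_trans[OF f 2(1)]) auto
      qed (use 2 s4 that(2) stack_frame[OF f] in auto)
    qed (use b s4 in auto)
  qed
  have main: "wp B attach (wp B (seqs [push 11]) Q) s2"
    if r2: "rep M (?N(v := ?N v - {?x}, ?x := ?N ?x - {v})) s2"
      and f2: "frame {12..18} {6, 7, 8} s1 s2" for s2
  proof -
    have f: "frame ({11} \<union> {12..18}) {6, 7, 8} s s2" by (rule frame_trans[OF f1 f2]) auto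
    have x2: "reg s2 11 = ?x" "reg s2 9 = v" "reg s2 10 = w"
      using x1 frame_reg[OF f2] by auto
    have e2: "env B M s2" using env_frame[OF e1 f2] by simp
    then have E: "reg s2 3 = M" "reg s2 7 = 0" by (auto simp: env_def)
    show ?thesis
    proof (cases "w = ?x")
      case True
      then have "rep M (moved v w (insert ?x X) N) s2"
        using r2 moved_insert_self[OF vw _ vX, of N] xN by simp
      then show ?thesis using True x2 fin'[of s2] f by (simp add: attach_def)
    next
      case False
      let ?N2 = "?N(v := ?N v - {?x}, ?x := ?N ?x - {v})"
      define s3 where "s3 = s2\<lparr>reg := (reg s2)(12 := arr s2 7 (w * M + ?x))\<rparr>"
      have f3: "frame {12..18} {} s2 s3" by (simp add: s3_def frame_def)
      have e3: "env B M s3" using env_frame[OF e2 f3] by simp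
      have r3: "rep M ?N2 s3" by (rule rep_cong[OF r2]) (simp add: s3_def)
      have x3: "reg s3 11 = ?x" "reg s3 10 = w" "reg s3 7 = 0" "reg s3 12 = arr s2 7 (w * M + ?x)"
        using x2 E by (auto simp: s3_def)
      have N2: "?N2 w = ?N w" "?N2 ?x = ?N ?x - {v}" using vw False by auto
      \<comment> \<open>By symmetry a single cell of the matrix decides about both directions of the
        new edge.\<close>
      have mem: "?x \<in> ?N w \<longleftrightarrow> w \<in> ?N ?x - {v}"
        using sym[of ?x w] xN vw False xv by (auto simp: moved_def)
      have mv: "(?N2)(w := insert ?x (?N w), ?x := insert w (?N ?x - {v})) = moved v w (insert ?x X) N"
        using moved_insert[OF vw _ _ xv vX] False xN by simp
      have f': "frame ({11} \<union> {12..18}) {6, 7, 8} s s3"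
        by (rule frame_trans[OF f f3]) auto
      have "wp B (Cond (Less 7 12) Skip (insert_edge 10 11)) (wp B (seqs [push 11]) Q) s3"
      proof (cases "?x \<in> ?N w")
        case True
        then have "0 < arr s2 7 (w * M + ?x)" using rep_adjacent[OF r2 w(2) xM] N2 by simp
        \<comment> \<open>For an existing edge both insertions are void, so omitting them leads to
          the same sets.\<close>
        moreover have "?N2 = moved v w (insert ?x X) N"
          using mv True mem vw xv False by (metis fun_upd_triv insert_absorb N2)
        ultimately show ?thesis using x3 fin'[of s3] r3 f' by simp
      next
        case False
        then have "\<not> 0 < arr s2 7 (w * M + ?x)" using rep_adjacent[OF r2 w(2) xM] N2 by simp
        moreover have "wp B (insert_edge 10 11) (wp B (seqs [push 11]) Q) s3"
        proof (rule wp_insert_edge[OF e3 r3 _ x3(2) w(2) _ x3(1) xM])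
          fix s4 assume 4: "rep M (?N2(w := insert ?x (?N2 w), ?x := insert w (?N2 ?x))) s4"
            "frame {12..18} {6, 7, 8} s3 s4"
          have "frame ({11} \<union> {12..18}) {6, 7, 8} s s4"
            by (rule frame_trans[OF f' 4(2)]) auto
          moreover have "reg s4 11 = ?x" using frame_reg[OF 4(2), of 11] x3 by simp
          ultimately show "wp B (seqs [push 11]) Q s4" using fin' 4(1) mv N2 by simp
        qed (use False mem N2 \<open>w \<noteq> ?x\<close> in auto)
        ultimately show ?thesis using x3 by simp
      qed
      then show ?thesis using False x2 E b2 by (simp add: attach_def s3_def split del: if_split)
    qed
  qed
  have "wp B (delete_edge 9 11) (wp B attach (wp B (seqs [push 11]) Q)) s1"
  proof (rule wp_delete_edge[OF e1 r1 _ x1(2) v(2) _ x1(1)])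
    show "?x \<in> ?N v" using xN Nv by simp
    show "v \<in> ?N ?x" using xN vw xv sym[of v ?x] by (auto simp: moved_def)
    show "v \<noteq> ?x" using xv by simp
    show "(9 :: nat) < 12" "(11 :: nat) < 12" by simp_all
  qed (rule main)
  moreover have "reg s 3 = M" "reg s 8 = Suc 0" using e by (auto simp: env_def)
  ultimately show ?thesis
    using b1 v(1) d unfolding move_edge_def s1_def by (simp add: fun_upd_twist)
qed

lemma wp_move_all:
  assumes e: "env B M s" and r: "rep M (moved v w X N) s" and X: "X \<subseteq> N v" "N v \<subseteq> {..<M}"
    and v: "reg s 9 = v" "v < M" "v \<notin> N v" and w: "reg s 10 = w" "w < M" "w \<in> N v"
    and sym: "\<And>a b. a \<in> N b \<longleftrightarrow> b \<in> N a"
    and k: "card (N v - X) \<le> k"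
    and b: "reg s 4 + card (N v - X) \<le> B"
    and Q: "\<And>s'. rep M (moved v w (N v) N) s' \<Longrightarrow>
      frame ({4, 11} \<union> {12..18}) {6, 7, 8, 10} s s' \<Longrightarrow> reg s' 4 = reg s 4 + card (N v - X) \<Longrightarrow>
      stack s' = (N v - X) \<union> stack s \<Longrightarrow> Q s'"
  shows "wp B (move_all k) Q s"
  using e r X(1) v(1) w(1) k b Q
proof (induction k arbitrary: s X)
  case 0
  have fin: "finite (N v)" using X(2) finite_subset by blast
  have "N v - X = {}" using 0(6) fin by simp
  then have "X = N v" using 0(3) by blast
  show ?case unfolding move_all.simps wp.simps
    by (rule 0(8)) (use 0(2) \<open>X = N v\<close> in \<open>auto simp: frame_refl\<close>)
next
  case (Suc k)
  note e = Suc.prems(1) and r = Suc.prems(2) and XN = Suc.prems(3) and Q = Suc.prems(8)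
  have fin: "finite (N v)" using X(2) finite_subset by blast
  have deg: "arr s 8 v = card (N v - X)" using rep_degree[OF r v(2)] by (simp add: moved_def)
  define s1 where "s1 = s\<lparr>reg := (reg s)(12 := arr s 8 v)\<rparr>"
  have f1: "frame {12..18} {} s s1" by (simp add: s1_def frame_def)
  have e1: "env B M s1" using env_frame[OF e f1] by simp
  have r1: "rep M (moved v w X N) s1" by (rule rep_cong[OF r]) (simp add: s1_def)
  have g1: "reg s1 9 = v" "reg s1 10 = w" "reg s1 4 = reg s 4" "reg s1 12 = arr s1 8 v" "reg s1 7 = 0"
    using Suc.prems(4,5) e by (auto simp: s1_def env_def)
  have "wp B (Cond (Less 7 12) (Seq move_edge (move_all k)) Skip) Q s1"
  proof (cases "N v - X = {}")
    case True
    then have "X = N v" using XN by blast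
    have "Q s1"
    proof (rule Q)
      show "frame ({4, 11} \<union> {12..18}) {6, 7, 8, 10} s s1" by (rule frame_trans[OF f1 frame_refl]) auto
    qed (use r1 \<open>X = N v\<close> g1 stack_frame[OF f1] in auto)
    moreover have "card (N v - X) = 0" by (simp only: True card.empty)
    ultimately show ?thesis using deg g1(5) by (simp add: s1_def)
  next
    case False
    then have pos: "card (N v - X) > 0" using fin by (simp add: card_gt_0_iff)
    have "wp B move_edge (wp B (move_all k) Q) s1"
    proof (rule wp_move_edge[OF e1 r1 _ X(2) g1(1) v(2,3) g1(2) w(2,3) sym _ g1(4)])
      fix s2 x assume x: "x \<in> N v - X" and r2: "rep M (moved v w (insert x X) N) s2"
        and f2: "frame ({4, 11} \<union> {12..18}) {6, 7, 8, 10} s1 s2"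
        and p2: "reg s2 4 = Suc (reg s1 4)" and k2: "stack s2 = insert x (stack s1)"
      have c: "card (N v - X) = Suc (card (N v - insert x X))"
        unfolding Diff_insert[of _ x X] by (rule card_Suc_Diff1[OF finite_Diff[OF fin] x, symmetric])
      have g2: "reg s2 9 = v" "reg s2 10 = w" using frame_reg[OF f2] g1 by auto
      show "wp B (move_all k) Q s2"
      proof (rule Suc.IH[OF env_frame[OF e1 f2] r2 _ g2])
        fix s3 assume 3: "rep M (moved v w (N v) N) s3"
          "frame ({4, 11} \<union> {12..18}) {6, 7, 8, 10} s2 s3"
          "reg s3 4 = reg s2 4 + card (N v - insert x X)" "stack s3 = N v - insert x X \<union> stack s2"
        have f: "frame ({4, 11} \<union> {12..18}) {6, 7, 8, 10} s s2"
          by (rule frame_trans[OF f1 f2]) auto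
        show "Q s3"
        proof (rule Q[OF 3(1)])
          show "frame ({4, 11} \<union> {12..18}) {6, 7, 8, 10} s s3"
            by (rule frame_trans[OF f 3(2)]) auto
          show "stack s3 = N v - X \<union> stack s" using 3(4) k2 x stack_frame[OF f1] by auto
        qed (use 3 p2 g1 c in auto)
      next
        show "insert x X \<subseteq> N v" using x XN by blast
        show "card (N v - insert x X) \<le> k" "reg s2 4 + card (N v - insert x X) \<le> B"
          using c Suc.prems(6,7) p2 g1(3) by linarith+
      qed auto
    next
      show "X \<subset> N v" using False XN by blast
      show "reg s1 4 < B" using Suc.prems(7) pos g1(3) by linarith
    qed
    then show ?thesis using pos deg g1 by (simp add: s1_def)
  qed
  then show ?case using Suc.prems(4) by (simp add: s1_def)
qed

text \<open>Links the data structure to the graph operation: moving all neighbours of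
  \<open>v\<close> is the contraction.\<close>

lemma moved_contract:
  assumes G: "simple_graph G" and vw: "{w, v} \<in> edges G"
  shows "moved v w (nbrs G v) (nbrs G) = nbrs (apply_op (Contract w v) G)"
proof
  fix u
  note d = simple_edgeD[OF G vw]
  have wv: "w \<in> nbrs G v" using vw by (simp add: nbrs_def insert_commute)
  have vv: "v \<notin> nbrs G v" by (rule nbrs_irrefl[OF G])
  have "x \<in> nbrs (apply_op (Contract w v) G) u \<longleftrightarrow>
      ({u, x} \<in> edges G \<and> v \<noteq> u \<and> v \<noteq> x) \<or> (\<exists>y\<in>nbrs G v - {w}. {u, x} = {w, y})" for x
    unfolding nbrs_def[of "apply_op _ _"] contract_edges[OF G vw] by auto
  moreover have "(\<exists>y\<in>nbrs G v - {w}. {u, x} = {w, y}) \<longleftrightarrow>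
      u = w \<and> x \<in> nbrs G v - {w} \<or> x = w \<and> u \<in> nbrs G v - {w}" for x
    by (auto simp: doubleton_eq_iff)
  moreover have "{u, x} \<in> edges G \<longleftrightarrow> x \<in> nbrs G u" for x by (simp add: nbrs_def)
  moreover have "v \<in> nbrs G u \<longleftrightarrow> u \<in> nbrs G v" by (rule nbrs_sym)
  ultimately show "moved v w (nbrs G v) (nbrs G) u = nbrs (apply_op (Contract w v) G) u"
    using d wv vv unfolding moved_def by (intro set_eqI) auto
qed

section \<open>Recording output operations\<close>

definition emit :: "nat \<Rightarrow> nat \<Rightarrow> nat \<Rightarrow> program" where
  "emit k i j = seqs [Const 12 k, Store 3 2 12, Store 4 2 i, Store 5 2 j, Arith 2 Plus 2 8]"

lemma wp_emit:
  assumes e: "env B M s" and i: "i \<notin> {2, 12}" "j \<notin> {2, 12}" and b: "k \<le> B" "reg s 2 < B"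
    and Q: "\<And>s'. frame {2, 12} {3, 4, 5} s s' \<Longrightarrow> reg s' 2 = Suc (reg s 2) \<Longrightarrow>
      output_ops s' = output_ops s @ [decode_op k (reg s i) (reg s j)] \<Longrightarrow> Q s'"
  shows "wp B (emit k i j) Q s"
proof -
  have "output_ops s' = output_ops s @ [decode_op k (reg s i) (reg s j)]"
    if "reg s' 2 = Suc (reg s 2)" "arr s' 3 = (arr s 3)(reg s 2 := k)"
      "arr s' 4 = (arr s 4)(reg s 2 := reg s i)" "arr s' 5 = (arr s 5)(reg s 2 := reg s j)" for s'
    using that by (simp add: output_ops_def)
  then show ?thesis
    using e i b unfolding emit_def env_def by simp (intro Q; simp add: frame_def)
qed

lemma output_ops_frame:
  "frame R A s s' \<Longrightarrow> 2 \<notin> R \<Longrightarrow> {3, 4, 5} \<inter> A = {} \<Longrightarrow> output_ops s' = output_ops s"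
  by (simp add: output_ops_def frame_def)

lemma rep_frame: "rep M N s \<Longrightarrow> frame R A s s' \<Longrightarrow> A \<inter> {6, 7, 8} = {} \<Longrightarrow> rep M N s'"
  by (rule rep_cong, assumption) (auto simp: frame_def)

subsection \<open>Case distinction on the graph induced by a neighbourhood\<close>

definition load_neighbour :: "nat \<Rightarrow> nat \<Rightarrow> program" where
  "load_neighbour r i = seqs [Arith 12 Times 9 3, Const 13 i, Arith 13 Plus 12 13, Load r 6 13]"

definition pair_test :: "nat \<Rightarrow> nat \<Rightarrow> program" where
  "pair_test i j = seqs [load_neighbour 14 i, Arith 14 Times 14 3, load_neighbour 13 j,
     Arith 13 Plus 14 13, Load 13 7 13]"

text \<open>The text branches on every adjacency test, so at each leaf the local graph is a constant
  \<open>S\<close>. Any function \<open>f\<close> of it, computable or not, can therefore be built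
  into the program.\<close>

primrec decision_tree ::
  "(nat \<times> nat) list \<Rightarrow> ((nat \<times> nat) set \<Rightarrow> program) \<Rightarrow> (nat \<times> nat) set \<Rightarrow> program" where
  "decision_tree [] f S = f S"
| "decision_tree (p # ps) f S = Seq (pair_test (fst p) (snd p))
     (Cond (Less 7 13) (decision_tree ps f (insert p S)) (decision_tree ps f S))"

text \<open>Makes the degree in register 15 a constant of the text as well, by comparing it with all
  values from \<open>k\<close> downwards.\<close>

primrec case_number :: "nat \<Rightarrow> (nat \<Rightarrow> program) \<Rightarrow> program" where
  "case_number 0 h = h 0"
| "case_number (Suc k) h = Seq (Const 16 (Suc k)) (Cond (Equal 15 16) (h (Suc k)) (case_number k h))"

definition by_neighbourhood :: "nat \<Rightarrow> (nat \<Rightarrow> (nat \<times> nat) set \<Rightarrow> program) \<Rightarrow> program" where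
  "by_neighbourhood k f = Seq (Load 15 8 9)
     (case_number k (\<lambda>m. decision_tree (List.product [0..<m] [0..<m]) (f m) {}))"

text \<open>Adjacency among the neighbours of a vertex in terms of list positions instead of names;
  only in this form are there boundedly many cases.\<close>

definition local_relation :: "(nat \<Rightarrow> nat set) \<Rightarrow> (nat \<Rightarrow> nat) \<Rightarrow> nat \<Rightarrow> (nat \<times> nat) set" where
  "local_relation N a m = {(i, j). i < m \<and> j < m \<and> a j \<in> N (a i)}"

lemma wp_pair_test:
  assumes e: "env B M s" and r: "rep M N s" and v: "reg s 9 = v" "v < M"
    and ij: "i < card (N v)" "j < card (N v)"
    and Q: "\<And>s'. frame {12..18} {} s s' \<Longrightarrow>
      0 < reg s' 13 \<longleftrightarrow> arr s 6 (v * M + j) \<in> N (arr s 6 (v * M + i)) \<Longrightarrow> Q s'"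
  shows "wp B (pair_test i j) Q s"
proof -
  have E: "reg s 3 = M" "M * M \<le> B" "M \<le> B" using e by (auto simp: env_def)
  have sub: "N v \<subseteq> {..<M}" by (rule rep_subset[OF r v(2)])
  then have cM: "card (N v) \<le> M" using card_mono[of "{..<M}" "N v"] by simp
  let ?a = "arr s 6 (v * M + i)" and ?b = "arr s 6 (v * M + j)"
  have ab: "?a < M" "?b < M" using rep_nth[OF r v(2)] ij sub by auto
  have c: "y * M + z \<le> B" if "y < M" "z < M" for y z using cell_bound[OF that] E(2) by linarith
  have "i < M" "j < M" using ij cM by linarith+
  then have b: "v * M \<le> B" "v * M + i \<le> B" "v * M + j \<le> B" "?a * M \<le> B" "?a * M + ?b \<le> B"
    "i \<le> B" "j \<le> B"
    using c[OF v(2), of 0] c[OF v(2)] c[OF ab] c[OF ab(1), of 0] v(2) E(3) by auto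
  have "0 < arr s 7 (?a * M + ?b) \<longleftrightarrow> ?b \<in> N ?a" by (rule rep_adjacent[OF r ab])
  then show ?thesis unfolding pair_test_def load_neighbour_def
    using E(1) v(1) b by simp (intro Q; simp add: frame_def)
qed

lemma wp_decision_tree:
  assumes "env B M s" "rep M N s" "reg s 9 = v" "v < M"
    and "\<And>p. p \<in> set ps \<Longrightarrow> fst p < card (N v) \<and> snd p < card (N v)"
    and "a = (\<lambda>i. arr s 6 (v * M + i))"
    and "\<And>s'. frame {12..18} {} s s' \<Longrightarrow>
      wp B (f (S \<union> {p \<in> set ps. a (snd p) \<in> N (a (fst p))})) Q s'"
  shows "wp B (decision_tree ps f S) Q s"
  using assms
proof (induction ps arbitrary: s S)
  case Nil
  then show ?case using Nil(7)[OF frame_refl] by simp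
next
  case (Cons p ps)
  have "wp B (pair_test (fst p) (snd p))
    (wp B (Cond (Less 7 13) (decision_tree ps f (insert p S)) (decision_tree ps f S)) Q) s"
  proof (rule wp_pair_test[OF Cons.prems(1-4)])
    fix s1 assume f1: "frame {12..18} {} s s1"
      and t: "0 < reg s1 13 \<longleftrightarrow> arr s 6 (v * M + snd p) \<in> N (arr s 6 (v * M + fst p))"
    have e1: "env B M s1" using env_frame[OF Cons.prems(1) f1] by simp
    have r1: "rep M N s1" using rep_frame[OF Cons.prems(2) f1] by simp
    have v1: "reg s1 9 = v" using frame_reg[OF f1, of 9] Cons.prems(3) by simp
    have a1: "a = (\<lambda>i. arr s1 6 (v * M + i))" using Cons.prems(6) frame_arr[OF f1] by simp
    \<comment> \<open>The branch that the machine takes corresponds to this set of pairs found so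
      far.\<close>
    let ?S = "if a (snd p) \<in> N (a (fst p)) then insert p S else S"
    have S: "S \<union> {q \<in> set (p # ps). a (snd q) \<in> N (a (fst q))} =
        ?S \<union> {q \<in> set ps. a (snd q) \<in> N (a (fst q))}" by auto
    have "wp B (decision_tree ps f ?S) Q s1"
    proof (rule Cons.IH[OF e1 r1 v1 Cons.prems(4) _ a1])
      fix s2 assume "frame {12..18} {} s1 s2"
      then have "frame {12..18} {} s s2" using frame_trans[OF f1] by blast
      from Cons.prems(7)[OF this] show "wp B (f (?S \<union> {q \<in> set ps. a (snd q) \<in> N (a (fst q))})) Q s2"
        by (simp only: S)
    qed (use Cons.prems(5) in auto)
    then show "wp B (Cond (Less 7 13) (decision_tree ps f (insert p S)) (decision_tree ps f S)) Q s1"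
      using t e1 Cons.prems(6) by (simp add: env_def split: if_splits)
  qed (use Cons.prems(5) in auto)
  then show ?case by simp
qed

lemma wp_case_number:
  assumes "reg s 15 \<le> k" "k \<le> B" "\<And>s'. frame {12..18} {} s s' \<Longrightarrow> wp B (h (reg s 15)) Q s'"
  shows "wp B (case_number k h) Q s"
  using assms
proof (induction k arbitrary: s)
  case 0
  then show ?case using 0(3)[OF frame_refl] by simp
next
  case (Suc k)
  let ?s = "s\<lparr>reg := (reg s)(16 := Suc k)\<rparr>"
  have f: "frame {12..18} {} s ?s" by (simp add: frame_def)
  show ?case
  proof (cases "reg s 15 = Suc k")
    case True
    then show ?thesis using Suc.prems(2) Suc.prems(3)[OF f] by simp
  next
    case False
    have "wp B (case_number k h) Q ?s"
    proof (rule Suc.IH)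
      fix s' assume "frame {12..18} {} ?s s'"
      then have "frame {12..18} {} s s'" using frame_trans[OF f] by blast
      then show "wp B (h (reg ?s 15)) Q s'" using Suc.prems(3) by simp
    qed (use Suc.prems False in auto)
    then show ?thesis using False Suc.prems(2) by simp
  qed
qed

lemma wp_by_neighbourhood:
  assumes e: "env B M s" and r: "rep M N s" and v: "reg s 9 = v" "v < M"
    and k: "card (N v) \<le> k" "k \<le> B" and a: "a = (\<lambda>i. arr s 6 (v * M + i))"
    and Q: "\<And>s'. frame {12..18} {} s s' \<Longrightarrow>
      wp B (f (card (N v)) (local_relation N a (card (N v)))) Q s'"
  shows "wp B (by_neighbourhood k f) Q s"
proof -
  let ?m = "card (N v)"
  define s1 where "s1 = s\<lparr>reg := (reg s)(15 := ?m)\<rparr>"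
  have f1: "frame {12..18} {} s s1" by (simp add: s1_def frame_def)
  have "wp B (case_number k (\<lambda>m. decision_tree (List.product [0..<m] [0..<m]) (f m) {})) Q s1"
  proof (rule wp_case_number)
    fix s2 assume "frame {12..18} {} s1 s2"
    then have f2: "frame {12..18} {} s s2" using frame_trans[OF f1] by blast
    have e2: "env B M s2" using env_frame[OF e f2] by simp
    have r2: "rep M N s2" using rep_frame[OF r f2] by simp
    have v2: "reg s2 9 = v" using frame_reg[OF f2, of 9] v by simp
    have a2: "a = (\<lambda>i. arr s2 6 (v * M + i))" using a frame_arr[OF f2] by simp
    have "wp B (decision_tree (List.product [0..<?m] [0..<?m]) (f ?m) {}) Q s2"
    proof (rule wp_decision_tree[OF e2 r2 v2 v(2) _ a2])
      fix s3 assume "frame {12..18} {} s2 s3"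
      then have "frame {12..18} {} s s3" using frame_trans[OF f2] by blast
      moreover have "{} \<union> {p \<in> set (List.product [0..<?m] [0..<?m]). a (snd p) \<in> N (a (fst p))} =
          local_relation N a ?m"
        by (auto simp: local_relation_def)
      ultimately show "wp B (f ?m ({} \<union> {p \<in> set (List.product [0..<?m] [0..<?m]).
          a (snd p) \<in> N (a (fst p))})) Q s3"
        using Q by simp
    qed auto
    then show "wp B (decision_tree (List.product [0..<reg s1 15] [0..<reg s1 15]) (f (reg s1 15)) {}) Q s2"
      by (simp add: s1_def)
  qed (use k in \<open>auto simp: s1_def\<close>)
  then show ?thesis using rep_degree[OF r v(2)] v(1) by (simp add: by_neighbourhood_def s1_def)
qed

lemma wp_load_neighbour:
  assumes e: "env B M s" and r: "rep M N s" and v: "reg s 9 = v" "v < M"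
    and i: "i < card (N v)"
    and Q: "\<And>s'. frame (insert q {12..18}) {} s s' \<Longrightarrow> reg s' q = arr s 6 (v * M + i) \<Longrightarrow> Q s'"
  shows "wp B (load_neighbour q i) Q s"
proof -
  have E: "reg s 3 = M" "M * M \<le> B" "M \<le> B" using e by (auto simp: env_def)
  have "card (N v) \<le> M" using card_mono[of "{..<M}" "N v"] rep_subset[OF r v(2)] by simp
  then have iM: "i < M" using i by linarith
  then have b: "v * M \<le> B" "v * M + i \<le> B" "i \<le> B"
    using cell_bound[OF v(2) iM] E by linarith+
  then show ?thesis unfolding load_neighbour_def
    using E(1) v(1) by simp (intro Q; simp add: frame_def)
qed

text \<open>The listing \<open>a\<close> is a bijection, so the number of common neighbours can be
  read off the positions alone.\<close>

lemma card_local_relation: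
  assumes a: "bij_betw a {..<m} (N v)" and i: "i < m"
  shows "card {j. (i, j) \<in> local_relation N a m} = card (N v \<inter> N (a i))"
proof -
  have "a ` {j. (i, j) \<in> local_relation N a m} = N v \<inter> N (a i)"
    using i bij_betw_imp_surj_on[OF a] unfolding local_relation_def by auto
  moreover have "inj_on a {j. (i, j) \<in> local_relation N a m}"
    using bij_betw_imp_inj_on[OF a] by (rule inj_on_subset) (auto simp: local_relation_def)
  ultimately show ?thesis using card_image by metis
qed

subsection \<open>The machine state of a partially contracted graph\<close>

definition remove_vertex :: program where
  "remove_vertex = seqs [Store 9 9 7, emit 0 9 9]"

definition contract :: "nat \<Rightarrow> program" where
  "contract L = seqs [move_all (2 * L), Store 9 9 7, emit 2 10 9]"

locale minor_search =
  fixes G :: "nat graph" and vs :: "nat list" and L M B :: nat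
  assumes simple_G: "simple_graph G" and vs: "distinct vs" "set vs = verts G" "set vs \<subseteq> {..<M}"
    and bounds: "M * M \<le> B" "M \<le> B" "2 * L \<le> B" "2 \<le> B" "length vs < B" and L: "L \<ge> 1"
begin

text \<open>The output leads from \<open>G\<close> to some \<open>H\<close> that may have more edges
  than the stored graph \<open>W\<close>. Every emitted operation uses up a vertex, which is what
  the last conjunct records; it keeps the output counter within a machine word.\<close>

definition graph_state :: "nat graph \<Rightarrow> state \<Rightarrow> bool" where
  "graph_state W s \<longleftrightarrow> simple_graph W \<and> verts W \<subseteq> set vs \<and>
     env B M s \<and> reg s 0 = length vs \<and> reg s 20 = 2 * L \<and> arr s 0 = cells vs \<and>
     rep M (nbrs W) s \<and> (\<forall>x. arr s 9 x = (if x \<in> verts W then 1 else 0)) \<and>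
     (\<exists>H. spanning_subgraph W H \<and> transforms (output_ops s) G H) \<and>
     reg s 2 + card (verts W) \<le> length vs"

lemma graph_stateD:
  assumes "graph_state W s"
  shows "simple_graph W" "verts W \<subseteq> set vs" "env B M s" "reg s 0 = length vs"
    "reg s 20 = 2 * L" "arr s 0 = cells vs" "rep M (nbrs W) s"
    "arr s 9 x = (if x \<in> verts W then 1 else 0)"
    "\<exists>H. spanning_subgraph W H \<and> transforms (output_ops s) G H"
    "reg s 2 + card (verts W) \<le> length vs" "verts W \<subseteq> {..<M}"
  using assms vs(3) unfolding graph_state_def by blast+

lemma graph_state_frame:
  assumes g: "graph_state W s" and f: "frame R A s s'"
    and "R \<inter> {0, 2, 3, 7, 8, 20} = {}" "A \<inter> {0, 3, 4, 5, 6, 7, 8, 9} = {}"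
  shows "graph_state W s'"
proof -
  have "r \<notin> R" if "r \<in> {0, 2, 3, 7, 8, 20}" for r using assms(3) that by blast
  then have R: "reg s' r = reg s r" if "r \<in> {0, 2, 3, 7, 8, 20}" for r
    using frame_reg[OF f] that by blast
  have "a \<notin> A" if "a \<in> {0, 3, 4, 5, 6, 7, 8, 9}" for a using assms(4) that by blast
  then have A: "arr s' a = arr s a" if "a \<in> {0, 3, 4, 5, 6, 7, 8, 9}" for a
    using frame_arr[OF f] that by blast
  have o: "output_ops s' = output_ops s" using R[of 2] A by (simp add: output_ops_def)
  have r: "rep M (nbrs W) s'" by (rule rep_cong[OF graph_stateD(7)[OF g]]) (use A in auto)
  have e: "env B M s'" using g R by (simp add: graph_state_def env_def)
  show ?thesis using g o r e R A unfolding graph_state_def by simp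
qed

text \<open>An operation justified in \<open>W\<close> is also legal in the larger graph
  \<open>H\<close>, so emitting it extends the transformation of \<open>G\<close> and preserves the
  inclusion.\<close>

lemma graph_state_op:
  assumes g: "graph_state W s" and app: "applicable x W"
    and d: "verts (apply_op x W) = verts W - {v}" "v \<in> verts W"
    and e: "env B M s'" and reg: "reg s' 0 = reg s 0" "reg s' 20 = reg s 20"
    and arr: "arr s' 0 = arr s 0" "arr s' 9 = (arr s 9)(v := 0)"
    and r: "rep M (nbrs (apply_op x W)) s'"
    and out: "output_ops s' = output_ops s @ [x]" "reg s' 2 = Suc (reg s 2)"
  shows "graph_state (apply_op x W) s'"
proof -
  obtain H where H: "spanning_subgraph W H" "transforms (output_ops s) G H"
    using graph_stateD(9)[OF g] by blast
  have x: "applicable x H" "spanning_subgraph (apply_op x W) (apply_op x H)"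
    using spanning_apply_op[OF H(1) app] by auto
  have "transforms (output_ops s') G (apply_op x H)"
    unfolding out(1) transforms_append using H(2) x(1) by (intro exI[of _ H]) simp
  then have 1: "\<exists>H. spanning_subgraph (apply_op x W) H \<and> transforms (output_ops s') G H" using x by blast
  have "card (verts W) = Suc (card (verts W - {v}))"
    using card_Suc_Diff1[OF simple_finite_verts[OF graph_stateD(1)[OF g]] d(2)] by simp
  then have "reg s' 2 + card (verts (apply_op x W)) \<le> length vs"
    using graph_stateD(10)[OF g] d out(2) by simp
  moreover have "\<forall>y. arr s' 9 y = (if y \<in> verts (apply_op x W) then 1 else 0)"
    unfolding d arr using graph_stateD(8)[OF g] by simp
  moreover have "verts (apply_op x W) \<subseteq> set vs" using graph_stateD(2)[OF g] d by blast
  ultimately show ?thesis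
    unfolding graph_state_def
    using 1 e reg arr(1) r simple_apply_op[OF graph_stateD(1)[OF g] app] graph_stateD(4-6)[OF g]
    by (simp only: simp_thms)
qed

lemma wp_remove_vertex:
  assumes g: "graph_state W s" and v: "v \<in> verts W" "nbrs W v = {}" "reg s 9 = v"
    and Q: "\<And>s'. graph_state (apply_op (Del_Vertex v) W) s' \<Longrightarrow>
      frame {2, 12} {3, 4, 5, 9} s s' \<Longrightarrow> Q s'"
  shows "wp B remove_vertex Q s"
proof -
  define s1 where "s1 = s\<lparr>arr := (arr s)(9 := (arr s 9)(v := 0))\<rparr>"
  note e = graph_stateD(3)[OF g]
  have f1: "frame {} {9} s s1" by (simp add: frame_def s1_def)
  have e1: "env B M s1" using env_frame[OF e f1] by simp
  have n1: "reg s1 2 < B" using graph_stateD(10)[OF g] bounds(5) by (simp add: s1_def)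
  \<comment> \<open>An isolated vertex occurs in no list, so only its mark has to be
    cleared.\<close>
  have nb: "nbrs (apply_op (Del_Vertex v) W) = nbrs W"
    using v(2) nbrs_sym[of v W] by (auto simp: nbrs_def fun_eq_iff)
  have "wp B (emit 0 9 9) Q s1"
  proof (rule wp_emit[OF e1 _ _ _ n1])
    fix s2 assume 2: "frame {2, 12} {3, 4, 5} s1 s2" "reg s2 2 = Suc (reg s1 2)"
      "output_ops s2 = output_ops s1 @ [decode_op 0 (reg s1 9) (reg s1 9)]"
    have f2: "frame {2, 12} {3, 4, 5, 9} s s2" by (rule frame_trans[OF f1 2(1)]) auto
    show "Q s2"
    proof (rule Q[OF graph_state_op[OF g] f2])
      show "env B M s2" using env_frame[OF e f2] by simp
      show "output_ops s2 = output_ops s @ [Del_Vertex v]"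
        using 2(3) output_ops_frame[OF f1] v(3) by (simp add: decode_op_def s1_def)
      show "rep M (nbrs (apply_op (Del_Vertex v) W)) s2"
        unfolding nb by (rule rep_frame[OF graph_stateD(7)[OF g] f2]) auto
    qed (use v 2(2) frame_reg[OF f2] frame_arr[OF f2] frame_arr[OF 2(1)] in \<open>auto simp: s1_def\<close>)
  qed auto
  then show ?thesis using v(3) e by (simp add: remove_vertex_def s1_def env_def)
qed

lemma wp_contract:
  assumes g: "graph_state W s" and v: "v \<in> verts W" "reg s 9 = v" "card (nbrs W v) \<le> 2 * L"
    and w: "w \<in> nbrs W v" "reg s 10 = w" and b: "reg s 4 + 2 * L \<le> B"
    and Q: "\<And>s'. graph_state (apply_op (Contract w v) W) s' \<Longrightarrow>
      frame ({2, 4, 11} \<union> {12..18}) ({3..10}) s s' \<Longrightarrow>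
      reg s' 4 = reg s 4 + card (nbrs W v) \<Longrightarrow> stack s' = nbrs W v \<union> stack s \<Longrightarrow> Q s'"
  shows "wp B (contract L) Q s"
proof -
  note W = graph_stateD(1)[OF g] and e = graph_stateD(3)[OF g]
  have wv: "{w, v} \<in> edges W" using w(1) by (simp add: nbrs_def insert_commute)
  note d = simple_edgeD[OF W wv]
  have M: "v < M" "w < M" "nbrs W v \<subseteq> {..<M}"
    using graph_stateD(11)[OF g] d nbrs_subset[OF W, of v] by auto
  have m0: "moved v w {} (nbrs W) = nbrs W" by (auto simp: moved_def fun_eq_iff)
  have "wp B (move_all (2 * L)) (wp B (seqs [Store 9 9 7, emit 2 10 9]) Q) s"
  proof (rule wp_move_all[OF e _ empty_subsetI M(3) v(2) M(1) nbrs_irrefl[OF W] w(2) M(2) w(1) nbrs_sym])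
    show "rep M (moved v w {} (nbrs W)) s" unfolding m0 by (rule graph_stateD(7)[OF g])
    show "card (nbrs W v - {}) \<le> 2 * L" "reg s 4 + card (nbrs W v - {}) \<le> B" using v b by auto
  next
    fix s1 assume r1: "rep M (moved v w (nbrs W v) (nbrs W)) s1"
      and f1: "frame ({4, 11} \<union> {12..18}) {6, 7, 8, 10} s s1"
      and p1: "reg s1 4 = reg s 4 + card (nbrs W v - {})" and k1: "stack s1 = nbrs W v - {} \<union> stack s"
    define s2 where "s2 = s1\<lparr>arr := (arr s1)(9 := (arr s1 9)(v := 0))\<rparr>"
    have f12: "frame {} {9} s1 s2" by (simp add: frame_def s2_def)
    have f2: "frame ({4, 11} \<union> {12..18}) {6, 7, 8, 9, 10} s s2" by (rule frame_trans[OF f1 f12]) auto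
    have e2: "env B M s2" using env_frame[OF e f2] by simp
    have v2: "reg s2 9 = v" "reg s2 10 = w" "reg s2 2 = reg s 2" using frame_reg[OF f2] v w by auto
    have n2: "reg s2 2 < B" using v2 graph_stateD(10)[OF g] bounds(5) by simp
    have "wp B (emit 2 10 9) Q s2"
    proof (rule wp_emit[OF e2 _ _ bounds(4) n2])
      fix s3 assume 3: "frame {2, 12} {3, 4, 5} s2 s3" "reg s3 2 = Suc (reg s2 2)"
        "output_ops s3 = output_ops s2 @ [decode_op 2 (reg s2 10) (reg s2 9)]"
      have f3: "frame ({2, 4, 11} \<union> {12..18}) {3..10} s s3" by (rule frame_trans[OF f2 3(1)]) auto
      have f13: "frame {2, 12} {3, 4, 5, 9} s1 s3" by (rule frame_trans[OF f12 3(1)]) auto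
      show "Q s3"
      proof (rule Q[OF graph_state_op[OF g] f3])
        show "env B M s3" using env_frame[OF e f3] by simp
        show "output_ops s3 = output_ops s @ [Contract w v]"
          using 3(3) output_ops_frame[OF f2] v2 by (simp add: decode_op_def)
        show "rep M (nbrs (apply_op (Contract w v) W)) s3"
          using rep_frame[OF r1 f13] moved_contract[OF W wv] by simp
        show "stack s3 = nbrs W v \<union> stack s" using k1 stack_frame[OF f13] by simp
        show "reg s3 4 = reg s 4 + card (nbrs W v)" using p1 frame_reg[OF f13] by simp
        show "arr s3 9 = (arr s 9)(v := 0)"
          using frame_arr[OF 3(1), of 9] frame_arr[OF f1, of 9] by (simp add: s2_def)
      qed (use wv v v2 3(2) frame_reg[OF f3] frame_arr[OF f3] in auto)
    qed auto
    moreover have "reg s1 9 = v" "reg s1 7 = 0" using frame_reg[OF f1] v e by (auto simp: env_def)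
    ultimately show "wp B (seqs [Store 9 9 7, emit 2 10 9]) Q s1" by (simp add: s2_def)
  qed
  then show ?thesis by (simp add: contract_def)
qed

end

section \<open>One step of the search and its potential\<close>

definition sparse_index :: "nat \<Rightarrow> nat \<Rightarrow> (nat \<times> nat) set \<Rightarrow> nat \<Rightarrow> bool" where
  "sparse_index L m R i \<longleftrightarrow> i < m \<and> card {j. (i, j) \<in> R} < L"

text \<open>The choice of \<open>i\<close> happens at a leaf of the decision tree, where
  \<open>m\<close> and \<open>R\<close> are constants, so it costs no running time.\<close>

definition process_low :: "nat \<Rightarrow> program" where
  "process_low L = by_neighbourhood (2 * L) (\<lambda>m R.
     if \<exists>i. sparse_index L m R i
     then Seq (load_neighbour 10 (SOME i. sparse_index L m R i)) (contract L)
     else Const 6 1)"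

text \<open>Entries of the stack may be outdated or repeated: the vertex may be gone or have high
  degree by now, and both tests come before any work.\<close>

definition pop_step :: "nat \<Rightarrow> program" where
  "pop_step L = seqs [Arith 4 Minus 4 8, Load 9 10 4, Load 12 9 9,
     Cond (Equal 12 7) Skip
       (seqs [Load 12 8 9,
          Cond (Less 20 12) Skip (Cond (Equal 12 7) remove_vertex (process_low L))])]"

text \<open>Register 5 points into the list of vertices. Vertices never come back, so it only moves
  forward, and all searches for a remaining vertex together take linear time.\<close>

definition sparsify_step :: program where
  "sparsify_step = seqs [Load 9 0 5, Load 12 9 9,
     Cond (Equal 12 7) (Arith 5 Plus 5 8)
       (seqs [Arith 12 Times 9 3, Load 10 6 12, delete_edge 9 10, push 9, push 10])]"

definition search_step :: "nat \<Rightarrow> program" where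
  "search_step L = Cond (Less 7 4) (pop_step L) sparsify_step"

text \<open>Shows that only neighbours of \<open>v\<close> can drop to low degree in a contraction,
  and these are exactly the vertices pushed.\<close>

lemma nbrs_contract_far:
  fixes W :: "nat graph"
  assumes "simple_graph W" "{w, v} \<in> edges W" "x \<noteq> v" "x \<notin> nbrs W v"
  shows "nbrs (apply_op (Contract w v) W) x = nbrs W x"
proof -
  have "w \<in> nbrs W v" using assms(2) by (simp add: nbrs_def insert_commute)
  then have "x \<noteq> w" using assms(4) by blast
  then show ?thesis
    unfolding moved_contract[OF assms(1,2), symmetric] using assms(3,4) by (simp add: moved_def)
qed

lemma nbrs_delete_edge:
  assumes "v \<noteq> w"
  shows "nbrs (apply_op (Del_Edge v w) W) = (nbrs W)(v := nbrs W v - {w}, w := nbrs W w - {v})"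
  using assms by (auto simp: nbrs_def fun_eq_iff doubleton_eq_iff)

context minor_search
begin

definition dense :: "nat graph \<Rightarrow> bool" where
  "dense W \<longleftrightarrow> verts W \<noteq> {} \<and> L * card (verts W) \<le> card (edges W)"

definition dense_at :: "nat graph \<Rightarrow> nat \<Rightarrow> bool" where
  "dense_at W v \<longleftrightarrow> v \<in> verts W \<and> nbrs W v \<noteq> {} \<and> card (nbrs W v) \<le> 2 * L \<and>
     (\<forall>w\<in>nbrs W v. L \<le> card (nbrs W v \<inter> nbrs W w))"

definition low :: "nat graph \<Rightarrow> nat set" where
  "low W = {x \<in> verts W. card (nbrs W x) \<le> 2 * L}"

text \<open>A contraction puts at most \<open>2 * L\<close> vertices on the stack and the deletion of an edge two,
  while every other step shortens the stack, advances the pointer \<open>r\<^sub>5\<close> or ends the search.\<close>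

definition potential :: "nat graph \<Rightarrow> state \<Rightarrow> nat" where
  "potential W s = (2 * L + 1) * card (verts W) + 3 * card (edges W) + reg s 4 +
     (length vs - reg s 5) + (1 - reg s 6)"

text \<open>The number \<open>f\<close> bounds the remaining steps. Since the height of the stack is
  part of the potential, \<open>f \<le> B\<close> also keeps register 4 within a machine word. Until
  the search ends, every vertex of degree at most \<open>2 * L\<close> waits on the stack, so an
  empty stack certifies high minimum degree.\<close>

definition search_inv :: "nat \<Rightarrow> state \<Rightarrow> bool" where
  "search_inv f s \<longleftrightarrow> f \<le> B \<and> reg s 6 \<le> 1 \<and> stack s \<subseteq> {..<M} \<and> reg s 5 \<le> length vs \<and>
     (\<exists>W. graph_state W s \<and> dense W \<and> (\<forall>i<reg s 5. vs ! i \<notin> verts W) \<and> potential W s \<le> f \<and>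
       (if reg s 6 = 0 then low W \<subseteq> stack s else dense_at W (reg s 9)))"

lemma search_invI:
  "f \<le> B \<Longrightarrow> reg s 6 \<le> 1 \<Longrightarrow> stack s \<subseteq> {..<M} \<Longrightarrow> reg s 5 \<le> length vs \<Longrightarrow> graph_state W s \<Longrightarrow>
   dense W \<Longrightarrow> (\<And>i. i < reg s 5 \<Longrightarrow> vs ! i \<notin> verts W) \<Longrightarrow> potential W s \<le> f \<Longrightarrow>
   (reg s 6 = 0 \<Longrightarrow> low W \<subseteq> stack s) \<Longrightarrow> (reg s 6 \<noteq> 0 \<Longrightarrow> dense_at W (reg s 9)) \<Longrightarrow> search_inv f s"
  unfolding search_inv_def by (intro conjI exI[of _ W]) auto

lemma card_remove_vert: "simple_graph W \<Longrightarrow> v \<in> verts W \<Longrightarrow> card (verts W) = Suc (card (verts W - {v}))"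
  using card_Suc_Diff1[OF simple_finite_verts] by metis

lemma contract_dense:
  assumes W: "simple_graph W" and d: "dense W" and w: "w \<in> nbrs W v"
    and c: "card (nbrs W v \<inter> nbrs W w) < L"
  defines "W' \<equiv> apply_op (Contract w v) W"
  shows "dense W'" "card (verts W) = Suc (card (verts W'))" "card (edges W') \<le> card (edges W)"
    "low W' \<subseteq> (low W - {v}) \<union> nbrs W v" "verts W' \<subseteq> verts W"
proof -
  have wv: "{w, v} \<in> edges W" using w by (simp add: nbrs_def insert_commute)
  note s = simple_edgeD[OF W wv]
  have V: "verts W' = verts W - {v}" by (simp add: W'_def)
  show cV: "card (verts W) = Suc (card (verts W'))" unfolding V by (rule card_remove_vert[OF W s(3)])
  have cE: "card (edges W') + card (nbrs W v \<inter> nbrs W w) + 1 = card (edges W)"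
    unfolding W'_def by (rule card_contract_edges[OF W wv])
  then show "card (edges W') \<le> card (edges W)" by linarith
  \<comment> \<open>One vertex less permits the loss of \<open>L\<close> edges, and at most
    \<open>L\<close> are lost.\<close>
  have "L * card (verts W) = L * card (verts W') + L" unfolding cV by simp
  then have "L * card (verts W') + L \<le> card (edges W)" using d unfolding dense_def by linarith
  then have "L * card (verts W') \<le> card (edges W')" using cE c by linarith
  moreover have "verts W' \<noteq> {}" using V s by auto
  ultimately show "dense W'" unfolding dense_def by blast
  show "low W' \<subseteq> (low W - {v}) \<union> nbrs W v"
  proof
    fix x assume x: "x \<in> low W'"
    then have xv: "x \<in> verts W" "x \<noteq> v" unfolding low_def V by auto
    show "x \<in> (low W - {v}) \<union> nbrs W v"
    proof (cases "x \<in> nbrs W v")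
      case False
      then have "nbrs W' x = nbrs W x" unfolding W'_def by (rule nbrs_contract_far[OF W wv xv(2)])
      then show ?thesis using x xv by (simp add: low_def)
    qed simp
  qed
  show "verts W' \<subseteq> verts W" using V by blast
qed

lemma remove_isolated_dense:
  assumes W: "simple_graph W" and d: "dense W" and v: "v \<in> verts W" "nbrs W v = {}"
  defines "W' \<equiv> apply_op (Del_Vertex v) W"
  shows "dense W'" "card (verts W) = Suc (card (verts W'))" "edges W' = edges W"
    "low W' \<subseteq> low W - {v}" "verts W' \<subseteq> verts W"
proof -
  have V: "verts W' = verts W - {v}" by (simp add: W'_def)
  show cV: "card (verts W) = Suc (card (verts W'))" unfolding V by (rule card_remove_vert[OF W v(1)])
  have "v \<notin> e" if e: "e \<in> edges W" for e
  proof
    assume "v \<in> e"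
    moreover obtain a b where "e = {a, b}" using simple_edgeE[OF W e] by metis
    ultimately have "e = {v, a} \<or> e = {v, b}" by auto
    then show False using e v(2) by (auto simp: nbrs_def)
  qed
  then show E: "edges W' = edges W" unfolding W'_def by auto
  then have N: "nbrs W' = nbrs W" by (simp add: nbrs_def fun_eq_iff)
  \<comment> \<open>As \<open>L \<ge> 1\<close>, a dense graph has an edge, and the deletion of an
    isolated vertex keeps it.\<close>
  have "verts W' \<noteq> {}"
  proof
    assume "verts W' = {}"
    then have "edges W' = {}" using simple_apply_op[OF W, of "Del_Vertex v"] v
      unfolding W'_def simple_graph_iff by (auto simp: pairs_def)
    then show False using d E cV L unfolding dense_def by simp
  qed
  then show "dense W'" using d E cV unfolding dense_def by simp
  show "low W' \<subseteq> low W - {v}" "verts W' \<subseteq> verts W" unfolding low_def V N by auto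
qed

lemma wp_process_low:
  assumes g: "graph_state W s" and v: "v \<in> verts W" "reg s 9 = v" "nbrs W v \<noteq> {}"
      "card (nbrs W v) \<le> 2 * L" and b: "reg s 4 + 2 * L \<le> B"
    and Q1: "\<And>s'. graph_state W s' \<Longrightarrow> frame ({6} \<union> {12..18}) {} s s' \<Longrightarrow> reg s' 6 = 1 \<Longrightarrow>
      dense_at W v \<Longrightarrow> Q s'"
    and Q2: "\<And>s' w. w \<in> nbrs W v \<Longrightarrow> card (nbrs W v \<inter> nbrs W w) < L \<Longrightarrow>
      graph_state (apply_op (Contract w v) W) s' \<Longrightarrow>
      frame ({2, 4, 10, 11} \<union> {12..18}) {3..10} s s' \<Longrightarrow>
      reg s' 4 = reg s 4 + card (nbrs W v) \<Longrightarrow> stack s' = nbrs W v \<union> stack s \<Longrightarrow> Q s'"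
  shows "wp B (process_low L) Q s"
proof -
  note e = graph_stateD(3)[OF g] and r = graph_stateD(7)[OF g]
  have M: "v < M" using graph_stateD(11)[OF g] v(1) by auto
  define a where "a = (\<lambda>i. arr s 6 (v * M + i))"
  let ?m = "card (nbrs W v)"
  let ?R = "local_relation (nbrs W) a ?m"
  have a: "bij_betw a {..<?m} (nbrs W v)"
    using rep_bij[OF r M] rep_degree[OF r M] by (simp add: a_def)
  have c: "card {j. (i, j) \<in> ?R} = card (nbrs W v \<inter> nbrs W (a i))" if "i < ?m" for i
    by (rule card_local_relation[where N = "nbrs W", OF a that])
  show ?thesis unfolding process_low_def
  proof (rule wp_by_neighbourhood[OF e r v(2) M v(4) bounds(3) a_def])
    fix s1 assume f1: "frame {12..18} {} s s1"
    have g1: "graph_state W s1" by (rule graph_state_frame[OF g f1]) auto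
    note e1 = graph_stateD(3)[OF g1] and r1 = graph_stateD(7)[OF g1]
    have v1: "reg s1 9 = v" using frame_reg[OF f1] v by simp
    show "wp B (if \<exists>i. sparse_index L ?m ?R i
      then Seq (load_neighbour 10 (SOME i. sparse_index L ?m ?R i)) (contract L) else Const 6 1) Q s1"
    proof (cases "\<exists>i. sparse_index L ?m ?R i")
      case True
      define i where "i = (SOME i. sparse_index L ?m ?R i)"
      have "sparse_index L ?m ?R i" unfolding i_def by (rule someI_ex[OF True])
      then have i: "i < ?m" "card {j. (i, j) \<in> ?R} < L" unfolding sparse_index_def by auto
      have w: "a i \<in> nbrs W v" using bij_betwE[OF a] i(1) by simp
      have cw: "card (nbrs W v \<inter> nbrs W (a i)) < L" using c[OF i(1)] i(2) by simp
      have "wp B (load_neighbour 10 i) (wp B (contract L) Q) s1"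
      proof (rule wp_load_neighbour[OF e1 r1 v1 M i(1)])
        fix s2 assume f2: "frame (insert 10 {12..18}) {} s1 s2"
          and w2: "reg s2 10 = arr s1 6 (v * M + i)"
        have f12: "frame (insert 10 {12..18}) {} s s2" by (rule frame_trans[OF f1 f2]) auto
        have g2: "graph_state W s2" by (rule graph_state_frame[OF g f12]) auto
        have w2': "reg s2 10 = a i" using w2 frame_arr[OF f1] by (simp add: a_def)
        have v2: "reg s2 9 = v" "reg s2 4 = reg s 4" using frame_reg[OF f12] v by auto
        show "wp B (contract L) Q s2"
        proof (rule wp_contract[OF g2 v(1) v2(1) v(4) w w2'])
          show "reg s2 4 + 2 * L \<le> B" using v2 b by simp
        next
          fix s3 assume 3: "graph_state (apply_op (Contract (a i) v) W) s3"
            "frame ({2, 4, 11} \<union> {12..18}) {3..10} s2 s3"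
            "reg s3 4 = reg s2 4 + card (nbrs W v)" "stack s3 = nbrs W v \<union> stack s2"
          show "Q s3"
          proof (rule Q2[OF w cw 3(1)])
            show "frame ({2, 4, 10, 11} \<union> {12..18}) {3..10} s s3"
              by (rule frame_trans[OF f12 3(2)]) auto
            show "reg s3 4 = reg s 4 + card (nbrs W v)" using 3(3) v2 by simp
            show "stack s3 = nbrs W v \<union> stack s" using 3(4) stack_frame[OF f12] by simp
          qed
        qed
      qed
      then show ?thesis using True by (simp add: i_def)
    next
      case False
      define s2 where "s2 = s1\<lparr>reg := (reg s1)(6 := 1)\<rparr>"
      have f12: "frame {6} {} s1 s2" by (simp add: frame_def s2_def)
      have f2: "frame ({6} \<union> {12..18}) {} s s2" by (rule frame_trans[OF f1 f12]) auto
      have "Q s2"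
      proof (rule Q1[OF _ f2])
        show "graph_state W s2" by (rule graph_state_frame[OF g f2]) auto
        show "dense_at W v" unfolding dense_at_def
        proof (intro conjI ballI)
          fix w assume "w \<in> nbrs W v"
          then obtain i where i: "i < ?m" "w = a i" using bij_betw_imp_surj_on[OF a] by auto
          then show "L \<le> card (nbrs W v \<inter> nbrs W w)"
            using False c[OF i(1)] unfolding sparse_index_def by (metis not_le)
        qed (use v in auto)
      qed (simp add: s2_def)
      then show ?thesis using False bounds(4) by (simp add: s2_def)
    qed
  qed
qed

lemma wp_pop_step:
  assumes i: "search_inv f s" and 0: "reg s 6 = 0" "0 < reg s 4"
  shows "f > 0 \<and> wp B (pop_step L) (search_inv (f - 1)) s"
proof -
  obtain W where g: "graph_state W s" and d: "dense W"
    and p: "\<And>i. i < reg s 5 \<Longrightarrow> vs ! i \<notin> verts W" "reg s 5 \<le> length vs"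
    and pot: "potential W s \<le> f" "f \<le> B" and st: "stack s \<subseteq> {..<M}" "low W \<subseteq> stack s"
    using i 0 unfolding search_inv_def by auto
  note W = graph_stateD(1)[OF g] and e = graph_stateD(3)[OF g] and r = graph_stateD(7)[OF g]
  have E: "reg s 7 = 0" "reg s 8 = Suc 0" "reg s 20 = 2 * L"
    using e graph_stateD(5)[OF g] by (auto simp: env_def)
  define v where "v = arr s 10 (reg s 4 - 1)"
  have f0: "f > 0" using pot 0 unfolding potential_def by simp
  have sp: "reg s 4 - 1 \<le> B" using pot unfolding potential_def by linarith
  have "v \<in> stack s" using 0 unfolding stack_def v_def by auto
  then have vM: "v < M" using st by auto
  define s1 where "s1 = s\<lparr>reg := (reg s)(4 := reg s 4 - 1, 9 := v, 12 := arr s 9 v)\<rparr>"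
  have f1: "frame ({4, 9, 12}) {} s s1" by (simp add: s1_def frame_def)
  have g1: "graph_state W s1" by (rule graph_state_frame[OF g f1]) auto
  have s41: "reg s1 4 + 1 = reg s 4" using 0 by (simp add: s1_def)
  have "{..<reg s 4} = insert (reg s 4 - 1) {..<reg s 4 - 1}" using 0 by auto
  then have k1: "stack s = insert v (stack s1)" by (simp add: stack_def v_def s1_def)
  \<comment> \<open>Serves both cases in which the popped vertex is discarded: it is removed or has
    high degree, so the stack still covers all of \<open>low W\<close>.\<close>
  have finish: "search_inv (f - 1) s'"
    if f: "frame ({4, 9} \<union> {12..18}) {} s s'" and s4: "reg s' 4 + 1 = reg s 4"
      and "stack s' = stack s1" "v \<notin> low W" for s'
  proof (rule search_invI)
    show "graph_state W s'" by (rule graph_state_frame[OF g f]) auto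
    have R: "reg s' 5 = reg s 5" "reg s' 6 = reg s 6" using frame_reg[OF f] by auto
    show "f - 1 \<le> B" using pot by simp
    show "potential W s' \<le> f - 1" using pot s4 R unfolding potential_def by simp
    show "stack s' \<subseteq> {..<M}" using that st k1 by auto
    show "low W \<subseteq> stack s'" using that st k1 by auto
  qed (use d p frame_reg[OF f] 0 in auto)
  have "wp B (Cond (Equal 12 7) Skip (seqs [Load 12 8 9,
          Cond (Less 20 12) Skip (Cond (Equal 12 7) remove_vertex (process_low L))]))
        (search_inv (f - 1)) s1"
  proof (cases "v \<in> verts W")
    case False
    have "frame ({4, 9} \<union> {12..18}) {} s s1" by (simp add: s1_def frame_def)
    then have "search_inv (f - 1) s1" using finish s41 False by (simp add: low_def)
    moreover have "reg s1 12 = 0" "reg s1 7 = 0"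
      using False graph_stateD(8)[OF g] E by (auto simp: s1_def)
    ultimately show ?thesis by simp
  next
    case True
    let ?d = "card (nbrs W v)"
    define s2 where "s2 = s1\<lparr>reg := (reg s1)(12 := ?d)\<rparr>"
    have f12: "frame {12} {} s1 s2" by (simp add: s2_def frame_def)
    have f2: "frame ({4, 9} \<union> {12..18}) {} s s2" by (rule frame_trans[OF f1 f12]) auto
    have g2: "graph_state W s2" by (rule graph_state_frame[OF g f2]) auto
    have k2: "stack s2 = stack s1" by (rule stack_frame[OF f12]) auto
    have R: "reg s2 9 = v" "reg s2 4 + 1 = reg s 4" "reg s2 5 = reg s 5" "reg s2 6 = 0"
      "reg s2 7 = 0" "reg s2 20 = 2 * L" "reg s2 12 = ?d"
      using s41 0 E by (auto simp: s1_def s2_def)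
    have fin: "finite (nbrs W v)" by (rule finite_nbrs[OF W])
    have "wp B (Cond (Less 20 12) Skip (Cond (Equal 12 7) remove_vertex (process_low L)))
        (search_inv (f - 1)) s2"
    proof -
      consider (high) "2 * L < ?d" | (isolated) "?d \<le> 2 * L" "nbrs W v = {}"
        | (low) "?d \<le> 2 * L" "nbrs W v \<noteq> {}" by linarith
      then show ?thesis
      proof cases
        case high
        then have "search_inv (f - 1) s2" using finish[OF f2 R(2) k2] by (simp add: low_def)
        then show ?thesis using R high by simp
      next
        case isolated
        note rd = remove_isolated_dense[OF W d True isolated(2)]
        have "wp B remove_vertex (search_inv (f - 1)) s2"
        proof (rule wp_remove_vertex[OF g2 True isolated(2) R(1)])
          fix s3 assume g3: "graph_state (apply_op (Del_Vertex v) W) s3"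
            and f3: "frame {2, 12} {3, 4, 5, 9} s2 s3"
          have k3: "stack s3 = stack s1" using stack_frame[OF f3] k2 by simp
          have R3: "reg s3 5 = reg s 5" "reg s3 6 = 0" "reg s3 4 + 1 = reg s 4"
            using frame_reg[OF f3] R by auto
          show "search_inv (f - 1) s3"
          proof (rule search_invI[OF _ _ _ _ g3 rd(1)])
            show "potential (apply_op (Del_Vertex v) W) s3 \<le> f - 1"
              using pot R3 rd(2,3) 0 unfolding potential_def by simp
            show "vs ! i \<notin> verts (apply_op (Del_Vertex v) W)" if "i < reg s3 5" for i
              using p(1) that R3 rd(5) by auto
            show "stack s3 \<subseteq> {..<M}" using k3 k1 st by auto
            show "low (apply_op (Del_Vertex v) W) \<subseteq> stack s3" using k3 k1 st rd(4) by auto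
          qed (use R3 pot p in auto)
        qed
        then show ?thesis using R isolated by simp
      next
        case low
        have pos: "?d > 0" using low fin by (simp add: card_gt_0_iff)
        \<comment> \<open>The vertex \<open>v\<close> still contributes \<open>2 * L + 1\<close> to
          the potential, which reserves room on the stack for its neighbours.\<close>
        have "2 * L + 1 \<le> (2 * L + 1) * card (verts W)"
          using card_remove_vert[OF W True] by simp
        then have b: "reg s2 4 + 2 * L \<le> B" using pot R unfolding potential_def by linarith
        have "wp B (process_low L) (search_inv (f - 1)) s2"
        proof (rule wp_process_low[OF g2 True R(1) low(2,1) b])
          fix s3 assume g3: "graph_state W s3" and f3: "frame ({6} \<union> {12..18}) {} s2 s3"
            and d3: "reg s3 6 = 1" "dense_at W v"
          have k3: "stack s3 = stack s1" using stack_frame[OF f3] k2 by simp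
          have R3: "reg s3 5 = reg s 5" "reg s3 4 + 1 = reg s 4" "reg s3 9 = v"
            using frame_reg[OF f3] R by auto
          show "search_inv (f - 1) s3"
          proof (rule search_invI[OF _ _ _ _ g3 d])
            show "potential W s3 \<le> f - 1" using pot R3 d3 0 unfolding potential_def by simp
            show "stack s3 \<subseteq> {..<M}" using k3 k1 st by auto
          qed (use R3 pot p d3 in auto)
        next
          fix s3 w assume w: "w \<in> nbrs W v" "card (nbrs W v \<inter> nbrs W w) < L"
            and g3: "graph_state (apply_op (Contract w v) W) s3"
            and f3: "frame ({2, 4, 10, 11} \<union> {12..18}) {3..10} s2 s3"
            and p3: "reg s3 4 = reg s2 4 + ?d" and k3: "stack s3 = nbrs W v \<union> stack s2"
          note cd = contract_dense[OF W d w]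
          have R3: "reg s3 5 = reg s 5" "reg s3 6 = 0" using frame_reg[OF f3] R by auto
          show "search_inv (f - 1) s3"
          proof (rule search_invI[OF _ _ _ _ g3 cd(1)])
            \<comment> \<open>The vertex lost releases \<open>2 * L + 1\<close> units, enough for
              the at most \<open>2 * L\<close> pushes.\<close>
            have "(2 * L + 1) * card (verts W) =
                (2 * L + 1) * card (verts (apply_op (Contract w v) W)) + (2 * L + 1)"
              unfolding cd(2) by simp
            then show "potential (apply_op (Contract w v) W) s3 \<le> f - 1"
              using pot R3 p3 R low(1) cd(3) 0 unfolding potential_def by linarith
            show "vs ! i \<notin> verts (apply_op (Contract w v) W)" if "i < reg s3 5" for i
              using p(1) that R3 cd(5) by auto
            have "nbrs W v \<subseteq> {..<M}" using nbrs_subset[OF W, of v] graph_stateD(11)[OF g] by blast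
            then show "stack s3 \<subseteq> {..<M}" using k3 k2 k1 st by auto
            show "low (apply_op (Contract w v) W) \<subseteq> stack s3" using k3 k2 k1 st cd(4) by blast
          qed (use R3 pot p in auto)
        qed
        then show ?thesis using R low pos by simp
      qed
    qed
    moreover have "reg s1 12 = 1" "reg s1 7 = 0" "reg s1 9 = v" "arr s1 8 v = ?d"
      using True graph_stateD(8)[OF g] E rep_degree[OF r vM] by (auto simp: s1_def)
    ultimately show ?thesis by (simp add: s2_def)
  qed
  then show ?thesis
    using f0 sp E 0 unfolding pop_step_def by (simp add: s1_def v_def split del: if_split)
qed

text \<open>A change of the stored edges alone emits nothing; the new graph only has to stay below
  some graph that the output produces. This covers forgetting an edge as well as reading
  one.\<close>

lemma graph_state_edges:
  assumes g: "graph_state W s" and W': "simple_graph W'" "verts W' = verts W"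
    and H: "spanning_subgraph W' H" "transforms (output_ops s) G H"
    and f: "frame R A s s'" "R \<inter> {0, 2, 3, 7, 8, 20} = {}" "A \<inter> {0, 3, 4, 5, 9} = {}"
    and r: "rep M (nbrs W') s'"
  shows "graph_state W' s'"
proof -
  have R: "reg s' r = reg s r" if "r \<in> {0, 2, 3, 7, 8, 20}" for r
    using frame_reg[OF f(1)] f(2) that by blast
  have A: "arr s' a = arr s a" if "a \<in> {0, 3, 4, 5, 9}" for a
    using frame_arr[OF f(1)] f(3) that by blast
  have "output_ops s' = output_ops s" using R[of 2] A by (simp add: output_ops_def)
  then have 1: "\<exists>H. spanning_subgraph W' H \<and> transforms (output_ops s') G H" using H by metis
  have 2: "env B M s'" using graph_stateD(3)[OF g] R by (simp add: env_def)
  show ?thesis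
    using 1 2 r W'(1) graph_stateD(2,4,5,6,10)[OF g] graph_stateD(8)[OF g] R A
    unfolding graph_state_def W'(2) by simp
qed

lemma graph_state_delete_edge:
  assumes g: "graph_state W s" and vw: "{v, w} \<in> edges W"
    and f: "frame R A s s'" "R \<inter> {0, 2, 3, 7, 8, 20} = {}" "A \<inter> {0, 3, 4, 5, 9} = {}"
    and r: "rep M ((nbrs W)(v := nbrs W v - {w}, w := nbrs W w - {v})) s'"
  shows "graph_state (apply_op (Del_Edge v w) W) s'"
proof -
  note W = graph_stateD(1)[OF g]
  let ?W = "apply_op (Del_Edge v w) W"
  obtain H where H: "spanning_subgraph W H" "transforms (output_ops s) G H"
    using graph_stateD(9)[OF g] by blast
  have "spanning_subgraph ?W H" using H(1) by (auto simp: spanning_subgraph_def)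
  moreover have "simple_graph ?W" by (rule simple_apply_op[OF W]) (use vw in simp)
  moreover have "rep M (nbrs ?W) s'" unfolding nbrs_delete_edge[OF simple_edgeD(1)[OF W vw]] by (rule r)
  ultimately show ?thesis using graph_state_edges[OF g _ _ _ H(2) f] by simp
qed

lemma wp_sparsify_step:
  assumes i: "search_inv f s" and 0: "reg s 6 = 0" "reg s 4 = 0"
  shows "f > 0 \<and> wp B sparsify_step (search_inv (f - 1)) s"
proof -
  obtain W where g: "graph_state W s" and d: "dense W"
    and p: "\<And>i. i < reg s 5 \<Longrightarrow> vs ! i \<notin> verts W" "reg s 5 \<le> length vs"
    and pot: "potential W s \<le> f" "f \<le> B" and st: "low W \<subseteq> stack s"
    using i 0 unfolding search_inv_def by auto
  note W = graph_stateD(1)[OF g] and e = graph_stateD(3)[OF g] and r = graph_stateD(7)[OF g]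
  have E: "reg s 7 = 0" "reg s 8 = Suc 0" "reg s 3 = M" using e by (auto simp: env_def)
  have f0: "f > 0" using pot 0 unfolding potential_def by simp
  have "low W = {}" using st 0 by (simp add: stack_def)
  then have high: "2 * L + 1 \<le> card (nbrs W x)" if "x \<in> verts W" for x
    using that unfolding low_def by force
  have n: "card (verts W) \<ge> 1"
    using d simple_finite_verts[OF W] unfolding dense_def by (simp add: card_gt_0_iff Suc_le_eq)
  \<comment> \<open>Minimum degree \<open>2 * L + 1\<close> gives half an edge per vertex beyond
    \<open>L\<close>, so at least one edge can be spared.\<close>
  have "(2 * L + 1) * card (verts W) \<le> 2 * card (edges W)" by (rule min_degree_edges[OF W high])
  moreover have "(2 * L + 1) * card (verts W) = 2 * (L * card (verts W)) + card (verts W)" by simp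
  ultimately have surplus: "L * card (verts W) + 1 \<le> card (edges W)" using n by linarith
  \<comment> \<open>All vertices before the pointer are gone, so a remaining vertex keeps the
    pointer inside the list.\<close>
  obtain y where "y \<in> verts W" using d unfolding dense_def by blast
  then obtain k where "k < length vs" "vs ! k \<in> verts W"
    using graph_stateD(2)[OF g] by (metis in_set_conv_nth subsetD)
  then have ptr: "reg s 5 < length vs" using p(1) by (metis not_le le_less_trans)
  define v where "v = vs ! reg s 5"
  have "v \<in> set vs" using ptr by (simp add: v_def)
  then have vM: "v < M" using vs(3) by auto
  define s1 where "s1 = s\<lparr>reg := (reg s)(9 := v, 12 := arr s 9 v)\<rparr>"
  have f1: "frame ({9, 12}) {} s s1" by (simp add: s1_def frame_def)
  have "wp B (Cond (Equal 12 7) (Arith 5 Plus 5 8)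
       (seqs [Arith 12 Times 9 3, Load 10 6 12, delete_edge 9 10, push 9, push 10]))
       (search_inv (f - 1)) s1"
  proof (cases "v \<in> verts W")
    case False
    define s2 where "s2 = s1\<lparr>reg := (reg s1)(5 := Suc (reg s 5))\<rparr>"
    have f2: "frame {5, 9, 12} {} s s2" by (simp add: s1_def s2_def frame_def)
    have R: "reg s2 5 = Suc (reg s 5)" "reg s2 4 = 0" "reg s2 6 = 0"
      using 0 by (auto simp: s1_def s2_def)
    have "search_inv (f - 1) s2"
    proof (rule search_invI[OF _ _ _ _ _ d])
      show "graph_state W s2" by (rule graph_state_frame[OF g f2]) auto
      show "potential W s2 \<le> f - 1" using pot R 0 ptr unfolding potential_def by simp
      show "vs ! i \<notin> verts W" if "i < reg s2 5" for i
        using that R p(1) False by (auto simp: less_Suc_eq v_def)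
    qed (use R pot ptr \<open>low W = {}\<close> in \<open>auto simp: stack_def\<close>)
    moreover have "reg s1 12 = 0" "reg s1 7 = 0" "reg s1 8 = Suc 0" "reg s1 5 = reg s 5"
      using False graph_stateD(8)[OF g] E by (auto simp: s1_def)
    moreover have "Suc (reg s 5) \<le> B" using ptr bounds(5) by simp
    ultimately show ?thesis by (simp add: s2_def)
  next
    case True
    define w where "w = arr s 6 (v * M)"
    have cN: "card (nbrs W v) > 0" using high[OF True] by linarith
    then have w: "w \<in> nbrs W v" using rep_nth[OF r vM, of 0] by (simp add: w_def)
    then have vw: "{v, w} \<in> edges W" by (simp add: nbrs_def)
    note dd = simple_edgeD[OF W vw]
    have wM: "w < M" using graph_stateD(11)[OF g] dd(3) by auto
    define s2 where "s2 = s1\<lparr>reg := (reg s1)(12 := v * M, 10 := w)\<rparr>"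
    have f2: "frame ({9, 10} \<union> {12..18}) {} s s2" by (simp add: s1_def s2_def frame_def)
    have e2: "env B M s2" using env_frame[OF e f2] by simp
    have r2: "rep M (nbrs W) s2" by (rule rep_frame[OF r f2]) simp
    have R2: "reg s2 9 = v" "reg s2 10 = w" by (auto simp: s1_def s2_def)
    let ?W = "apply_op (Del_Edge v w) W"
    have "wp B (delete_edge 9 10) (wp B (seqs [push 9, push 10]) (search_inv (f - 1))) s2"
    proof (rule wp_delete_edge[OF e2 r2 _ R2(1) vM _ R2(2) w])
      fix s3 assume r3: "rep M ((nbrs W)(v := nbrs W v - {w}, w := nbrs W w - {v})) s3"
        and f23: "frame {12..18} {6, 7, 8} s2 s3"
      have f3: "frame ({9, 10} \<union> {12..18}) {6, 7, 8} s s3" by (rule frame_trans[OF f2 f23]) auto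
      have g3: "graph_state ?W s3" by (rule graph_state_delete_edge[OF g vw f3 _ _ r3]) auto
      have R3: "reg s3 9 = v" "reg s3 10 = w" "reg s3 4 = 0" "reg s3 5 = reg s 5" "reg s3 6 = 0"
        using frame_reg[OF f3] frame_reg[OF f23] R2 0 by auto
      have e3: "env B M s3" by (rule graph_stateD(3)[OF g3])
      have "wp B (push 9) (wp B (push 10) (search_inv (f - 1))) s3"
      proof (rule wp_push[OF e3])
        fix s4 assume 4: "frame {4} {10} s3 s4" "reg s4 4 = Suc (reg s3 4)"
          "stack s4 = insert (reg s3 9) (stack s3)"
        have e4: "env B M s4" using env_frame[OF e3 4(1)] by simp
        show "wp B (push 10) (search_inv (f - 1)) s4"
        proof (rule wp_push[OF e4])
          fix s5 assume 5: "frame {4} {10} s4 s5" "reg s5 4 = Suc (reg s4 4)"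
            "stack s5 = insert (reg s4 10) (stack s4)"
          have f5: "frame {4} {10} s3 s5" by (rule frame_trans[OF 4(1) 5(1)]) auto
          have R5: "reg s5 4 = 2" "reg s5 5 = reg s 5" "reg s5 6 = 0"
            using 4(2) 5(2) R3 frame_reg[OF f5] by auto
          have k: "stack s5 = {v, w}"
            using 5(3) 4(3) R3 frame_reg[OF 4(1), of 10] by (auto simp: stack_def)
          have cE: "card (edges W) = Suc (card (edges ?W))"
            using card_Suc_Diff1[OF simple_finite_edges[OF W] vw] by simp
          have V: "verts ?W = verts W" by simp
          show "search_inv (f - 1) s5"
          proof (rule search_invI)
            show "graph_state ?W s5" by (rule graph_state_frame[OF g3 f5]) auto
            show "dense ?W" using d surplus cE unfolding dense_def V by simp
            \<comment> \<open>The deleted edge releases 3 units: two for the pushes and one for the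
              step.\<close>
            show "potential ?W s5 \<le> f - 1"
              using pot R5 0 cE unfolding potential_def V by simp
            show "stack s5 \<subseteq> {..<M}" using k vM wM by simp
            \<comment> \<open>No vertex was low before, and only the two ends of the deleted edge
              lost a neighbour.\<close>
            show "low ?W \<subseteq> stack s5"
            proof
              fix x assume x: "x \<in> low ?W"
              show "x \<in> stack s5"
              proof (rule ccontr)
                assume "x \<notin> stack s5"
                then have "nbrs ?W x = nbrs W x" unfolding nbrs_delete_edge[OF dd(1)] k by simp
                then show False using x \<open>low W = {}\<close> unfolding low_def V by auto
              qed
            qed
            show "vs ! i \<notin> verts ?W" if "i < reg s5 5" for i using p(1) that R5 by simp
          qed (use R5 pot p in auto)
        qed (use 4(2) R3 bounds(4) in auto)
      qed (use R3 bounds(4) in auto)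
      then show "wp B (seqs [push 9, push 10]) (search_inv (f - 1)) s3" by simp
    qed (use w nbrs_sym[of v W w] dd in auto)
    moreover have "reg s1 12 = 1" "reg s1 7 = 0" "reg s1 9 = v" "reg s1 3 = M" "arr s1 = arr s"
      using True graph_stateD(8)[OF g] E by (auto simp: s1_def)
    moreover have "v * M \<le> M * M" using vM by simp
    then have "v * M \<le> B" using bounds(1) by linarith
    ultimately show ?thesis by (simp add: s2_def w_def)
  qed
  moreover have "arr s 0 (reg s 5) = v" using graph_stateD(6)[OF g] ptr by (simp add: cells_def v_def)
  ultimately show ?thesis
    using f0 unfolding sparsify_step_def by (simp add: s1_def split del: if_split)
qed

lemma wp_search_step:
  assumes "search_inv f s" "reg s 6 = 0"
  shows "f > 0 \<and> wp B (search_step L) (search_inv (f - 1)) s"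
proof -
  have "reg s 7 = 0" using assms(1) unfolding search_inv_def by (metis env_def graph_stateD(3))
  then show ?thesis
    using wp_pop_step[OF assms] wp_sparsify_step[OF assms] by (simp add: search_step_def)
qed

end

subsection \<open>Reading the input\<close>

text \<open>Register 3 becomes one more than the largest name. The names go straight into array 10,
  so all vertices will start on the stack. Adding register 7, which is \<open>0\<close>, serves as
  copying.\<close>

definition read_vertex :: program where
  "read_vertex = seqs [Load 11 0 5, Store 10 5 11, Store 9 11 8, Arith 12 Plus 11 8,
     Cond (Less 3 12) (Arith 3 Plus 12 7) Skip, Arith 5 Plus 5 8]"

definition read_edge :: program where
  "read_edge = seqs [Load 9 1 5, Load 10 2 5, insert_edge 9 10, Arith 5 Plus 5 8]"

definition vertices_read ::
  "nat list \<Rightarrow> (nat \<times> nat) list \<Rightarrow> nat \<Rightarrow> nat \<Rightarrow> nat \<Rightarrow> state \<Rightarrow> bool" where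
  "vertices_read vs es L N i s \<longleftrightarrow> reg s 5 = i \<and> reg s 3 \<le> N + 1 \<and> reg s 0 = length vs \<and>
     reg s 2 = 0 \<and> reg s 6 = 0 \<and> reg s 7 = 0 \<and> reg s 8 = 1 \<and> reg s 20 = 2 * L \<and>
     (\<forall>x. arr s 9 x = (if x \<in> set (take i vs) then 1 else 0)) \<and>
     (\<forall>k<i. arr s 10 k = vs ! k \<and> vs ! k < reg s 3) \<and>
     (\<forall>a. a \<notin> {9, 10} \<longrightarrow> arr s a = arr (input_state vs es) a)"

lemma wp_read_vertex:
  assumes r: "vertices_read vs es L N i s" and i: "i < length vs"
    and N: "set vs \<subseteq> {..N}" "length vs \<le> N" "N + 1 \<le> B"
  shows "wp B read_vertex (vertices_read vs es L N (Suc i)) s"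
proof -
  let ?x = "vs ! i"
  have x: "?x \<le> N" using i N by (metis atMost_iff nth_mem subsetD)
  have a0: "arr s 0 i = ?x" using r i by (simp add: vertices_read_def input_state_def cells_def)
  have R: "reg s 5 = i" "reg s 7 = 0" "reg s 8 = Suc 0" using r by (auto simp: vertices_read_def)
  have s': "vertices_read vs es L N (Suc i) s'"
    if "reg s' 5 = Suc i" "reg s' 3 = max (reg s 3) (Suc ?x)"
      "\<And>q. q \<notin> {3, 5, 11, 12} \<Longrightarrow> reg s' q = reg s q"
      "arr s' 9 = (arr s 9)(?x := 1)" "arr s' 10 = (arr s 10)(i := ?x)"
      "\<And>a. a \<notin> {9, 10} \<Longrightarrow> arr s' a = arr s a" for s'
    using r that x i unfolding vertices_read_def
    by (auto simp: take_Suc_conv_app_nth less_Suc_eq less_max_iff_disj)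
  have b: "Suc ?x \<le> B" "Suc i \<le> B" using x i N by linarith+
  show ?thesis
  proof (cases "reg s 3 < Suc ?x")
    case True
    then show ?thesis using R a0 b unfolding read_vertex_def by simp (rule s'; simp add: max_def)
  next
    case False
    then show ?thesis using R a0 b unfolding read_vertex_def by simp (rule s'; simp add: max_def)
  qed
qed

context minor_search
begin

text \<open>Register 21 is the number of edges to be read. Reading stops there, since the full list
  may be quadratic in \<open>length vs\<close>.\<close>

definition edges_read :: "(nat \<times> nat) list \<Rightarrow> nat \<Rightarrow> state \<Rightarrow> bool" where
  "edges_read es j s \<longleftrightarrow> reg s 5 = j \<and> reg s 6 = 0 \<and> reg s 4 = length vs \<and> reg s 21 = L * length vs \<and>
     (\<forall>i<length vs. arr s 10 i = vs ! i) \<and>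
     arr s 1 = cells (map fst es) \<and> arr s 2 = cells (map snd es) \<and> output_ops s = [] \<and>
     graph_state (set vs, set (map (\<lambda>(u, v). {u, v}) (take j es))) s"

lemma wp_read_edge:
  assumes r: "edges_read es j s" and j: "j < length es" "Suc j \<le> B"
    and es: "distinct (map (\<lambda>(u, v). {u, v}) es)" "set (map (\<lambda>(u, v). {u, v}) es) = edges G"
  shows "wp B read_edge (edges_read es (Suc j)) s"
proof -
  let ?E = "\<lambda>j. set (map (\<lambda>(u, v). {u, v}) (take j es))"
  let ?W = "(set vs, ?E j)" and ?W' = "(set vs, ?E (Suc j))"
  obtain u x where ux: "es ! j = (u, x)" by fastforce
  have g: "graph_state ?W s" using r by (simp add: edges_read_def)
  have E: "?E (Suc j) = insert {u, x} (?E j)" using j ux by (simp add: take_Suc_conv_app_nth)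
  have "(\<lambda>(u, v). {u, v}) (es ! j) \<in> edges G" using es(2) j by (metis length_map nth_map nth_mem)
  then have uxG: "{u, x} \<in> edges G" using ux by simp
  note d = simple_edgeD[OF simple_G uxG]
  \<comment> \<open>The edges are distinct as unordered pairs, so no row receives an entry
    twice.\<close>
  have new: "{u, x} \<notin> ?E j"
  proof
    assume "{u, x} \<in> ?E j"
    then obtain k where k: "k < length es" "k < j" "(\<lambda>(u, v). {u, v}) (es ! k) = {u, x}"
      by (auto simp: in_set_conv_nth)
    then have "map (\<lambda>(u, v). {u, v}) es ! k = map (\<lambda>(u, v). {u, v}) es ! j" using j ux by simp
    then have "k = j" using nth_eq_iff_index_eq[OF es(1)] k(1) j(1) by (metis length_map)
    then show False using k(2) by simp
  qed
  have "?E (Suc j) \<subseteq> edges G" unfolding es(2)[symmetric] using set_take_subset[of "Suc j" es] by auto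
  then have W': "simple_graph ?W'" "spanning_subgraph ?W' G"
    using simple_G vs(2) unfolding simple_graph_iff spanning_subgraph_def by auto
  have nb: "nbrs ?W' = (nbrs ?W)(u := insert x (nbrs ?W u), x := insert u (nbrs ?W x))"
    unfolding nbrs_def fun_eq_iff snd_conv E using d(1) by (auto simp: doubleton_eq_iff)
  have M: "u < M" "x < M" using d vs by auto
  have e: "env B M s" and rep: "rep M (nbrs ?W) s" using graph_stateD[OF g] by auto
  have R: "reg s 5 = j" "reg s 6 = 0" "reg s 8 = 1" "arr s 1 j = u" "arr s 2 j = x"
    using r e j ux by (auto simp: edges_read_def cells_def env_def)
  define s1 where "s1 = s\<lparr>reg := (reg s)(9 := u, 10 := x)\<rparr>"
  have f1: "frame {9, 10} {} s s1" by (simp add: s1_def frame_def)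
  have e1: "env B M s1" using env_frame[OF e f1] by simp
  have r1: "rep M (nbrs ?W) s1" by (rule rep_frame[OF rep f1]) simp
  have R1: "reg s1 9 = u" "reg s1 10 = x" by (auto simp: s1_def)
  have "wp B (insert_edge 9 10) (wp B (Arith 5 Plus 5 8) (edges_read es (Suc j))) s1"
  proof (rule wp_insert_edge[OF e1 r1 _ R1(1) M(1) _ R1(2) M(2)])
    show "x \<notin> nbrs ?W u" "u \<notin> nbrs ?W x" using new by (auto simp: nbrs_def insert_commute)
  next
    fix s2 assume r2: "rep M ((nbrs ?W)(u := insert x (nbrs ?W u), x := insert u (nbrs ?W x))) s2"
      and f12: "frame {12..18} {6, 7, 8} s1 s2"
    have f2: "frame ({9, 10} \<union> {12..18}) {6, 7, 8} s s2" by (rule frame_trans[OF f1 f12]) auto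
    define s3 where "s3 = s2\<lparr>reg := (reg s2)(5 := Suc j)\<rparr>"
    have f23: "frame {5} {} s2 s3" by (simp add: s3_def frame_def)
    have f3: "frame ({5, 9, 10} \<union> {12..18}) {6, 7, 8} s s3" by (rule frame_trans[OF f2 f23]) auto
    have r3: "rep M (nbrs ?W') s3" unfolding nb by (rule rep_frame[OF r2 f23]) simp
    have o: "output_ops s = []" using r by (simp add: edges_read_def)
    have "graph_state ?W' s3"
      by (rule graph_state_edges[OF g W'(1) _ W'(2) _ f3 _ _ r3]) (use o in auto)
    moreover have "output_ops s3 = []" using output_ops_frame[OF f3] o by simp
    ultimately have "edges_read es (Suc j) s3"
      using r frame_reg[OF f3] frame_arr[OF f3] unfolding edges_read_def by (simp add: s3_def)
    moreover have "reg s2 5 = j" "reg s2 8 = 1" using frame_reg[OF f2] R by auto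
    ultimately show "wp B (Arith 5 Plus 5 8) (edges_read es (Suc j)) s2"
      using j(2) by (simp add: s3_def)
  qed (use d in auto)
  then show ?thesis using R unfolding read_edge_def by (simp add: s1_def)
qed

text \<open>The value of \<open>f\<close> is the initial potential: \<open>(2 * L + 1) * n\<close>
  for the vertices, \<open>3 * L * n\<close> for the edges, \<open>n\<close> for the stack,
  \<open>n\<close> for the pointer and 1 for the end of the search, where \<open>n\<close> is
  \<open>length vs\<close>.\<close>

lemma edges_read_search_inv:
  assumes r: "edges_read es (L * length vs) s" and l: "L * length vs \<le> length es" "vs \<noteq> []"
    and es: "distinct (map (\<lambda>(u, v). {u, v}) es)"
    and f: "f = (5 * L + 3) * length vs + 1" "f \<le> B"
  shows "search_inv f (s\<lparr>reg := (reg s)(5 := 0)\<rparr>)"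
proof -
  let ?s = "s\<lparr>reg := (reg s)(5 := 0)\<rparr>"
  let ?m = "map (\<lambda>(u, v). {u, v}) (take (L * length vs) es)"
  let ?W = "(set vs, set ?m)"
  have g: "graph_state ?W s" using r by (simp add: edges_read_def)
  have "distinct ?m" using es by (simp add: take_map[symmetric])
  then have c: "card (edges ?W) = L * length vs" using distinct_card l(1) by fastforce
  have cV: "card (verts ?W) = length vs" using vs(1) by (simp add: distinct_card)
  have R: "reg s 6 = 0" "reg s 4 = length vs" using r by (auto simp: edges_read_def)
  have k: "stack ?s = set vs"
    using r by (auto simp: stack_def edges_read_def set_conv_nth image_iff)
  have fr: "frame {5} {} s ?s" by (simp add: frame_def)
  show ?thesis
  proof (rule search_invI[of _ _ ?W])
    show "graph_state ?W ?s" by (rule graph_state_frame[OF g fr]) auto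
    show "dense ?W" unfolding dense_def c cV using l(2) by simp
    show "potential ?W ?s \<le> f" unfolding potential_def c cV f using R by (simp add: algebra_simps)
    show "low ?W \<subseteq> stack ?s" unfolding k low_def by simp
    show "stack ?s \<subseteq> {..<M}" unfolding k by (rule vs(3))
  qed (use R f in auto)
qed

end

subsection \<open>Writing the minor\<close>

abbreviation writes_complete :: "nat graph \<Rightarrow> nat \<Rightarrow> state \<Rightarrow> bool" where
  "writes_complete G t s \<equiv> \<exists>H. transforms (output_ops s) G H \<and> isomorphic H (complete_graph t)"

text \<open>Keeps exactly the neighbours of the vertex in register 9. That vertex is not its own
  neighbour, so it is deleted too.\<close>

definition discard_vertex :: program where
  "discard_vertex = seqs [Load 11 0 5, Load 12 9 11,
     Cond (Less 7 12)
       (seqs [Arith 12 Times 9 3, Arith 12 Plus 12 11, Load 12 7 12,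
          Cond (Equal 12 7) (emit 0 11 11) Skip])
       Skip,
     Arith 5 Plus 5 8]"

text \<open>The tabulated operations speak of list positions, and the names are looked up here. The
  rows no longer change in this phase, so the lookups stay valid.\<close>

fun emit_op :: "nat minor_op \<Rightarrow> program" where
  "emit_op (Del_Vertex i) = Seq (load_neighbour 14 i) (emit 0 14 14)"
| "emit_op (Del_Edge i j) = Seq (load_neighbour 14 i) (Seq (load_neighbour 15 j) (emit 1 14 15))"
| "emit_op (Contract i j) = Seq (load_neighbour 14 i) (Seq (load_neighbour 15 j) (emit 2 14 15))"

lemma wp_emit_op:
  assumes e: "env B M s" and r: "rep M N s" and v: "reg s 9 = v" "v < M"
    and x: "set_minor_op x \<subseteq> {..<card (N v)}" and b: "2 \<le> B" "reg s 2 < B"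
    and a: "a = (\<lambda>i. arr s 6 (v * M + i))"
    and Q: "\<And>s'. frame ({2} \<union> {12..18}) {3, 4, 5} s s' \<Longrightarrow> reg s' 2 = Suc (reg s 2) \<Longrightarrow>
      output_ops s' = output_ops s @ [map_minor_op a x] \<Longrightarrow> Q s'"
  shows "wp B (emit_op x) Q s"
proof -
  have load1: "wp B (load_neighbour 14 i) P s"
    if "i < card (N v)" and P: "\<And>s'. frame {12..18} {} s s' \<Longrightarrow> reg s' 14 = a i \<Longrightarrow> P s'" for i P
    by (rule wp_load_neighbour[OF e r v that(1)]) (use P a in \<open>simp add: insert_absorb\<close>)
  have load2: "wp B (load_neighbour 14 i) (wp B (load_neighbour 15 j) P) s"
    if ij: "i < card (N v)" "j < card (N v)"
      and P: "\<And>s'. frame {12..18} {} s s' \<Longrightarrow> reg s' 14 = a i \<Longrightarrow> reg s' 15 = a j \<Longrightarrow> P s'" for i j P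
  proof (rule load1[OF ij(1)])
    fix s1 assume f1: "frame {12..18} {} s s1" and 1: "reg s1 14 = a i"
    have e1: "env B M s1" using env_frame[OF e f1] by simp
    have r1: "rep M N s1" by (rule rep_frame[OF r f1]) simp
    have v1: "reg s1 9 = v" using frame_reg[OF f1] v by simp
    \<comment> \<open>The general rule for loading would allow register 14 to change, so the second
      load is evaluated explicitly.\<close>
    have E: "reg s1 3 = M" "M * M \<le> B" "M \<le> B" using e1 by (auto simp: env_def)
    have "card (N v) \<le> M" using card_mono[of "{..<M}" "N v"] rep_subset[OF r v(2)] by simp
    then have jM: "j < M" using ij by linarith
    then have "v * M \<le> B" "v * M + j \<le> B" "j \<le> B"
      using cell_bound[OF v(2) jM] E by linarith+
    moreover have "P (s1\<lparr>reg := (reg s1)(12 := v * M, 13 := v * M + j, 15 := arr s1 6 (v * M + j))\<rparr>)"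
    proof (rule P)
      show "frame {12..18} {} s (s1\<lparr>reg := (reg s1)(12 := v * M, 13 := v * M + j, 15 := arr s1 6 (v * M + j))\<rparr>)"
        using f1 by (simp add: frame_def)
    qed (use 1 a frame_arr[OF f1] in auto)
    ultimately show "wp B (load_neighbour 15 j) P s1"
      using E v1 unfolding load_neighbour_def by (simp add: fun_upd_twist)
  qed
  have fin: "wp B (emit k p q) Q s1"
    if f1: "frame {12..18} {} s s1" and k: "k \<le> 2" "p \<notin> {2, 12}" "q \<notin> {2, 12}"
      and x: "map_minor_op a x = decode_op k (reg s1 p) (reg s1 q)" for s1 k p q
  proof (rule wp_emit[OF _ k(2,3)])
    show "env B M s1" using env_frame[OF e f1] by simp
    show "k \<le> B" "reg s1 2 < B" using k b frame_reg[OF f1] by auto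
  next
    fix s2 assume 2: "frame {2, 12} {3, 4, 5} s1 s2" "reg s2 2 = Suc (reg s1 2)"
      "output_ops s2 = output_ops s1 @ [decode_op k (reg s1 p) (reg s1 q)]"
    show "Q s2"
    proof (rule Q)
      show "frame ({2} \<union> {12..18}) {3, 4, 5} s s2" by (rule frame_trans[OF f1 2(1)]) auto
    qed (use 2 x frame_reg[OF f1] output_ops_frame[OF f1] in auto)
  qed
  show ?thesis
  proof (cases x)
    case (Del_Vertex i)
    then show ?thesis using x by (auto intro!: load1 fin simp: decode_op_def)
  next
    case (Del_Edge i j)
    then show ?thesis using x by (auto intro!: load2 fin simp: decode_op_def)
  next
    case (Contract i j)
    then show ?thesis using x by (auto intro!: load2 fin simp: decode_op_def)
  qed
qed

lemma wp_emit_ops: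
  assumes "env B M s" "rep M N s" "reg s 9 = v" "v < M"
    "\<And>x. x \<in> set xs \<Longrightarrow> set_minor_op x \<subseteq> {..<card (N v)}" "2 \<le> B" "reg s 2 + length xs \<le> B"
    "a = (\<lambda>i. arr s 6 (v * M + i))"
    "\<And>s'. output_ops s' = output_ops s @ map (map_minor_op a) xs \<Longrightarrow> Q s'"
  shows "wp B (seqs (map emit_op xs)) Q s"
  using assms
proof (induction xs arbitrary: s)
  case (Cons x xs)
  have "wp B (emit_op x) (wp B (seqs (map emit_op xs)) Q) s"
  proof (rule wp_emit_op[OF Cons.prems(1-4) _ Cons.prems(6) _ Cons.prems(8)])
    fix s1 assume f1: "frame ({2} \<union> {12..18}) {3, 4, 5} s s1" and 1: "reg s1 2 = Suc (reg s 2)"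
      "output_ops s1 = output_ops s @ [map_minor_op a x]"
    show "wp B (seqs (map emit_op xs)) Q s1"
    proof (rule Cons.IH)
      show "env B M s1" using env_frame[OF Cons.prems(1) f1] by simp
      show "rep M N s1" by (rule rep_frame[OF Cons.prems(2) f1]) simp
      show "reg s1 9 = v" using frame_reg[OF f1] Cons.prems(3) by simp
      show "a = (\<lambda>i. arr s1 6 (v * M + i))" using Cons.prems(8) frame_arr[OF f1] by simp
      show "reg s1 2 + length xs \<le> B" using Cons.prems(7) 1 by simp
      show "Q s'" if "output_ops s' = output_ops s1 @ map (map_minor_op a) xs" for s'
        using Cons.prems(9) that 1 by simp
    qed (use Cons.prems in auto)
  qed (use Cons.prems in auto)
  then show ?case by simp
qed simp

text \<open>A merged vertex keeps an old name, so no operation introduces a new one. Hence all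
  operands in a table entry are valid positions.\<close>

lemma transforms_operands:
  assumes "transforms xs G H" "simple_graph G" "x \<in> set xs" shows "set_minor_op x \<subseteq> verts G"
  using assms
proof (induction xs arbitrary: G)
  case (Cons y xs)
  have y: "applicable y G" "transforms xs (apply_op y G) H" using Cons.prems(1) by auto
  show ?case
  proof (cases "x = y")
    case True
    then show ?thesis using y(1) simple_edgeD[OF Cons.prems(2)] by (cases y) auto
  next
    case False
    then show ?thesis
      using Cons.IH[OF y(2) simple_apply_op[OF Cons.prems(2) y(1)]] Cons.prems(3) verts_apply_op[of y G]
      by auto
  qed
qed simp

definition local_graph :: "nat \<Rightarrow> (nat \<times> nat) set \<Rightarrow> nat graph" where
  "local_graph m R = ({..<m}, {{i, j} | i j. (i, j) \<in> R})"

text \<open>A table entry: one fixed sequence for each local graph, chosen when the program is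
  formed.\<close>

definition complete_ops :: "nat \<Rightarrow> nat \<Rightarrow> (nat \<times> nat) set \<Rightarrow> nat minor_op list" where
  "complete_ops t m R = (SOME xs. \<exists>H. transforms xs (local_graph m R) H \<and>
     card (verts H) = t \<and> edges H = pairs (verts H))"

definition write_minor :: "nat \<Rightarrow> nat \<Rightarrow> program" where
  "write_minor t L = by_neighbourhood (2 * L) (\<lambda>m R. seqs (map emit_op (complete_ops t m R)))"

text \<open>There are finitely many pairs \<open>(m, R)\<close>. The common bound is needed because
  the word size must be chosen before the local graph is known.\<close>

lemma complete_ops_bounded:
  "\<exists>C. \<forall>m R. m \<le> k \<and> R \<subseteq> {..<m} \<times> {..<m} \<longrightarrow> length (complete_ops t m R) \<le> C"
proof -
  let ?S = "{..k} \<times> Pow ({..<k} \<times> {..<k})"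
  have "finite ((\<lambda>(m, R). length (complete_ops t m R)) ` ?S)" by simp
  then obtain C where C: "\<And>y. y \<in> (\<lambda>(m, R). length (complete_ops t m R)) ` ?S \<Longrightarrow> y \<le> C"
    by (metis finite_nat_set_iff_bounded_le)
  have "length (complete_ops t m R) \<le> C" if "m \<le> k" "R \<subseteq> {..<m} \<times> {..<m}" for m R
  proof -
    have "R \<subseteq> {..<k} \<times> {..<k}" using that by fastforce
    then have "(m, R) \<in> ?S" using that by simp
    then have "(\<lambda>(m, R). length (complete_ops t m R)) (m, R) \<le> C" by (intro C imageI)
    then show ?thesis by simp
  qed
  then show ?thesis by blast
qed

context minor_search
begin

text \<open>The stored graph \<open>W\<close> is left as it is while vertices are deleted; only the
  graph \<open>H\<close> reached by the output shrinks.\<close>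

definition discarded :: "nat graph \<Rightarrow> nat \<Rightarrow> nat \<Rightarrow> state \<Rightarrow> bool" where
  "discarded W v i s \<longleftrightarrow> env B M s \<and> reg s 5 = i \<and> reg s 0 = length vs \<and> reg s 9 = v \<and>
     arr s 0 = cells vs \<and> rep M (nbrs W) s \<and> (\<forall>x. arr s 9 x = (if x \<in> verts W then 1 else 0)) \<and>
     (\<exists>H. transforms (output_ops s) G H \<and> verts H = verts W - (set (take i vs) - nbrs W v) \<and>
        {e \<in> edges W. e \<subseteq> verts H} \<subseteq> edges H \<and> reg s 2 + card (verts H) \<le> length vs)"

lemma wp_discard_vertex:
  assumes r: "discarded W v i s" and i: "i < length vs" and v: "v < M"
  shows "wp B discard_vertex (discarded W v (Suc i)) s"
proof -
  let ?x = "vs ! i"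
  have e: "env B M s" and R: "reg s 5 = i" "reg s 0 = length vs" "reg s 9 = v" "arr s 0 = cells vs"
    and rep: "rep M (nbrs W) s" and al: "\<And>x. arr s 9 x = (if x \<in> verts W then 1 else 0)"
    using r unfolding discarded_def by auto
  obtain H where H: "transforms (output_ops s) G H" "verts H = verts W - (set (take i vs) - nbrs W v)"
    "{e \<in> edges W. e \<subseteq> verts H} \<subseteq> edges H" "reg s 2 + card (verts H) \<le> length vs"
    using r unfolding discarded_def by blast
  have E: "reg s 3 = M" "reg s 7 = 0" "reg s 8 = 1" using e by (auto simp: env_def)
  have "?x \<in> {..<M}" using vs(3) nth_mem[OF i] by blast
  then have x: "?x < M" "arr s 0 i = ?x" using i R(4) by (auto simp: cells_def)
  have T: "set (take (Suc i) vs) = insert ?x (set (take i vs))" using i by (simp add: take_Suc_conv_app_nth)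
  \<comment> \<open>No vertex is met twice, so a vertex that is still marked is really present in
    \<open>H\<close>.\<close>
  have "?x \<notin> set (take i vs)"
    using vs(1) i by (auto simp: in_set_conv_nth nth_eq_iff_index_eq)
  note nt = this
  have b: "Suc i \<le> B" using i bounds(5) by linarith
  have vx: "v * M \<le> B" "v * M + ?x \<le> B" using cell_bound[OF v x(1)] bounds(1) by linarith+
  have skip: "discarded W v (Suc i) s'"
    if f: "frame {5, 11, 12} {} s s'" and "reg s' 5 = Suc i" and n: "?x \<notin> verts W \<or> ?x \<in> nbrs W v" for s'
  proof -
    have "output_ops s' = output_ops s" by (rule output_ops_frame[OF f]) auto
    moreover have "verts H = verts W - (set (take (Suc i) vs) - nbrs W v)" unfolding T H(2) using n by auto
    moreover have "rep M (nbrs W) s'" by (rule rep_frame[OF rep f]) simp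
    moreover have "env B M s'" using env_frame[OF e f] by simp
    ultimately show ?thesis
      using H(1,3,4) that(2) R al frame_reg[OF f] frame_arr[OF f] unfolding discarded_def
      by (intro conjI exI[of _ H]) auto
  qed
  have del: "wp B (emit 0 11 11) (wp B (Arith 5 Plus 5 8) (discarded W v (Suc i))) s1"
    if f1: "frame {11, 12} {} s s1" and x1: "reg s1 11 = ?x" and n: "?x \<in> verts W" "?x \<notin> nbrs W v" for s1
  proof (rule wp_emit)
    show "env B M s1" using env_frame[OF e f1] by simp
    have "simple_graph H" by (rule simple_transforms[OF simple_G H(1)])
    moreover have xH: "?x \<in> verts H" unfolding H(2) using n nt by simp
    ultimately have cH: "card (verts H) = Suc (card (verts H - {?x}))" by (rule card_remove_vert)
    then show "reg s1 2 < B" using H(4) bounds(5) frame_reg[OF f1] by simp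
    fix s2 assume 2: "frame {2, 12} {3, 4, 5} s1 s2" "reg s2 2 = Suc (reg s1 2)"
      "output_ops s2 = output_ops s1 @ [decode_op 0 (reg s1 11) (reg s1 11)]"
    have f2: "frame {2, 11, 12} {3, 4, 5} s s2" by (rule frame_trans[OF f1 2(1)]) auto
    define s3 where "s3 = s2\<lparr>reg := (reg s2)(5 := Suc i)\<rparr>"
    have f23: "frame {5} {} s2 s3" by (simp add: s3_def frame_def)
    have f3: "frame {2, 5, 11, 12} {3, 4, 5} s s3" by (rule frame_trans[OF f2 f23]) auto
    let ?H = "apply_op (Del_Vertex ?x) H"
    have o: "output_ops s3 = output_ops s @ [Del_Vertex ?x]"
      using 2(3) output_ops_frame[OF f1] output_ops_frame[OF f23] x1 by (simp add: decode_op_def)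
    have "transforms (output_ops s3) G ?H"
      unfolding o transforms_append using H(1) xH by (intro exI[of _ H]) simp
    moreover have "verts ?H = verts W - (set (take (Suc i) vs) - nbrs W v)"
      unfolding T using H(2) n by auto
    moreover have "{e \<in> edges W. e \<subseteq> verts ?H} \<subseteq> edges ?H" using H(3) by auto
    moreover have "reg s3 2 + card (verts ?H) \<le> length vs"
      using cH H(4) 2(2) frame_reg[OF f1] frame_reg[OF f23] by simp
    moreover have "rep M (nbrs W) s3" by (rule rep_frame[OF rep f3]) simp
    moreover have "env B M s3" using env_frame[OF e f3] by simp
    moreover have "reg s3 5 = Suc i" by (simp add: s3_def)
    ultimately have "discarded W v (Suc i) s3"
      using R al frame_reg[OF f3] frame_arr[OF f3] unfolding discarded_def
      by (intro conjI exI[of _ ?H]) auto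
    moreover have "reg s2 5 = i" "reg s2 8 = 1" using frame_reg[OF f2] R E by auto
    ultimately show "wp B (Arith 5 Plus 5 8) (discarded W v (Suc i)) s2"
      using b by (simp add: s3_def)
  qed auto
  show ?thesis
  proof (cases "?x \<in> verts W")
    case False
    then show ?thesis
      unfolding discard_vertex_def using R E x(2) al[of ?x] b
      by simp (rule skip; simp add: frame_def)
  next
    case True
    have P: "0 < arr s 7 (v * M + ?x) \<longleftrightarrow> ?x \<in> nbrs W v" by (rule rep_adjacent[OF rep v x(1)])
    show ?thesis
    proof (cases "?x \<in> nbrs W v")
      case nb: True
      then show ?thesis
        unfolding discard_vertex_def using R E x(2) al[of ?x] b vx P True
        by simp (rule skip; simp add: frame_def)
    next
      case nb: False
      then show ?thesis
        unfolding discard_vertex_def using R E x(2) al[of ?x] b vx P True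
        by simp (rule del; simp add: frame_def)
    qed
  qed
qed

text \<open>The tabulated operations live on list positions. They are renamed along \<open>a\<close>
  to the graph induced by the neighbourhood, and then lifted to \<open>H\<close>, which may have
  more edges on the same vertices.\<close>

lemma wp_write_minor:
  assumes r: "discarded W v (length vs) s" and W: "simple_graph W" "verts W \<subseteq> set vs"
    and d: "dense_at W v" and t: "\<And>K :: nat graph. simple_graph K \<Longrightarrow> verts K \<noteq> {} \<Longrightarrow>
      L * card (verts K) \<le> 2 * card (edges K) \<Longrightarrow> minor (complete_graph t) K"
    and C: "\<And>m R. m \<le> 2 * L \<Longrightarrow> R \<subseteq> {..<m} \<times> {..<m} \<Longrightarrow> length (complete_ops t m R) \<le> C"
      "length vs + C \<le> B"
  shows "wp B (write_minor t L)
    (writes_complete G t) s"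
proof -
  let ?N = "nbrs W v" let ?m = "card ?N"
  have vd: "v \<in> verts W" "?N \<noteq> {}" "?m \<le> 2 * L" "\<And>w. w \<in> ?N \<Longrightarrow> L \<le> card (?N \<inter> nbrs W w)"
    using d unfolding dense_at_def by auto
  have vM: "v < M" using vd(1) W(2) vs(3) by auto
  have e: "env B M s" and v9: "reg s 9 = v" and rep: "rep M (nbrs W) s"
    using r unfolding discarded_def by auto
  obtain H where H: "transforms (output_ops s) G H" "verts H = verts W - (set vs - ?N)"
    "{e \<in> edges W. e \<subseteq> verts H} \<subseteq> edges H" "reg s 2 + card (verts H) \<le> length vs"
    using r unfolding discarded_def by auto
  have sN: "?N \<subseteq> verts W" by (rule nbrs_subset[OF W(1)])
  then have VH: "verts H = ?N" using H(2) W(2) by auto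
  let ?K = "induce W ?N"
  have K: "simple_graph ?K" by (rule simple_induce[OF W(1) sN])
  have sp: "spanning_subgraph ?K H" using H(3) VH unfolding spanning_subgraph_def induce_def by simp
  have "L * ?m \<le> 2 * card (edges ?K)" by (rule dense_neighbourhood[OF W(1) vd(4)])
  then have mK: "minor (complete_graph t) ?K" using t[OF K] vd(2) by (simp add: induce_def)
  define a where "a = (\<lambda>i. arr s 6 (v * M + i))"
  have a: "bij_betw a {..<?m} ?N"
    using rep_bij[OF rep vM] rep_degree[OF rep vM] by (simp add: a_def)
  let ?R = "local_relation (nbrs W) a ?m" let ?X = "local_graph ?m ?R"
  have injX: "inj_on a (verts ?X)" using bij_betw_imp_inj_on[OF a] by (simp add: local_graph_def)
  have aX: "a ` {..<?m} = ?N" by (rule bij_betw_imp_surj_on[OF a])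
  have "{i, j} \<in> pairs {..<?m}" if ij: "(i, j) \<in> ?R" for i j
  proof (rule pairsI)
    show "i \<noteq> j" using ij nbrs_irrefl[OF W(1), of "a i"] by (auto simp: local_relation_def)
  qed (use ij in \<open>auto simp: local_relation_def\<close>)
  then have X: "simple_graph ?X" unfolding simple_graph_iff local_graph_def by auto
  have mapX: "graph_map a ?X = ?K"
  proof -
    have "e \<in> edges ?K \<longleftrightarrow> e \<in> (\<lambda>e. a ` e) ` edges ?X" for e
    proof
      assume "e \<in> edges ?K"
      then have e: "e \<in> edges W" "e \<subseteq> ?N" by (auto simp: induce_def)
      obtain x y where xy: "e = {x, y}" using simple_edgeE[OF W(1) e(1)] by metis
      then have "x \<in> a ` {..<?m}" "y \<in> a ` {..<?m}" using e(2) aX by auto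
      then obtain i j where ij: "i < ?m" "j < ?m" "x = a i" "y = a j" by auto
      then have "{i, j} \<in> edges ?X" using e(1) xy by (auto simp: local_graph_def local_relation_def nbrs_def)
      moreover have "e = a ` {i, j}" using xy ij by simp
      ultimately show "e \<in> (\<lambda>e. a ` e) ` edges ?X" by blast
    next
      assume "e \<in> (\<lambda>e. a ` e) ` edges ?X"
      then obtain i j where ij: "i < ?m" "j < ?m" "a j \<in> nbrs W (a i)" "e = {a i, a j}"
        by (auto simp: local_graph_def local_relation_def)
      moreover have "a i \<in> ?N" "a j \<in> ?N" using ij(1,2) aX by auto
      ultimately show "e \<in> edges ?K" by (simp add: induce_def nbrs_def)
    qed
    then have "edges (graph_map a ?X) = edges ?K" by (auto simp: graph_map_def)
    moreover have "verts (graph_map a ?X) = verts ?K"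
      using aX by (simp add: graph_map_def induce_def local_graph_def)
    ultimately show ?thesis by (simp add: prod_eq_iff)
  qed
  \<comment> \<open>Makes the table entry meaningful: the choice in \<open>complete_ops\<close> is
    from a nonempty set.\<close>
  have "minor (complete_graph t) ?X"
    using mK minor_complete_graph_map_iff[OF X injX] mapX by simp
  then have "\<exists>xs H. transforms xs ?X H \<and> card (verts H) = t \<and> edges H = pairs (verts H)"
    using minor_complete_iff[OF X] by blast
  from someI_ex[OF this] obtain H' where H': "transforms (complete_ops t ?m ?R) ?X H'"
    "card (verts H') = t" "edges H' = pairs (verts H')"
    unfolding complete_ops_def by blast
  let ?xs = "complete_ops t ?m ?R"
  have inj': "inj_on a (verts H')" by (rule inj_on_subset[OF injX verts_transforms[OF H'(1)]])
  have "transforms (map (map_minor_op a) ?xs) ?K (graph_map a H')"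
    using graph_map_transforms[OF X injX H'(1)] mapX by simp
  then obtain H'' where H'': "transforms (map (map_minor_op a) ?xs) H H''"
    "spanning_subgraph (graph_map a H') H''"
    using spanning_transforms[OF _ sp] by blast
  have out: "transforms (output_ops s @ map (map_minor_op a) ?xs) G H''"
    unfolding transforms_append using H(1) H''(1) by blast
  have sH: "simple_graph H''" by (rule simple_transforms[OF simple_G out])
  have "edges (graph_map a H') = pairs (verts (graph_map a H'))"
    using H'(3) pairs_image[OF inj'] by (simp add: graph_map_def)
  then have "edges H'' = pairs (verts H'')" by (rule complete_spanning[OF H''(2) sH])
  moreover have "card (verts H'') = t"
    using H''(2) H'(2) card_image[OF inj'] by (simp add: spanning_subgraph_def graph_map_def)
  ultimately have iso: "isomorphic H'' (complete_graph t)" using isomorphic_complete_iff[OF sH] by blast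
  have ops: "set_minor_op x \<subseteq> {..<?m}" if "x \<in> set ?xs" for x
    using transforms_operands[OF H'(1) X that] by (simp add: local_graph_def)
  have len: "length ?xs \<le> C" by (rule C(1)[OF vd(3)]) (auto simp: local_relation_def)
  show ?thesis unfolding write_minor_def
  proof (rule wp_by_neighbourhood[OF e rep v9 vM vd(3) bounds(3) a_def])
    fix s1 assume f1: "frame {12..18} {} s s1"
    show "wp B (seqs (map emit_op ?xs))
      (writes_complete G t) s1"
    proof (rule wp_emit_ops[where N = "nbrs W" and v = v and M = M and a = a])
      show "env B M s1" using env_frame[OF e f1] by simp
      show "rep M (nbrs W) s1" by (rule rep_frame[OF rep f1]) simp
      show "reg s1 9 = v" using frame_reg[OF f1] v9 by simp
      show "reg s1 2 + length ?xs \<le> B" using frame_reg[OF f1] H(4) len C(2) by simp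
      show "a = (\<lambda>i. arr s1 6 (v * M + i))" using frame_arr[OF f1] a_def by simp
      show "set_minor_op x \<subseteq> {..<?m}" if "x \<in> set ?xs" for x by (rule ops[OF that])
      fix s2 assume "output_ops s2 = output_ops s1 @ map (map_minor_op a) ?xs"
      then have "output_ops s2 = output_ops s @ map (map_minor_op a) ?xs"
        using output_ops_frame[OF f1] by simp
      then show "writes_complete G t s2"
        using out iso by metis
    qed (fact vM bounds(4))+
  qed
qed

end

subsection \<open>The algorithm\<close>

definition search_and_write :: "nat \<Rightarrow> nat \<Rightarrow> program" where
  "search_and_write t L = Seq (While (Less 5 21) read_edge) (Seq (Const 5 0)
     (Seq (While (Equal 6 7) (search_step L)) (Seq (Const 5 0)
       (Seq (While (Less 5 0) discard_vertex) (write_minor t L)))))"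

definition find_minor :: "nat \<Rightarrow> nat \<Rightarrow> program" where
  "find_minor t L = Seq (seqs [Const 8 1, Const 20 (2 * L)]) (Seq (While (Less 5 0) read_vertex)
     (Seq (seqs [Arith 4 Plus 5 7, Const 5 0, Const 12 L, Arith 21 Times 0 12])
       (search_and_write t L)))"

lemma (in minor_search) runs_search_and_write:
  assumes r: "edges_read es 0 s" and n: "vs \<noteq> []" "L * length vs \<le> length es"
    and es: "distinct (map (\<lambda>(u, v). {u, v}) es)" "set (map (\<lambda>(u, v). {u, v}) es) = edges G"
    and t: "\<And>K :: nat graph. simple_graph K \<Longrightarrow> verts K \<noteq> {} \<Longrightarrow>
      L * card (verts K) \<le> 2 * card (edges K) \<Longrightarrow> minor (complete_graph t) K"
    and C: "\<And>m R. m \<le> 2 * L \<Longrightarrow> R \<subseteq> {..<m} \<times> {..<m} \<Longrightarrow> length (complete_ops t m R) \<le> C"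
      "length vs + C \<le> B"
    and f: "f = (5 * L + 3) * length vs + 1" "f \<le> B"
  shows "runs B (search_and_write t L)
    ((1 + L * length vs * (1 + time_bound read_edge)) + (1 +
      ((1 + f * (1 + time_bound (search_step L))) + (1 +
        ((1 + length vs * (1 + time_bound discard_vertex)) + time_bound (write_minor t L))))))
    (writes_complete G t) s"
proof -
  let ?n = "length vs"
  \<comment> \<open>In the counting loops \<open>f\<close> is the number of iterations still to
    come, so the index reached is the total minus \<open>f\<close>.\<close>
  have reading: "runs B (While (Less 5 21) read_edge) (1 + L * ?n * (1 + time_bound read_edge))
    (\<lambda>s'. (\<exists>f. f \<le> L * ?n \<and> edges_read es (L * ?n - f) s') \<and> \<not> holds (Less 5 21) s') s"
  proof (rule runs_While[where I = "\<lambda>f s. f \<le> L * ?n \<and> edges_read es (L * ?n - f) s"])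
    fix f' s assume I: "f' \<le> L * ?n \<and> edges_read es (L * ?n - f') s" and h: "holds (Less 5 21) s"
    have f0: "f' > 0" using I h by (auto simp: edges_read_def)
    then have S: "L * ?n - (f' - 1) = Suc (L * ?n - f')" using I by linarith
    have lt: "L * ?n - f' < length es" "Suc (L * ?n - f') \<le> B"
    proof -
      have "L * ?n \<le> f" unfolding f(1) by (simp add: algebra_simps)
      then show "L * ?n - f' < length es" "Suc (L * ?n - f') \<le> B" using f0 I n(2) f(2) by linarith+
    qed
    have "wp B read_edge (edges_read es (Suc (L * ?n - f'))) s"
      by (rule wp_read_edge[OF conjunct2[OF I] lt es])
    then show "0 < f' \<and> wp B read_edge (\<lambda>s. f' - 1 \<le> L * ?n \<and> edges_read es (L * ?n - (f' - 1)) s) s"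
      using f0 I S by (auto intro: wp_mono)
  qed (use r in simp)
  show ?thesis unfolding search_and_write_def
  proof (rule runs_Seq[OF reading])
    fix s1 assume s1: "(\<exists>f. f \<le> L * ?n \<and> edges_read es (L * ?n - f) s1) \<and> \<not> holds (Less 5 21) s1"
    then obtain f' where f': "f' \<le> L * ?n" "edges_read es (L * ?n - f') s1" by blast
    moreover have "\<not> L * ?n - f' < L * ?n" using f'(2) s1 by (auto simp: edges_read_def)
    ultimately have "edges_read es (L * ?n) s1" by (metis diff_less diff_zero le_0_eq less_le_trans not_gr_zero)
    then have "search_inv f (s1\<lparr>reg := (reg s1)(5 := 0)\<rparr>)"
      by (rule edges_read_search_inv[OF _ n(2,1) es(1) f])
    then have "wp B (Const 5 0) (search_inv f) s1" by simp
    from runs_wp[OF this] have start: "runs B (Const 5 0) 1 (search_inv f) s1" by simp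
    show "runs B (Seq (Const 5 0) (Seq (While (Equal 6 7) (search_step L)) (Seq (Const 5 0)
         (Seq (While (Less 5 0) discard_vertex) (write_minor t L)))))
      (1 + ((1 + f * (1 + time_bound (search_step L))) + (1 +
        ((1 + ?n * (1 + time_bound discard_vertex)) + time_bound (write_minor t L)))))
      (writes_complete G t) s1"
    proof (rule runs_Seq[OF start], rule runs_Seq[OF runs_While[where I = search_inv]])
      fix s2 show "search_inv f s2 \<Longrightarrow> search_inv f s2" .
    next
      fix f' s2 assume "search_inv f' s2" "holds (Equal 6 7) s2"
      moreover have "reg s2 7 = 0"
        using calculation(1) unfolding search_inv_def by (metis env_def graph_stateD(3))
      ultimately show "0 < f' \<and> wp B (search_step L) (search_inv (f' - 1)) s2"
        using wp_search_step by simp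
    next
      fix s3 assume s3: "(\<exists>f'. search_inv f' s3) \<and> \<not> holds (Equal 6 7) s3"
      then obtain f' W where g: "graph_state W s3"
        and W: "if reg s3 6 = 0 then low W \<subseteq> stack s3 else dense_at W (reg s3 9)"
        unfolding search_inv_def by blast
      note gD = graph_stateD[OF g]
      let ?v = "reg s3 9"
      have "reg s3 7 = 0" using gD(3) by (simp add: env_def)
      \<comment> \<open>The loop was left with a nonzero register 6, so the invariant holds in its
        second form.\<close>
      then have d: "dense_at W ?v" using s3 W by (auto split: if_splits)
      then have vM: "?v < M" using gD(11) unfolding dense_at_def by auto
      let ?s = "s3\<lparr>reg := (reg s3)(5 := 0)\<rparr>"
      have fr: "frame {5} {} s3 ?s" by (simp add: frame_def)
      obtain H where H: "spanning_subgraph W H" "transforms (output_ops s3) G H" using gD(9) by blast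
      have "discarded W ?v 0 ?s"
        unfolding discarded_def
      proof (intro conjI exI[of _ H])
        show "env B M ?s" using env_frame[OF gD(3) fr] by simp
        show "rep M (nbrs W) ?s" by (rule rep_frame[OF gD(7) fr]) simp
        show "transforms (output_ops ?s) G H" using H(2) output_ops_frame[OF fr] by simp
      qed (use gD(4,6,8,10) H(1) in \<open>auto simp: spanning_subgraph_def\<close>)
      then have "wp B (Const 5 0) (discarded W ?v 0) s3" by simp
      from runs_wp[OF this] have start: "runs B (Const 5 0) 1 (discarded W ?v 0) s3" by simp
      show "runs B (Seq (Const 5 0) (Seq (While (Less 5 0) discard_vertex) (write_minor t L)))
        (1 + ((1 + ?n * (1 + time_bound discard_vertex)) + time_bound (write_minor t L)))
        (writes_complete G t) s3"
      proof (rule runs_Seq[OF start],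
          rule runs_Seq[OF runs_While[where I = "\<lambda>f s. f \<le> ?n \<and> discarded W ?v (?n - f) s"]])
        fix s4 assume "discarded W ?v 0 s4"
        then show "?n \<le> ?n \<and> discarded W ?v (?n - ?n) s4" by simp
      next
        fix f' s4 assume I: "f' \<le> ?n \<and> discarded W ?v (?n - f') s4" and h: "holds (Less 5 0) s4"
        have f0: "f' > 0" "?n - f' < ?n" using I h by (auto simp: discarded_def)
        then have S: "?n - (f' - 1) = Suc (?n - f')" using I by linarith
        have "wp B discard_vertex (discarded W ?v (Suc (?n - f'))) s4"
          by (rule wp_discard_vertex[OF conjunct2[OF I] f0(2) vM])
        then show "0 < f' \<and> wp B discard_vertex (\<lambda>s. f' - 1 \<le> ?n \<and> discarded W ?v (?n - (f' - 1)) s) s4"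
          using f0 I S by (auto intro: wp_mono)
      next
        fix s5 assume s5: "(\<exists>f'. f' \<le> ?n \<and> discarded W ?v (?n - f') s5) \<and> \<not> holds (Less 5 0) s5"
        then obtain f' where f': "f' \<le> ?n" "discarded W ?v (?n - f') s5" by blast
        then have "\<not> ?n - f' < ?n" using s5 by (auto simp: discarded_def)
        then have "?n - f' = ?n" by linarith
        then have "discarded W ?v ?n s5" using f'(2) by simp
        then show "runs B (write_minor t L) (time_bound (write_minor t L))
          (writes_complete G t) s5"
          by (intro runs_wp wp_write_minor[OF _ gD(1,2) d t C])
      qed
    qed
  qed
qed

text \<open>The two bounds on \<open>B\<close> cover all numbers that occur: the quadratic one the
  addresses in arrays 6 and 7, the linear one the potential, the counters and the length of the
  output.\<close>

lemma runs_find_minor: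
  fixes G :: "nat graph"
  assumes G: "lists_graph vs es G" and n: "vs \<noteq> []" "L \<ge> 1" "L * length vs \<le> length es"
    and t: "\<And>K :: nat graph. simple_graph K \<Longrightarrow> verts K \<noteq> {} \<Longrightarrow>
      L * card (verts K) \<le> 2 * card (edges K) \<Longrightarrow> minor (complete_graph t) K"
    and C: "\<And>m R. m \<le> 2 * L \<Longrightarrow> R \<subseteq> {..<m} \<times> {..<m} \<Longrightarrow> length (complete_ops t m R) \<le> C"
    and N: "set vs \<subseteq> {..N}" "length vs \<le> N"
    and B: "(N + 1) * (N + 1) \<le> B" "(5 * L + C + 10) * (N + 2) \<le> B"
  shows "runs B (find_minor t L)
    (2 + 1 + ((1 + length vs * (1 + time_bound read_vertex)) + (5 +
      ((1 + L * length vs * (1 + time_bound read_edge)) + (1 +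
        ((1 + ((5 * L + 3) * length vs + 1) * (1 + time_bound (search_step L))) + (1 +
          ((1 + length vs * (1 + time_bound discard_vertex)) + time_bound (write_minor t L)))))))))
    (writes_complete G t) (input_state vs es)"
proof -
  let ?n = "length vs"
  have Gs: "simple_graph G" "distinct vs" "set vs = verts G"
    "distinct (map (\<lambda>(u, v). {u, v}) es)" "set (map (\<lambda>(u, v). {u, v}) es) = edges G"
    using G unfolding lists_graph_def by auto
  have B': "5 * L * (N + 2) + C * (N + 2) + 10 * (N + 2) \<le> B"
    using B(2) by (simp add: algebra_simps)
  have B2: "2 * L \<le> B" "L \<le> B" "2 \<le> B" "?n < B" "N + 1 \<le> B" "?n + C \<le> B"
  proof -
    have "5 * L \<le> 5 * L * (N + 2)" "C \<le> C * (N + 2)" by simp_all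
    then have "5 * L + C + 10 * (N + 2) \<le> B" using B' by linarith
    then show "2 * L \<le> B" "L \<le> B" "2 \<le> B" "?n < B" "N + 1 \<le> B" "?n + C \<le> B"
      using N(2) by auto
  qed
  have "(5 * L) * ?n \<le> (5 * L) * (N + 2)" by (rule mult_le_mono2) (use N(2) in simp)
  then have f: "(5 * L + 3) * ?n + 1 \<le> B" "L * ?n \<le> B"
    using B' N(2) by (auto simp: algebra_simps)
  have "wp B (seqs [Const 8 1, Const 20 (2 * L)]) (vertices_read vs es L N 0) (input_state vs es)"
    using B2 by (simp add: vertices_read_def input_state_def cells_def)
  from runs_wp[OF this]
  have start: "runs B (seqs [Const 8 1, Const 20 (2 * L)]) (2 + 1) (vertices_read vs es L N 0) (input_state vs es)"
    by (simp add: numeral_3_eq_3)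
  show ?thesis unfolding find_minor_def
  proof (rule runs_Seq[OF start],
      rule runs_Seq[OF runs_While[where I = "\<lambda>f s. f \<le> ?n \<and> vertices_read vs es L N (?n - f) s"]])
    fix s assume "vertices_read vs es L N 0 s"
    then show "?n \<le> ?n \<and> vertices_read vs es L N (?n - ?n) s" by simp
  next
    fix f' s assume I: "f' \<le> ?n \<and> vertices_read vs es L N (?n - f') s" and h: "holds (Less 5 0) s"
    have f0: "f' > 0" "?n - f' < ?n" using I h by (auto simp: vertices_read_def)
    then have S: "?n - (f' - 1) = Suc (?n - f')" using I by linarith
    have "wp B read_vertex (vertices_read vs es L N (Suc (?n - f'))) s"
      by (rule wp_read_vertex[OF conjunct2[OF I] f0(2) N B2(5)])
    then show "0 < f' \<and> wp B read_vertex (\<lambda>s. f' - 1 \<le> ?n \<and> vertices_read vs es L N (?n - (f' - 1)) s) s"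
      using f0 I S by (auto intro: wp_mono)
  next
    fix s1 assume s1: "(\<exists>f'. f' \<le> ?n \<and> vertices_read vs es L N (?n - f') s1) \<and> \<not> holds (Less 5 0) s1"
    then obtain f' where f': "f' \<le> ?n" "vertices_read vs es L N (?n - f') s1" by blast
    then have "\<not> ?n - f' < ?n" using s1 by (auto simp: vertices_read_def)
    then have "?n - f' = ?n" by linarith
    then have r: "vertices_read vs es L N ?n s1" using f'(2) by simp
    \<comment> \<open>The bound on the names is found at run time, so the locale is available only
      after the vertices have been read.\<close>
    let ?M = "reg s1 3"
    have M: "?M \<le> N + 1" "set vs \<subseteq> {..<?M}"
      using r by (auto simp: vertices_read_def in_set_conv_nth)
    have MM: "?M * ?M \<le> B" using mult_le_mono[OF M(1) M(1)] B(1) by linarith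
    interpret minor_search G vs L ?M B
      by unfold_locales (use Gs M MM B2 n in auto)
    let ?s = "s1\<lparr>reg := (reg s1)(4 := ?n, 5 := 0, 12 := L, 21 := ?n * L)\<rparr>"
    have R: "reg s1 0 = ?n" "reg s1 2 = 0" "reg s1 6 = 0" "reg s1 7 = 0" "reg s1 8 = 1" "reg s1 20 = 2 * L"
      "reg s1 5 = ?n"
      "\<And>x. arr s1 9 x = (if x \<in> set vs then 1 else 0)" "\<And>i. i < ?n \<Longrightarrow> arr s1 10 i = vs ! i"
      "\<And>a. a \<notin> {9, 10} \<Longrightarrow> arr s1 a = arr (input_state vs es) a"
      using r by (auto simp: vertices_read_def)
    \<comment> \<open>Still untouched memory, which represents the edgeless graph.\<close>
    have z: "arr ?s 6 = (\<lambda>_. 0)" "arr ?s 7 = (\<lambda>_. 0)" "arr ?s 8 = (\<lambda>_. 0)"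
      using R(10) by (auto simp: input_state_def)
    have o: "output_ops ?s = []" using R(2) by (simp add: output_ops_def)
    have "graph_state (set vs, {}) ?s"
      unfolding graph_state_def
    proof (intro conjI)
      show "simple_graph (set vs, {})" by (simp add: simple_graph_def)
      show "env B ?M ?s" using R MM M(1) B2(5) by (simp add: env_def)
      show "rep ?M (nbrs (set vs, {})) ?s" unfolding rep_def z by (simp add: row_def nbrs_def)
      show "\<exists>H. spanning_subgraph (set vs, {}) H \<and> transforms (output_ops ?s) G H"
        unfolding o using Gs(3) by (intro exI[of _ G]) (simp add: spanning_subgraph_def)
      show "arr ?s 0 = cells vs" using R(10)[of 0] by (simp add: input_state_def)
      show "reg ?s 2 + card (verts (set vs, {} :: nat set set)) \<le> ?n" using R(2) by (simp add: card_length)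
    qed (use R in auto)
    then have e0: "edges_read es 0 ?s"
      unfolding edges_read_def using o R(3,9) R(10)[of 1] R(10)[of 2] by (simp add: input_state_def mult.commute)
    have "wp B (seqs [Arith 4 Plus 5 7, Const 5 0, Const 12 L, Arith 21 Times 0 12]) (edges_read es 0) s1"
      using e0 R B2 f by (simp add: mult.commute)
    from runs_wp[OF this]
    have start': "runs B (seqs [Arith 4 Plus 5 7, Const 5 0, Const 12 L, Arith 21 Times 0 12]) 5 (edges_read es 0) s1"
      by (simp add: eval_nat_numeral)
    show "runs B (Seq (seqs [Arith 4 Plus 5 7, Const 5 0, Const 12 L, Arith 21 Times 0 12]) (search_and_write t L))
      (5 + ((1 + L * ?n * (1 + time_bound read_edge)) + (1 +
        ((1 + ((5 * L + 3) * ?n + 1) * (1 + time_bound (search_step L))) + (1 +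
          ((1 + ?n * (1 + time_bound discard_vertex)) + time_bound (write_minor t L)))))))
      (writes_complete G t) s1"
      by (rule runs_Seq[OF start'], rule runs_search_and_write[OF _ n(1,3) Gs(4,5) t C B2(6) refl f(1)])
  qed
qed

theorem theorem1:
  fixes \<epsilon> :: real
  assumes "\<epsilon> > 0"
  shows "\<exists>t0 :: nat. \<forall>t \<ge> t0. \<exists>(p :: program) (c :: nat) (k :: nat).
    \<forall>(G :: nat graph) vs es.
      lists_graph vs es G \<and> average_degree G \<ge> (2 + \<epsilon>) * g t \<longrightarrow>
      (\<exists>T s H. exec (word_bound k vs es) p (input_state vs es) T s \<and>
         T \<le> c * card (verts G) \<and>
         transforms (output_ops s) G H \<and> isomorphic H (complete_graph t))"
proof (intro exI[of _ "nat \<lceil>2 / \<epsilon>\<rceil> + 3"] allI impI)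
  fix t :: nat assume t0: "nat \<lceil>2 / \<epsilon>\<rceil> + 3 \<le> t"
  then have t3: "t \<ge> 3" by simp
  \<comment> \<open>From \<open>g t > t - 2\<close> and the choice of the threshold,
    \<open>\<epsilon> * g t\<close> exceeds 2, hence \<open>2 * (g t + 1)\<close> is at most
    \<open>(2 + \<epsilon>) * g t\<close>. The summand 3 also ensures
    \<open>t \<ge> 3\<close>.\<close>
  have "2 / \<epsilon> \<le> real (nat \<lceil>2 / \<epsilon>\<rceil>)" by (rule real_nat_ceiling_ge)
  also have "\<dots> < g t" using g_properties(2)[OF t3] t0 by linarith
  finally have gt: "2 < \<epsilon> * g t" using assms by (simp add: field_simps)
  have g1: "g t > 1" using g_properties(2)[OF t3] t3 by linarith
  define L where "L = nat \<lceil>g t\<rceil>"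
  have L: "g t \<le> real L" "real L \<le> g t + 1" "L \<ge> 1" using g1 unfolding L_def by linarith+
  have dense: "minor (complete_graph t) K"
    if K: "simple_graph K" "verts K \<noteq> {}" "L * card (verts K) \<le> 2 * card (edges K)" for K :: "nat graph"
  proof -
    have "card (verts K) > 0" using K simple_finite_verts card_gt_0_iff by blast
    moreover have "real L * real (card (verts K)) \<le> 2 * real (card (edges K))"
      using K(3) by (metis of_nat_le_iff of_nat_mult of_nat_numeral)
    ultimately have "real L \<le> average_degree K" by (simp add: average_degree_def field_simps)
    then show ?thesis using g_properties(1)[OF t3 K(1)] L(1) by linarith
  qed
  obtain C where C: "\<And>m R. m \<le> 2 * L \<Longrightarrow> R \<subseteq> {..<m} \<times> {..<m} \<Longrightarrow> length (complete_ops t m R) \<le> C"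
    using complete_ops_bounded[of "2 * L" t] by blast
  \<comment> \<open>In the running time, \<open>a + 4\<close> collects the constant terms and
    \<open>b\<close> the coefficient of the number of vertices.\<close>
  define a where "a = 11 + time_bound (search_step L) + time_bound (write_minor t L)"
  define b where "b = (1 + time_bound read_vertex) + L * (1 + time_bound read_edge) +
    (5 * L + 3) * (1 + time_bound (search_step L)) + (1 + time_bound discard_vertex)"
  define D where "D = 5 * L + C + 10"
  show "\<exists>(p :: program) (c :: nat) (k :: nat). \<forall>(G :: nat graph) vs es.
      lists_graph vs es G \<and> average_degree G \<ge> (2 + \<epsilon>) * g t \<longrightarrow>
      (\<exists>T s H. exec (word_bound k vs es) p (input_state vs es) T s \<and>
         T \<le> c * card (verts G) \<and>
         transforms (output_ops s) G H \<and> isomorphic H (complete_graph t))"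
  proof (rule exI[of _ "find_minor t L"], rule exI[of _ "a + 4 + b"], rule exI[of _ "D + 2"],
      intro allI impI)
    fix G :: "nat graph" and vs es
    assume G: "lists_graph vs es G \<and> average_degree G \<ge> (2 + \<epsilon>) * g t"
    let ?B = "word_bound (D + 2) vs es" let ?n = "length vs"
    have Gs: "simple_graph G" "distinct vs" "set vs = verts G"
      "distinct (map (\<lambda>(u, v). {u, v}) es)" "set (map (\<lambda>(u, v). {u, v}) es) = edges G"
      using G unfolding lists_graph_def by auto
    have nV: "?n = card (verts G)" using distinct_card[OF Gs(2)] Gs(3) by simp
    have nE: "length es = card (edges G)" using distinct_card[OF Gs(4)] Gs(5) by simp
    have "(2 + \<epsilon>) * g t > 0" using assms g1 by simp
    \<comment> \<open>The empty graph is excluded because its average degree is \<open>0\<close> by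
      division by zero.\<close>
    then have n0: "card (verts G) > 0" using G by (auto simp: average_degree_def intro: Nat.gr0I)
    have "2 * real L \<le> (2 + \<epsilon>) * g t" using L(2) gt by (simp add: algebra_simps)
    also have "\<dots> \<le> 2 * real (card (edges G)) / real (card (verts G))"
      using G by (simp add: average_degree_def)
    finally have "real L * real (card (verts G)) \<le> real (card (edges G))" using n0 by (simp add: field_simps)
    then have LE: "L * ?n \<le> length es" unfolding nV nE by (metis of_nat_le_iff of_nat_mult)
    define N where "N = Max ({?n, length es} \<union> set vs)"
    have "x \<le> N" if "x \<in> {?n, length es} \<union> set vs" for x
      unfolding N_def by (rule Max_ge[OF _ that]) simp
    then have N: "set vs \<subseteq> {..N}" "?n \<le> N" by auto
    have B: "?B = (N + 2) ^ D * (N + 2)\<^sup>2" unfolding word_bound_def N_def by (rule power_add)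
    \<comment> \<open>Turns the constant factor \<open>D\<close> into a power of
      \<open>N + 2\<close>, which is at least 2; two more factors provide for the square.\<close>
    have "D < 2 ^ D" by simp
    also have "2 ^ D \<le> (N + 2) ^ D" by (rule power_mono) simp_all
    finally have "(D + 1) * (N + 2)\<^sup>2 \<le> ?B" unfolding B by (intro mult_le_mono1) simp
    moreover have "(N + 1) * (N + 1) \<le> (N + 2)\<^sup>2" "N + 2 \<le> (N + 2)\<^sup>2" by (simp_all add: power2_eq_square)
    moreover from this have "D * (N + 2) \<le> D * (N + 2)\<^sup>2" by (intro mult_le_mono2)
    ultimately have B': "(N + 1) * (N + 1) \<le> ?B" "D * (N + 2) \<le> ?B" by auto
    have B3: "(5 * L + C + 10) * (N + 2) \<le> ?B" using B'(2) by (simp only: D_def)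
    have "vs \<noteq> []" using n0 nV by auto
    from runs_find_minor[OF conjunct1[OF G] this L(3) LE dense C N B'(1) B3]
    obtain T s H where T: "exec ?B (find_minor t L) (input_state vs es) T s"
      "T \<le> 2 + 1 + ((1 + ?n * (1 + time_bound read_vertex)) + (5 +
        ((1 + L * ?n * (1 + time_bound read_edge)) + (1 +
          ((1 + ((5 * L + 3) * ?n + 1) * (1 + time_bound (search_step L))) + (1 +
            ((1 + ?n * (1 + time_bound discard_vertex)) + time_bound (write_minor t L))))))))"
      "transforms (output_ops s) G H" "isomorphic H (complete_graph t)"
      unfolding runs_def by blast
    \<comment> \<open>There is at least one vertex, so the constant terms are absorbed into the
      linear one.\<close>
    have "(a + 4) * 1 \<le> (a + 4) * ?n" by (rule mult_le_mono2) (use n0 nV in simp)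
    then have "(a + 4) + b * ?n \<le> (a + 4 + b) * ?n" unfolding add_mult_distrib[of "a + 4" b] by simp
    moreover have "T \<le> (a + 4) + b * ?n" using T(2) unfolding a_def b_def by (simp add: algebra_simps)
    ultimately have "T \<le> (a + 4 + b) * card (verts G)" unfolding nV by linarith
    then show "\<exists>T s H. exec (word_bound (D + 2) vs es) (find_minor t L) (input_state vs es) T s \<and>
      T \<le> (a + 4 + b) * card (verts G) \<and> transforms (output_ops s) G H \<and> isomorphic H (complete_graph t)"
      using T by blast
  qed
qed

end
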